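(* Let $R=R(q)$ be a function of the positive integer $q$ with $R(q)<\frac12$, and suppose there exist $\delta>0$ and $c>0$ such that $R(q)\ge c\,q^{-\frac12+\delta}$ for all sufficiently large $q$. Then for every fixed $\varepsilon>0$, \[\lim_{q\to\infty}\mathrm{vol}\left(\left\{y\in\mathbb{T}^2:\left|\mu_q(B_R(y))-\mathrm{vol}(B_R)\right|>\varepsilon\,\mathrm{vol}(B_R)\right\}\right)=0.\]
   Context: $\mathbb{T}^2=(\mathbb{R}/\mathbb{Z})^2$ carries the flat metric induced from $\mathbb{R}^2$ and Lebesgue (Haar) probability measure $\mathrm{vol}$. For $y\in\mathbb{T}^2$ and $0<R<\frac12$, $B_R(y)$ is the geodesic ball of radius $R$ centred at $y$, and $\mathrm{vol}(B_R)=\pi R^2$. For a positive integer $q$, $\varphi(q)=\#(\mathbb{Z}/q\mathbb{Z})^\times$, and for $d\in(\mathbb{Z}/q\mathbb{Z})^\times$, $\overline{d}$ denotes its multiplicative inverse modulo $q$. The probability measure $\mu_q$ on $\mathbb{T}^2$ is $\mu_q(B)=\frac{1}{\varphi(q)}\#\{d\in(\mathbb{Z}/q\mathbb{Z})^\times:(d/q,\overline{d}/q)\in B\}$ for Borel $B\subset\mathbb{T}^2$. *)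

theory Defs
  imports
    "HOL-Analysis.Analysis"
    "HOL-Probability.Probability"
    "HOL-Number_Theory.Totient"
    "HOL-Number_Theory.Modular_Inverse"
begin

section \<open>The circle \<open>\<real>/\<int>\<close>\<close>

quotient_type circle = real / "\<lambda>x y. x - y \<in> (\<int> :: real set)"
  morphisms rep_circle to_circle
proof (rule equivpI)
  show "reflp (\<lambda>x y. x - y \<in> (\<int> :: real set))"
    by (rule reflpI) simp
  show "symp (\<lambda>x y. x - y \<in> (\<int> :: real set))"
    by (rule sympI) (metis Ints_minus minus_diff_eq)
  show "transp (\<lambda>x y. x - y \<in> (\<int> :: real set))"
  proof (rule transpI)
    fix x y z :: real
    assume "x - y \<in> \<int>" "y - z \<in> \<int>"
    then have "(x - y) + (y - z) \<in> \<int>" by (rule Ints_add)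
    then show "x - z \<in> \<int>" by simp
  qed
qed

lemma to_circle_eq_iff: "to_circle x = to_circle y \<longleftrightarrow> x - y \<in> \<int>"
  by (rule circle.abs_eq_iff)

lemma infdist_Ints_attained:
  obtains n :: real where "n \<in> \<int>" "infdist t \<int> = \<bar>t - n\<bar>"
proof (rule infdist_attains_inf[of "\<int> :: real set" t])
  show "(\<int> :: real set) \<noteq> {}"
    using Ints_0 by blast
qed (auto simp: dist_real_def intro: that)

lemma infdist_Ints_le: "n \<in> \<int> \<Longrightarrow> infdist t \<int> \<le> \<bar>t - (n :: real)\<bar>"
  using infdist_le[of n \<int> t] by (simp add: dist_real_def)

lemma infdist_Ints_triangle:
  "infdist (x - y) (\<int> :: real set) \<le> infdist (x - z) \<int> + infdist (y - z) \<int>"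
proof -
  obtain m where m: "m \<in> \<int>" "infdist (x - z) \<int> = \<bar>x - z - m\<bar>"
    by (rule infdist_Ints_attained)
  obtain n where n: "n \<in> \<int>" "infdist (y - z) \<int> = \<bar>y - z - n\<bar>"
    by (rule infdist_Ints_attained)
  have "infdist (x - y) (\<int> :: real set) \<le> \<bar>x - y - (m - n)\<bar>"
    using m n by (intro infdist_Ints_le) auto
  with m n show ?thesis
    by linarith
qed

lemma infdist_Ints_cong:
  assumes "x - x' \<in> (\<int> :: real set)"
  shows "infdist x \<int> = infdist x' \<int>"
proof -
  have *: "infdist a \<int> \<le> infdist b \<int>" if ab: "a - b \<in> (\<int> :: real set)" for a b :: real
  proof -
    obtain n where n: "n \<in> \<int>" "infdist b \<int> = \<bar>b - n\<bar>"
      by (rule infdist_Ints_attained)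
    have "infdist a (\<int> :: real set) \<le> \<bar>a - (n + (a - b))\<bar>"
      using n ab by (intro infdist_Ints_le Ints_add)
    with n show ?thesis by simp
  qed
  have "x' - x \<in> (\<int> :: real set)"
    using assms by (metis Ints_minus minus_diff_eq)
  with * assms show ?thesis
    by (meson order_antisym)
qed

instantiation circle :: metric_space
begin

text \<open>
  The quotient metric: the distance of two classes is the least \<open>\<bar>x - y - n\<bar>\<close> with \<open>n\<close> an
  integer.  The product metric of type \<^typ>\<open>circle \<times> circle\<close> is Euclidean, so this makes
  \<^typ>\<open>circle \<times> circle\<close> the flat torus, \<^const>\<open>dist\<close> its geodesic distance and
  \<^const>\<open>ball\<close> its (open) geodesic ball.
\<close>

lift_definition dist_circle :: "circle \<Rightarrow> circle \<Rightarrow> real" is "\<lambda>x y. infdist (x - y) \<int>"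
proof -
  fix x x' y y' :: real
  assume "x - x' \<in> \<int>" "y - y' \<in> \<int>"
  then have "(x - x') - (y - y') \<in> \<int>" by (rule Ints_diff)
  then show "infdist (x - y) \<int> = infdist (x' - y') \<int>"
    by (intro infdist_Ints_cong) (simp add: algebra_simps)
qed

definition uniformity_circle :: "(circle \<times> circle) filter" where
  "uniformity_circle = (INF e\<in>{0<..}. principal {(x, y). dist x y < e})"

definition open_circle :: "circle set \<Rightarrow> bool" where
  "open_circle U \<longleftrightarrow> (\<forall>x\<in>U. \<forall>\<^sub>F (x', y) in uniformity. x' = x \<longrightarrow> y \<in> U)"

instance
proof
  fix x y z :: circle
  show "dist x y = 0 \<longleftrightarrow> x = y"
  proof transfer
    fix x y :: real
    show "infdist (x - y) \<int> = 0 \<longleftrightarrow> x - y \<in> \<int>"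
      using in_closed_iff_infdist_zero[OF closed_Ints, of "x - y"] Ints_0 by blast
  qed
  show "dist x y \<le> dist x z + dist y z"
    by transfer (rule infdist_Ints_triangle)
qed (rule uniformity_circle_def open_circle_def)+

end

lemma dist_to_circle: "dist (to_circle x) (to_circle y) = infdist (x - y) \<int>"
  by (rule dist_circle.abs_eq)

lemma dist_to_circle_le: "dist (to_circle x) (to_circle y) \<le> dist x y"
  using infdist_Ints_le[of 0 "x - y"] by (simp add: dist_to_circle dist_real_def)

lemma continuous_on_to_circle: "continuous_on A to_circle"
  unfolding continuous_on_iff using dist_to_circle_le by (meson le_less_trans)


section \<open>The torus and its Haar measure\<close>

type_synonym torus = "circle \<times> circle"

definition to_torus :: "real \<times> real \<Rightarrow> torus" where
  "to_torus p = (to_circle (fst p), to_circle (snd p))"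

lemma to_torus_measurable [measurable]: "to_torus \<in> borel_measurable borel"
proof (rule borel_measurable_continuous_onI)
  show "continuous_on UNIV to_torus"
    unfolding to_torus_def
    by (intro continuous_on_Pair continuous_on_compose2[OF continuous_on_to_circle]
        continuous_intros) auto
qed

text \<open>
  Lebesgue measure on a fundamental domain, pushed to the torus.
\<close>

definition torus_vol :: "torus measure" where
  "torus_vol = distr (uniform_measure lborel ({0..<1} \<times> {0..<1})) borel to_torus"

lemma sets_torus_vol [simp, measurable_cong]: "sets torus_vol = sets borel"
  by (simp add: torus_vol_def)

lemma space_torus_vol [simp]: "space torus_vol = UNIV"
  by (simp add: torus_vol_def)

lemma emeasure_unit_square: "emeasure lborel ({0..<1::real} \<times> {0..<1::real}) = 1"
  by (simp add: lborel_prod[symmetric] lborel.emeasure_pair_measure_Times)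

lemma prob_space_torus_vol: "prob_space torus_vol"
  unfolding torus_vol_def
  by (intro prob_space.prob_space_distr prob_space_uniform_measure)
    (auto simp: emeasure_unit_square)

lemma emeasure_torus_vol:
  assumes "B \<in> sets borel"
  shows "emeasure torus_vol B = emeasure lborel {p \<in> {0..<1} \<times> {0..<1}. to_torus p \<in> B}"
proof -
  have [measurable]: "B \<in> sets borel" by fact
  have "to_torus -` B \<in> sets borel"
    using measurable_sets[OF to_torus_measurable assms] by simp
  moreover have "({0..<1} \<times> {0..<1}) \<inter> to_torus -` B = {p \<in> {0..<1} \<times> {0..<1}. to_torus p \<in> B}"
    by auto
  ultimately show ?thesis
    using assms unfolding torus_vol_def
    by (subst emeasure_distr)
      (auto simp: emeasure_unit_square borel_Times divide_ennreal_def)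
qed


section \<open>The measure \<open>\<mu>\<^sub>q\<close>\<close>

text \<open>
  The unit group modulo \<open>q\<close> is represented by \<^term>\<open>totatives q\<close>.  The inverse is taken in
  \<^typ>\<open>int\<close>, since \<^const>\<open>modular_inverse\<close> has its specification only on rings.
\<close>

definition inverse_point :: "nat \<Rightarrow> nat \<Rightarrow> torus" where
  "inverse_point q d =
     to_torus (real d / real q, real_of_int (modular_inverse (int q) (int d)) / real q)"

definition mu :: "nat \<Rightarrow> torus measure" where
  "mu q = distr (uniform_count_measure (totatives q)) borel (inverse_point q)"

lemma measure_mu:
  assumes "B \<in> sets borel"
  shows "measure (mu q) B = real (card {d \<in> totatives q. inverse_point q d \<in> B}) / real (totient q)"
proof -
  have "inverse_point q \<in> uniform_count_measure (totatives q) \<rightarrow>\<^sub>M borel"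
    by (auto simp: measurable_def space_uniform_count_measure sets_uniform_count_measure)
  then have "measure (mu q) B =
      measure (uniform_count_measure (totatives q)) (inverse_point q -` B \<inter> totatives q)"
    unfolding mu_def using assms
    by (subst measure_distr) (auto simp: space_uniform_count_measure)
  also have "\<dots> = card (inverse_point q -` B \<inter> totatives q) / card (totatives q)"
    by (intro measure_uniform_count_measure) auto
  also have "inverse_point q -` B \<inter> totatives q = {d \<in> totatives q. inverse_point q d \<in> B}"
    by auto
  finally show ?thesis
    by (simp add: totient_def)
qed

lemma sets_mu [simp, measurable_cong]: "sets (mu q) = sets borel"
  by (simp add: mu_def)

lemma prob_space_mu:
  assumes "q > 0"
  shows "prob_space (mu q)"
proof -
  have "prob_space (uniform_count_measure (totatives q))"
    using assms by (intro prob_space_uniform_count_measure) auto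
  moreover have "inverse_point q \<in> uniform_count_measure (totatives q) \<rightarrow>\<^sub>M borel"
    by (auto simp: measurable_def space_uniform_count_measure sets_uniform_count_measure)
  ultimately show ?thesis
    unfolding mu_def by (rule prob_space.prob_space_distr)
qed

end

(*
  The argument is elementary: no individual Kloosterman sum K(m, n) is estimated.

  Smooth mu_q by a Jackson kernel whose frequencies have size at most N = q^(1/2 - delta/2).  The
  kernel is concentrated at scale 1/N, far below R, so mu_q(B_R(y)) is sandwiched between smoothed
  measures of slightly smaller and larger discs, up to errors that are small in L^1.  The smoothed
  measure has a density W, and by Parseval the L^2 norm of W - 1 is at most the sum of
  |K(m, n)|^2 / phi(q)^2 over nonzero |m|, |n| <= N.

  Since K(m u, n u^-1) = K(m, n), that sum can be averaged over the units u.  Cauchy-Schwarz bounds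
  it by the number of coincidences (m u, n u^-1) = (m' u', n' u'^-1) mod q, times the complete
  fourth moment of K.  A coincidence forces m n = m' n' because 2 N^2 < q, so the divisor bound
  applies.  The fourth moment counts units with a + b = c + d and 1/a + 1/b = 1/c + 1/d, that is
  (a + b)(a - d)(b - d) = 0 mod q, which again is a divisor count.
*)

theory Submission
  imports Defs "HOL-Real_Asymp.Real_Asymp"
begin

text \<open>The obstacle is relative precision: the area of the disc tends to 0 in the critical
  range, almost as fast as 1/q, so a uniform o(1) error would be useless. Averaging over the centre
  helps: the mean over \<open>y\<close> of each error term carries the factor
  \<open>disc_vol R\<close>, so Markov's inequality bounds the exceptional set by the L^1 error of
  the density and the kernel tail alone.

  Two constraints frame N: the comparison of products needs 2 N^2 < q, the kernel needs N R to tend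
  to infinity. At N about q^(1/2 - delta/2) both hold with a power to spare. Weil's bound would make
  the mean square of W - 1 about N^2/q up to q^o(1); the fourth moment gives only the square root of
  this, but for the same range of N, and N^2/q = q^(-delta) is small enough. The zero frequency may
  stay in the complete fourth moment, since its share phi(q)^4 does not exceed the order q^(4 +
  o(1)) of the bound. The other losses are nine divisor counts, which together cost
  q^(delta/2).\<close>

section \<open>Units modulo \<open>q\<close> with equal sums and equal sums of inverses\<close>

text \<open>The members of \<open>A\<close> share one residue modulo \<open>L\<close>, so the
  quotient \<open>(x - c) div L\<close> separates them, and it takes at most \<open>n div L\<close>
  values.\<close>

lemma card_congruent_le:
  fixes A :: "int set" and L n c :: int
  assumes "A \<subseteq> {c..<c + n}" "n \<ge> 0" "L > 0" "L dvd n"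
    and "\<And>x y. x \<in> A \<Longrightarrow> y \<in> A \<Longrightarrow> L dvd x - y"
  shows "int (card A) * L \<le> n"
proof -
  obtain k where k: "n = L * k" using assms(4) by blast
  have "inj_on (\<lambda>x. (x - c) div L) A"
  proof (rule inj_onI)
    fix x y assume xy: "x \<in> A" "y \<in> A" "(x - c) div L = (y - c) div L"
    have "(x - c) mod L = (y - c) mod L"
      using assms(5)[OF xy(1,2)] by (simp add: mod_eq_dvd_iff)
    then have "x - c = y - c" using xy(3) by (metis div_mult_mod_eq)
    then show "x = y" by simp
  qed
  moreover have "(\<lambda>x. (x - c) div L) ` A \<subseteq> {0..<k}"
  proof (clarsimp, rule conjI)
    fix x assume "x \<in> A"
    then have "0 \<le> x - c" "x - c < L * k" using assms(1) k by auto
    then show "0 \<le> (x - c) div L" "(x - c) div L < k"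
      using assms(3) by (simp_all add: pos_imp_zdiv_nonneg_iff) (smt (verit, del_insts) mult.commute div_mod_decomp_int mult_right_less_imp_less pos_mod_sign)
  qed
  ultimately have "card A \<le> nat k"
    using card_inj_on_le[of "\<lambda>x. (x - c) div L" A "{0..<k}"] by simp
  show ?thesis
  proof (cases "A = {}")
    case True
    with \<open>n \<ge> 0\<close> show ?thesis by simp
  next
    case False
    then obtain x where "x \<in> A" by blast
    with assms(1) have "n > 0" by auto
    then have "k > 0" using k assms(3) by (simp add: zero_less_mult_iff)
    then show ?thesis
      using \<open>card A \<le> nat k\<close> k assms(3) by (simp add: mult.commute nat_le_iff le_nat_iff)
  qed
qed

text \<open>Integers rather than naturals, because differences and modular inverses are taken
  throughout. Representatives lie in 1..q, not 0..q - 1: for \<open>q = 1\<close> the only unit is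
  1.\<close>

definition units_mod :: "nat \<Rightarrow> int set" where
  "units_mod q = int ` totatives q"

abbreviation inv_mod :: "nat \<Rightarrow> int \<Rightarrow> int" where
  "inv_mod q d \<equiv> modular_inverse (int q) d"

lemma units_mod_subset: "units_mod q \<subseteq> {1..<1 + int q}"
  by (auto simp: units_mod_def in_totatives_iff)

lemma finite_units_mod [simp]: "finite (units_mod q)"
  by (simp add: units_mod_def)

lemma card_units_mod: "card (units_mod q) = totient q"
  by (simp add: units_mod_def card_image totient_def)

lemma coprime_units_mod: "d \<in> units_mod q \<Longrightarrow> coprime d (int q)"
  by (auto simp: units_mod_def in_totatives_iff)

lemma inv_mod_dvd:
  assumes "d \<in> units_mod q"
  shows "int q dvd d * inv_mod q d - 1"
  using cong_modular_inverse1[OF coprime_units_mod[OF assms]] by (simp add: cong_iff_dvd_diff)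

lemma units_mod_eqI:
  assumes "x \<in> units_mod q" "y \<in> units_mod q" "int q dvd x - y"
  shows "x = y"
proof -
  have "x \<in> {1..<1 + int q}" "y \<in> {1..<1 + int q}" using assms units_mod_subset by blast+
  then have "\<bar>x - y\<bar> < int q" by auto
  with assms(3) show ?thesis by (metis dvd_imp_le_int abs_of_nat not_less eq_iff_diff_eq_0)
qed

text \<open>As \<open>q\<close> may be composite, the product cannot be split into alternatives such
  as \<open>a = d\<close>; the divisibility is kept whole and distributed over gcds later.\<close>

lemma inv_mod_sum_factor:
  assumes U: "a \<in> units_mod q" "b \<in> units_mod q" "c \<in> units_mod q" "d \<in> units_mod q"
    and s: "int q dvd (a + b) - (c + d)"
    and t: "int q dvd (inv_mod q a + inv_mod q b) - (inv_mod q c + inv_mod q d)"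
  shows "int q dvd (a + b) * (a - d) * (b - d)"
proof -
  obtain ka where ka: "a * inv_mod q a = 1 + int q * ka" using inv_mod_dvd[OF U(1)] by (auto simp: dvd_def algebra_simps)
  obtain kb where kb: "b * inv_mod q b = 1 + int q * kb" using inv_mod_dvd[OF U(2)] by (auto simp: dvd_def algebra_simps)
  obtain kc where kc: "c * inv_mod q c = 1 + int q * kc" using inv_mod_dvd[OF U(3)] by (auto simp: dvd_def algebra_simps)
  obtain kd where kd: "d * inv_mod q d = 1 + int q * kd" using inv_mod_dvd[OF U(4)] by (auto simp: dvd_def algebra_simps)
  obtain X where X: "(a + b) - (c + d) = int q * X" using s by blast
  obtain Y where Y: "(inv_mod q a + inv_mod q b) - (inv_mod q c + inv_mod q d) = int q * Y" using t by blast
  have "b*c*d*(a*inv_mod q a) + a*c*d*(b*inv_mod q b) - a*b*d*(c*inv_mod q c) - a*b*c*(d*inv_mod q d)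
       = a*b*c*d*(int q * Y)"
    unfolding Y[symmetric] by (simp add: algebra_simps)
  then have "b*c*d + a*c*d - a*b*d - a*b*c = int q * (a*b*c*d*Y - b*c*d*ka - a*c*d*kb + a*b*d*kc + a*b*c*kd)"
    unfolding ka kb kc kd by (simp add: algebra_simps)
  \<comment> \<open>Modulo \<open>q\<close> the previous line says that
    \<open>(a + b)cd - ab(c + d)\<close> vanishes. Replacing \<open>c + d\<close> by
    \<open>a + b\<close> leaves \<open>(a + b)(cd - ab)\<close>, and \<open>c = a + b - d\<close>
    gives \<open>cd - ab = -(a - d)(b - d)\<close>.\<close>
  moreover have "(a + b) * (a - d) * (b - d) = int q * X * (a*b - d*(a+b)) - (b*c*d + a*c*d - a*b*d - a*b*c)"
    unfolding X[symmetric] by (simp add: algebra_simps)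
  ultimately show ?thesis by simp
qed

text \<open>
  As \<open>(a + b) - (a - e) - (b - e) = 2 e\<close>, a common divisor of the three moduli divides 2; this is
  why the three conditions are almost independent.
\<close>

lemma card_divisibility_triple_le:
  fixes g1 g2 g3 e n :: int
  assumes g: "g1 > 0" "g2 > 0" "g3 > 0" "g1 dvd n" "g2 dvd n" "g3 dvd n" and n: "n > 0"
    and co: "coprime e n" and prod: "n dvd g1 * g2 * g3"
  shows "card {(a, b). a \<in> {1..<1 + n} \<and> b \<in> {1..<1 + n} \<and> g1 dvd a - e \<and> g2 dvd b - e \<and> g3 dvd a + b} \<le> 2 * n"
    (is "int (card ?S) \<le> _")
proof -
  \<comment> \<open>\<open>h\<close> is what the two conditions on \<open>b\<close> force on
    \<open>a\<close> alone: it divides \<open>(a + b) - (b - e) = a + e\<close>. With this condition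
    included, \<open>A\<close> has at most \<open>n / lcm g1 h\<close> members and each fibre
    \<open>B a\<close> at most \<open>n / lcm g2 g3\<close>.\<close>
  define h where "h = gcd g2 g3"
  define A where "A = {a \<in> {1..<1 + n}. g1 dvd a - e \<and> h dvd a + e}"
  define B where "B = (\<lambda>a. {b \<in> {1..<1 + n}. g2 dvd b - e \<and> g3 dvd a + b})"
  have fin: "finite A" "\<And>a. finite (B a)" unfolding A_def B_def by (auto intro: finite_subset[of _ "{1..<1 + n}"])
  have h: "h > 0" "h dvd g2" "h dvd g3" "h dvd n" using g by (auto simp: h_def intro: dvd_trans)
  have sub: "{(a, b). a \<in> {1..<1 + n} \<and> b \<in> {1..<1 + n} \<and> g1 dvd a - e \<and> g2 dvd b - e \<and> g3 dvd a + b}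
     \<subseteq> Sigma A B"
  proof (clarsimp simp: A_def B_def)
    fix a b assume "g2 dvd b - e" "g3 dvd a + b"
    then have "h dvd b - e" "h dvd a + b" using h by (auto intro: dvd_trans)
    then have "h dvd (a + b) - (b - e)" by (rule dvd_diff[rotated])
    then show "h dvd a + e" by (simp add: algebra_simps)
  qed
  have cardB: "int (card (B a)) * lcm g2 g3 \<le> n" for a
  proof (rule card_congruent_le)
    show "B a \<subseteq> {1..<1 + n}" by (auto simp: B_def)
    show "n \<ge> 0" using n by simp
    show "lcm g2 g3 > 0" using g by (metis lcm_pos_int less_irrefl)
    show "lcm g2 g3 dvd n" using g by simp
    fix x y assume "x \<in> B a" "y \<in> B a"
    then have "g2 dvd (x - e) - (y - e)" "g3 dvd (a + x) - (a + y)" unfolding B_def by (blast intro: dvd_diff)+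
    then show "lcm g2 g3 dvd x - y" by (simp add: lcm_least)
  qed
  have cardA: "int (card A) * lcm g1 h \<le> n"
  proof (rule card_congruent_le)
    show "A \<subseteq> {1..<1 + n}" by (auto simp: A_def)
    show "n \<ge> 0" using n by simp
    show "lcm g1 h > 0" using g h by (metis lcm_pos_int less_irrefl)
    show "lcm g1 h dvd n" using g h by simp
    fix x y assume "x \<in> A" "y \<in> A"
    then have "g1 dvd (x - e) - (y - e)" "h dvd (x + e) - (y + e)" unfolding A_def by (blast intro: dvd_diff)+
    then show "lcm g1 h dvd x - y" by (simp add: lcm_least)
  qed
  show ?thesis
  \<comment> \<open>A member of \<open>A\<close> is needed to see that \<open>gcd g1 h\<close>
    divides \<open>2 * e\<close>. If the congruences for \<open>a\<close> are incompatible, this gcd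
    may be large, but then there is nothing to count.\<close>
  proof (cases "A = {}")
    case True
    then have "?S = {}" using sub by blast
    then have "card ?S = 0" by (simp only: card.empty)
    then show ?thesis using n by linarith
  next
    case False
    then obtain x where x: "g1 dvd x - e" "h dvd x + e" by (auto simp: A_def)
    have "gcd g1 h dvd (x + e) - (x - e)"
      using x by (metis dvd_diff dvd_trans gcd_dvd1 gcd_dvd2)
    then have "gcd g1 h dvd 2 * e" by (simp add: algebra_simps)
    moreover have "coprime (gcd g1 h) e"
    proof -
      have "gcd g1 h dvd n" using g(4) by (meson dvd_trans gcd_dvd1)
      then show ?thesis using co by (metis coprime_commute coprime_divisors dvd_refl)
    qed
    ultimately have "gcd g1 h dvd 2" by (metis coprime_dvd_mult_left_iff mult.commute)
    then have gle: "gcd g1 h \<le> 2" by (simp add: zdvd_imp_le)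
    have e1: "gcd g1 h * lcm g1 h = g1 * h" using g h by (simp add: prod_gcd_lcm_int)
    have e2: "h * lcm g2 g3 = g2 * g3" using g by (simp add: h_def prod_gcd_lcm_int)
    have lp: "lcm g1 h > 0" "lcm g2 g3 > 0" using g h by (metis lcm_pos_int less_irrefl)+
    have "n \<le> g1 * g2 * g3" using prod g by (simp add: zdvd_imp_le)
    also have "\<dots> = gcd g1 h * lcm g1 h * lcm g2 g3" using e1 e2 by (metis mult.assoc)
    also have "\<dots> \<le> 2 * (lcm g1 h * lcm g2 g3)" using gle lp by (simp only: mult.assoc) (intro mult_right_mono, auto)
    finally have nle: "n \<le> 2 * (lcm g1 h * lcm g2 g3)" .
    have "card (Sigma A B) = (\<Sum>a\<in>A. card (B a))" using fin by simp
    then have "int (card (Sigma A B)) * (lcm g1 h * lcm g2 g3) = lcm g1 h * (\<Sum>a\<in>A. int (card (B a)) * lcm g2 g3)"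
      by (simp add: sum_distrib_right sum_distrib_left ac_simps)
    also have "\<dots> \<le> lcm g1 h * (\<Sum>a\<in>A. n)"
      using lp cardB by (intro mult_left_mono sum_mono) auto
    also have "\<dots> = n * (int (card A) * lcm g1 h)" by simp
    also have "\<dots> \<le> n * n" using cardA n by simp
    also have "\<dots> \<le> n * (2 * (lcm g1 h * lcm g2 g3))" using nle n by simp
    finally have "int (card (Sigma A B)) * (lcm g1 h * lcm g2 g3) \<le> (2 * n) * (lcm g1 h * lcm g2 g3)"
      by (simp add: algebra_simps)
    then have "int (card (Sigma A B)) \<le> 2 * n" using lp by (simp add: mult_le_cancel_right)
    moreover have "card ?S \<le> card (Sigma A B)"
      using fin by (intro card_mono[OF _ sub]) auto
    ultimately show ?thesis by simp
  qed
qed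

definition divisor_count :: "nat \<Rightarrow> nat" where
  "divisor_count n = card {d. d dvd n}"

definition unit_quadruples :: "nat \<Rightarrow> ((int \<times> int) \<times> (int \<times> int)) set" where
  "unit_quadruples q = {((a, b), (c, d)).
     a \<in> units_mod q \<and> b \<in> units_mod q \<and> c \<in> units_mod q \<and> d \<in> units_mod q \<and>
     int q dvd (a + b) - (c + d) \<and>
     int q dvd (inv_mod q a + inv_mod q b) - (inv_mod q c + inv_mod q d)}"

text \<open>\<open>c\<close> is determined by \<open>a\<close>, \<open>b\<close>, \<open>d\<close>,
  since distinct units are incongruent. For fixed \<open>d\<close>, the gcds with \<open>q\<close>
  of the three factors from \<open>inv_mod_sum_factor\<close> form one of at most
  \<open>divisor_count q ^ 3\<close> patterns, each admitting at most \<open>2 * q\<close> pairs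
  \<open>(a, b)\<close>.\<close>

lemma card_unit_quadruples_le:
  assumes q: "q > 0"
  shows "card (unit_quadruples q) \<le> totient q * (divisor_count q ^ 3 * (2 * q))"
proof -
  define D where "D = {d. d dvd q}"
  define S where "S = (\<lambda>d (g1::nat, g2::nat, g3::nat). {(a, b). a \<in> {1..<1 + int q} \<and> b \<in> {1..<1 + int q} \<and>
     int g1 dvd a - d \<and> int g2 dvd b - d \<and> int g3 dvd a + b})"
  define E where "E = {(g1, g2, g3). g1 \<in> D \<and> g2 \<in> D \<and> g3 \<in> D \<and> q dvd g1 * g2 * g3}"
  have finD: "finite D" using q by (simp add: D_def)
  have E_sub: "E \<subseteq> D \<times> D \<times> D" by (auto simp: E_def)
  then have finE: "finite E" using finD by (meson finite_SigmaI finite_subset)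
  have cardE: "card E \<le> divisor_count q ^ 3"
    using card_mono[OF _ E_sub] finD
    by (simp add: divisor_count_def D_def[symmetric] card_cartesian_product power3_eq_cube mult.assoc)
  have finS: "finite (S d g)" for d g
    unfolding S_def by (cases g) (auto intro: finite_subset[of _ "{1..<1 + int q} \<times> {1..<1 + int q}"])
  have cardS: "card (S d g) \<le> 2 * q" if "d \<in> units_mod q" "g \<in> E" for d g
  proof -
    obtain g1 g2 g3 where g: "g = (g1, g2, g3)" by (cases g)
    with that have *: "g1 dvd q" "g2 dvd q" "g3 dvd q" "q dvd g1 * g2 * g3" by (auto simp: E_def D_def)
    then have "g1 > 0" "g2 > 0" "g3 > 0" using q by (auto intro: Nat.gr0I)
    moreover have "int q dvd int g1 * int g2 * int g3" using *(4) by (metis of_nat_dvd_iff of_nat_mult)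
    ultimately have "int (card (S d g)) \<le> 2 * int q"
      unfolding g S_def prod.case using * q coprime_units_mod[OF that(1)]
      by (intro card_divisibility_triple_le) auto
    then show ?thesis by linarith
  qed
  have cardU: "card (\<Union>g\<in>E. S d g) \<le> divisor_count q ^ 3 * (2 * q)" if "d \<in> units_mod q" for d
  proof -
    have "card (\<Union>g\<in>E. S d g) \<le> (\<Sum>g\<in>E. card (S d g))" using finE by (rule card_UN_le)
    also have "\<dots> \<le> (\<Sum>g\<in>E. 2 * q)" using cardS[OF that] by (intro sum_mono)
    also have "\<dots> \<le> divisor_count q ^ 3 * (2 * q)" using cardE by simp
    finally show ?thesis .
  qed
  have inj: "inj_on (\<lambda>((a, b), (c, d)). (d, (a, b))) (unit_quadruples q)"
  proof (rule inj_onI, clarsimp simp: unit_quadruples_def)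
    fix a b c d c'
    assume "c \<in> units_mod q" "c' \<in> units_mod q"
      "int q dvd (a + b) - (c + d)" "int q dvd (a + b) - (c' + d)"
    moreover from this have "int q dvd ((a + b) - (c' + d)) - ((a + b) - (c + d))" by (blast intro: dvd_diff)
    ultimately show "c = c'" by (intro units_mod_eqI) simp_all
  qed
  have sub: "(\<lambda>((a, b), (c, d)). (d, (a, b))) ` unit_quadruples q \<subseteq> Sigma (units_mod q) (\<lambda>d. \<Union>g\<in>E. S d g)"
  proof
    fix y assume "y \<in> (\<lambda>((a, b), (c, d)). (d, (a, b))) ` unit_quadruples q"
    then obtain a b c d where y: "y = (d, (a, b))" and Q: "((a, b), (c, d)) \<in> unit_quadruples q" by auto
    then have U: "a \<in> units_mod q" "b \<in> units_mod q" "c \<in> units_mod q" "d \<in> units_mod q"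
      and dv: "int q dvd (a + b) * (a - d) * (b - d)"
      using inv_mod_sum_factor[of a q b c d] by (auto simp: unit_quadruples_def)
    define g where "g = (nat (gcd (a - d) (int q)), nat (gcd (b - d) (int q)), nat (gcd (a + b) (int q)))"
    have "int q dvd gcd (a - d) (int q) * gcd (b - d) (int q) * gcd (a + b) (int q)"
    proof -
      \<comment> \<open>A factor may be replaced by its gcd with \<open>q\<close> without losing
        divisibility of the product by \<open>q\<close>; this is applied to the three factors in
        turn.\<close>
      have *: "int q dvd gcd x (int q) * y" if "int q dvd x * y" for x y :: int
      proof -
        have "int q dvd gcd (x * y) (int q * y)" using that by simp
        also have "gcd (x * y) (int q * y) = gcd x (int q) * \<bar>y\<bar>"
          by (metis gcd_mult_distrib_int mult.commute)
        finally show ?thesis by (simp add: abs_if split: if_splits)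
      qed
      from dv have "int q dvd (a - d) * ((b - d) * (a + b))" by (simp add: ac_simps)
      from *[OF this] have "int q dvd (b - d) * (gcd (a - d) (int q) * (a + b))" by (simp add: ac_simps)
      from *[OF this] have "int q dvd (a + b) * (gcd (b - d) (int q) * gcd (a - d) (int q))" by (simp add: ac_simps)
      from *[OF this] show ?thesis by (simp add: ac_simps)
    qed
    then have "q dvd nat (gcd (a - d) (int q)) * nat (gcd (b - d) (int q)) * nat (gcd (a + b) (int q))"
      by (simp add: nat_mult_distrib[symmetric] int_dvd_int_iff[symmetric] del: int_dvd_int_iff)
    moreover have "nat (gcd x (int q)) dvd q" for x by (simp add: int_dvd_int_iff[symmetric] del: int_dvd_int_iff)
    ultimately have gE: "g \<in> E"
      unfolding E_def g_def D_def by simp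
    have "(a, b) \<in> S d g"
      unfolding S_def g_def using U(1,2)[THEN subsetD[OF units_mod_subset]] by simp
    with gE y U show "y \<in> Sigma (units_mod q) (\<lambda>d. \<Union>g\<in>E. S d g)" by auto
  qed
  have "card (unit_quadruples q) \<le> card (Sigma (units_mod q) (\<lambda>d. \<Union>g\<in>E. S d g))"
    using finS finE by (intro card_inj_on_le[OF inj sub]) auto
  also have "\<dots> = (\<Sum>d\<in>units_mod q. card (\<Union>g\<in>E. S d g))" using finS finE by (intro card_SigmaI) auto
  also have "\<dots> \<le> (\<Sum>d\<in>units_mod q. divisor_count q ^ 3 * (2 * q))" using cardU by (intro sum_mono)
  also have "\<dots> = totient q * (divisor_count q ^ 3 * (2 * q))" by (simp add: card_units_mod)
  finally show ?thesis .
qed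

section \<open>Kloosterman sums\<close>

definition echar :: "real \<Rightarrow> complex" where
  "echar x = cis (2 * pi * x)"

lemma echar_add: "echar (x + y) = echar x * echar y"
  by (simp add: echar_def cis_mult algebra_simps)

lemma norm_echar [simp]: "cmod (echar x) = 1"
  by (simp add: echar_def)

lemma cnj_echar: "cnj (echar x) = echar (- x)"
  by (simp add: echar_def cis_cnj)

lemma echar_0 [simp]: "echar 0 = 1"
  by (simp add: echar_def)

lemma echar_of_int [simp]: "echar (of_int k) = 1"
  by (simp add: echar_def complex_eq_iff cos_int_2pin sin_int_2pin)

lemma echar_eq_1_iff: "echar x = 1 \<longleftrightarrow> x \<in> \<int>"
proof
  assume "echar x = 1"
  then have "cos (2 * pi * x) = 1" by (simp add: echar_def complex_eq_iff)
  then obtain n :: int where "2 * pi * x = of_int n * 2 * pi" by (auto simp: cos_one_2pi_int)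
  then show "x \<in> \<int>" by simp
qed (auto elim: Ints_cases)

lemma echar_cong:
  assumes "int q dvd k - l"
  shows "echar (of_int k / real q) = echar (of_int l / real q)"
proof (cases "q = 0")
  case False
  obtain m where "k = l + int q * m" using assms by (auto simp: dvd_def algebra_simps)
  then have "of_int k / real q = of_int l / real q + of_int m" using False by (simp add: field_simps)
  then show ?thesis by (simp add: echar_add)
qed auto

lemma echar_power: "echar x ^ n = echar (real n * x)"
  by (simp add: echar_def Complex.DeMoivre mult_ac)

lemma sum_echar:
  assumes q: "q > 0"
  shows "(\<Sum>a\<in>{0..<int q}. echar (of_int (a * k) / real q)) = (if int q dvd k then of_nat q else 0)"
proof (cases "int q dvd k")
  case True
  have "echar (of_int (a * k) / real q) = 1" for a
    using echar_cong[of q "a * k" 0] True by simp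
  then show ?thesis using True by simp
next
  case False
  define w where "w = echar (of_int k / real q)"
  have "w \<noteq> 1"
  proof
    assume "w = 1"
    then obtain m where "real_of_int k / real q = of_int m" unfolding w_def echar_eq_1_iff by (elim Ints_cases)
    then have "real_of_int k = real_of_int (m * int q)" using q by (simp add: field_simps)
    then have "k = m * int q" by (simp only: of_int_eq_iff)
    then show False using False by simp
  qed
  have wq: "w ^ q = 1" using q by (simp add: w_def echar_power)
  have "(\<Sum>a\<in>{0..<int q}. echar (of_int (a * k) / real q)) = (\<Sum>a<q. w ^ a)"
    by (rule sum.reindex_bij_witness[of _ int nat]) (auto simp: w_def echar_power)
  also have "\<dots> = 0" using \<open>w \<noteq> 1\<close> wq by (simp add: sum_gp_strict)
  finally show ?thesis using False by simp
qed

text \<open>Orthogonality in both variables. The index set is arbitrary because it will consist of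
  pairs of units: the square of a Kloosterman sum is an exponential sum over pairs, and the second
  moment of the square is the fourth moment.\<close>

lemma parseval_mod:
  fixes f g :: "'a \<Rightarrow> int"
  assumes q: "q > 0" and X: "finite X"
  shows "(\<Sum>(a, b)\<in>{0..<int q} \<times> {0..<int q}. (cmod (\<Sum>x\<in>X. echar (of_int (a * f x + b * g x) / real q)))\<^sup>2)
       = real q ^ 2 * real (card {(x, y) \<in> X \<times> X. int q dvd f x - f y \<and> int q dvd g x - g y})"
proof -
  let ?I = "{0..<int q}"
  define h where "h = (\<lambda>(x, y) (a, b). echar (of_int (a * (f x - f y)) / real q) * echar (of_int (b * (g x - g y)) / real q))"
  have sq: "of_real ((cmod (\<Sum>x\<in>X. echar (of_int (a * f x + b * g x) / real q)))\<^sup>2) = (\<Sum>p\<in>X \<times> X. h p (a, b))" for a b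
  proof -
    have "complex_of_real ((cmod (\<Sum>x\<in>X. echar (of_int (a * f x + b * g x) / real q)))\<^sup>2)
       = (\<Sum>x\<in>X. \<Sum>y\<in>X. echar (of_int (a * f x + b * g x) / real q) * echar (- (of_int (a * f y + b * g y) / real q)))"
      by (simp only: complex_norm_square cnj_sum cnj_echar sum_product)
    also have "\<dots> = (\<Sum>x\<in>X. \<Sum>y\<in>X. h (x, y) (a, b))"
      unfolding h_def prod.case echar_add[symmetric]
      by (intro sum.cong refl arg_cong[of _ _ echar]) (simp add: algebra_simps add_divide_distrib diff_divide_distrib)
    finally show ?thesis by (simp add: sum.cartesian_product)
  qed
  have "complex_of_real (\<Sum>(a, b)\<in>?I \<times> ?I. (cmod (\<Sum>x\<in>X. echar (of_int (a * f x + b * g x) / real q)))\<^sup>2)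
     = (\<Sum>ab\<in>?I \<times> ?I. \<Sum>p\<in>X \<times> X. h p ab)"
    unfolding of_real_sum by (intro sum.cong refl) (auto simp: sq[symmetric])
  also have "\<dots> = (\<Sum>p\<in>X \<times> X. \<Sum>ab\<in>?I \<times> ?I. h p ab)" by (rule sum.swap)
  also have "\<dots> = (\<Sum>p\<in>X \<times> X. if int q dvd f (fst p) - f (snd p) \<and> int q dvd g (fst p) - g (snd p) then of_nat q ^ 2 else 0)"
  proof (intro sum.cong refl)
    fix p assume "p \<in> X \<times> X"
    obtain x y where p: "p = (x, y)" by (cases p)
    have "(\<Sum>ab\<in>?I \<times> ?I. h p ab) = (\<Sum>a\<in>?I. echar (of_int (a * (f x - f y)) / real q)) * (\<Sum>b\<in>?I. echar (of_int (b * (g x - g y)) / real q))"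
      by (simp add: p h_def sum_product sum.cartesian_product case_prod_beta)
    also have "\<dots> = (if int q dvd f x - f y then of_nat q else 0) * (if int q dvd g x - g y then of_nat q else 0)"
      by (simp only: sum_echar[OF q])
    finally show "(\<Sum>ab\<in>?I \<times> ?I. h p ab) = (if int q dvd f (fst p) - f (snd p) \<and> int q dvd g (fst p) - g (snd p) then of_nat q ^ 2 else 0)"
      by (simp add: p power2_eq_square)
  qed
  also have "\<dots> = of_nat q ^ 2 * of_nat (card {(x, y) \<in> X \<times> X. int q dvd f x - f y \<and> int q dvd g x - g y})"
  proof -
    have "{p \<in> X \<times> X. int q dvd f (fst p) - f (snd p) \<and> int q dvd g (fst p) - g (snd p)}
       = {(x, y) \<in> X \<times> X. int q dvd f x - f y \<and> int q dvd g x - g y}" by auto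
    then show ?thesis using X by (simp add: sum.inter_filter[symmetric] mult.commute)
  qed
  finally have "complex_of_real (\<Sum>(a, b)\<in>?I \<times> ?I. (cmod (\<Sum>x\<in>X. echar (of_int (a * f x + b * g x) / real q)))\<^sup>2)
     = complex_of_real (real q ^ 2 * real (card {(x, y) \<in> X \<times> X. int q dvd f x - f y \<and> int q dvd g x - g y}))"
    by simp
  then show ?thesis by (simp only: of_real_eq_iff)
qed

definition kloosterman :: "nat \<Rightarrow> int \<Rightarrow> int \<Rightarrow> complex" where
  "kloosterman q m n = (\<Sum>d\<in>units_mod q. echar (of_int (m * d + n * inv_mod q d) / real q))"

lemma kloosterman_fourth_moment:
  assumes q: "q > 0"
  shows "(\<Sum>(a, b)\<in>{0..<int q} \<times> {0..<int q}. cmod (kloosterman q a b) ^ 4)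
       = real q ^ 2 * real (card (unit_quadruples q))"
proof -
  let ?f = "\<lambda>(x, y). x + y" and ?g = "\<lambda>(x, y). inv_mod q x + inv_mod q y"
  let ?X = "units_mod q \<times> units_mod q"
  have K2: "kloosterman q a b ^ 2 = (\<Sum>p\<in>?X. echar (of_int (a * ?f p + b * ?g p) / real q))" for a b
  proof -
    have "kloosterman q a b ^ 2 = (\<Sum>x\<in>units_mod q. \<Sum>y\<in>units_mod q. echar (of_int (a * ?f (x, y) + b * ?g (x, y)) / real q))"
      unfolding kloosterman_def power2_eq_square sum_product echar_add[symmetric]
      by (intro sum.cong refl arg_cong[of _ _ echar]) (simp add: algebra_simps add_divide_distrib)
    then show ?thesis by (simp only: sum.cartesian_product split_beta' prod.collapse)
  qed
  have "cmod (kloosterman q a b) ^ 4 = (cmod (\<Sum>p\<in>?X. echar (of_int (a * ?f p + b * ?g p) / real q)))\<^sup>2" for a b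
    unfolding K2[symmetric] by (simp add: norm_power)
  then have "(\<Sum>(a, b)\<in>{0..<int q} \<times> {0..<int q}. cmod (kloosterman q a b) ^ 4)
     = real q ^ 2 * real (card {(x, y) \<in> ?X \<times> ?X. int q dvd ?f x - ?f y \<and> int q dvd ?g x - ?g y})"
    using parseval_mod[OF q, of ?X ?f ?g] by simp
  moreover have "{(x, y) \<in> ?X \<times> ?X. int q dvd ?f x - ?f y \<and> int q dvd ?g x - ?g y} = unit_quadruples q"
    by (auto simp: unit_quadruples_def)
  ultimately show ?thesis by simp
qed

section \<open>Symmetry of Kloosterman sums under scaling by units\<close>

lemma units_mod_memI:
  assumes "q > 1" "coprime x (int q)"
  shows "x mod int q \<in> units_mod q"
proof -
  have c: "coprime (x mod int q) (int q)" using assms by simp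
  moreover have "x mod int q \<noteq> 0" using c assms(1) by (auto simp del: coprime_mod_left_iff)
  ultimately have "nat (x mod int q) \<in> totatives q"
    using assms(1) pos_mod_bound[of "int q" x] pos_mod_sign[of "int q" x]
    by (auto simp: in_totatives_iff coprime_int_iff[symmetric] simp del: coprime_int_iff coprime_mod_left_iff pos_mod_sign pos_mod_bound)
  then show ?thesis using assms(1) by (auto simp: units_mod_def intro!: image_eqI[of _ _ "nat (x mod int q)"])
qed

lemma inv_mod_unique:
  assumes "x \<in> units_mod q" "int q dvd x * y - 1"
  shows "int q dvd y - inv_mod q x"
proof -
  have "int q dvd (x * y - 1) - (x * inv_mod q x - 1)"
    by (rule dvd_diff[OF assms(2) inv_mod_dvd[OF assms(1)]])
  then have "int q dvd x * (y - inv_mod q x)" by (simp add: algebra_simps)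
  then show ?thesis
    using coprime_units_mod[OF assms(1)] by (simp add: coprime_dvd_mult_right_iff coprime_commute)
qed

lemma kloosterman_cong:
  assumes "int q dvd m - m'" "int q dvd n - n'"
  shows "kloosterman q m n = kloosterman q m' n'"
  unfolding kloosterman_def
proof (intro sum.cong refl echar_cong)
  fix d
  have "int q dvd (m - m') * d + (n - n') * inv_mod q d" using assms by simp
  then show "int q dvd (m * d + n * inv_mod q d) - (m' * d + n' * inv_mod q d)"
    by (simp add: algebra_simps)
qed

text \<open>The substitution of \<open>u * d mod q\<close> for \<open>d\<close> permutes the units,
  and \<open>inv_mod_unique\<close> recognises \<open>inv_mod q u * inv_mod q d\<close> as the
  inverse of the image up to multiples of \<open>q\<close>, which \<open>echar\<close> does not
  see.\<close>

lemma kloosterman_scale: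
  assumes q: "q > 1" and u: "u \<in> units_mod q"
  shows "kloosterman q (m * u) (n * inv_mod q u) = kloosterman q m n"
proof -
  define s where "s = (\<lambda>d. (u * d) mod int q)"
  have s_in: "s d \<in> units_mod q" if "d \<in> units_mod q" for d
    unfolding s_def using coprime_units_mod[OF u] coprime_units_mod[OF that]
    by (intro units_mod_memI q) simp
  have s_cong: "int q dvd s d - u * d" for d by (simp add: s_def mod_eq_dvd_iff[symmetric])
  have inj: "inj_on s (units_mod q)"
  proof (rule inj_onI)
    fix x y assume xy: "x \<in> units_mod q" "y \<in> units_mod q" "s x = s y"
    then have "int q dvd u * (x - y)"
      by (simp add: s_def mod_eq_dvd_iff algebra_simps)
    then have "int q dvd x - y"
      using coprime_units_mod[OF u] by (simp add: coprime_dvd_mult_right_iff coprime_commute)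
    then show "x = y" using xy units_mod_eqI by blast
  qed
  have bij: "bij_betw s (units_mod q) (units_mod q)"
    using inj s_in by (simp add: bij_betw_def endo_inj_surj image_subset_iff)
  have "kloosterman q m n = (\<Sum>d\<in>units_mod q. echar (of_int (m * s d + n * inv_mod q (s d)) / real q))"
    unfolding kloosterman_def by (rule sum.reindex_bij_betw[OF bij, symmetric])
  also have "\<dots> = kloosterman q (m * u) (n * inv_mod q u)"
    unfolding kloosterman_def
  proof (intro sum.cong refl echar_cong)
    fix d assume d: "d \<in> units_mod q"
    have "int q dvd s d * (inv_mod q u * inv_mod q d) - 1"
    proof -
      have "int q dvd (s d - u * d) * (inv_mod q u * inv_mod q d)
         + (u * inv_mod q u - 1) * (d * inv_mod q d) + (d * inv_mod q d - 1)"
        using s_cong inv_mod_dvd[OF u] inv_mod_dvd[OF d] by simp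
      then show ?thesis by (simp add: algebra_simps)
    qed
    from inv_mod_unique[OF s_in[OF d] this]
    have "int q dvd m * (s d - u * d) - n * (inv_mod q u * inv_mod q d - inv_mod q (s d))"
      using s_cong by simp
    then show "int q dvd (m * s d + n * inv_mod q (s d)) - (m * u * d + n * inv_mod q u * inv_mod q d)"
      by (simp add: algebra_simps)
  qed
  finally show ?thesis by simp
qed

text \<open>Cauchy--Schwarz after grouping the terms of the sum by the value of \<open>h\<close>.\<close>

lemma sum_comp_square_le:
  fixes k :: "'b \<Rightarrow> real"
  assumes X: "finite X" and Y: "finite Y" and h: "h ` X \<subseteq> Y"
  shows "(\<Sum>x\<in>X. k (h x))\<^sup>2 \<le> real (card {(x, x') \<in> X \<times> X. h x = h x'}) * (\<Sum>y\<in>Y. (k y)\<^sup>2)"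
proof -
  define v where "v = (\<lambda>y. card {x \<in> X. h x = y})"
  have "(\<Sum>x\<in>X. k (h x)) = (\<Sum>y\<in>Y. \<Sum>x | x \<in> X \<and> h x = y. k (h x))"
    by (rule sum.group[OF X Y h, symmetric])
  also have "\<dots> = (\<Sum>y\<in>Y. real (v y) * k y)"
    by (intro sum.cong refl) (simp add: v_def)
  finally have 1: "(\<Sum>x\<in>X. k (h x)) = (\<Sum>y\<in>Y. real (v y) * k y)" .
  have "{(x, x') \<in> X \<times> X. h x = h x'} = Sigma X (\<lambda>x. {x' \<in> X. h x' = h x})" by auto
  then have "real (card {(x, x') \<in> X \<times> X. h x = h x'}) = (\<Sum>x\<in>X. real (v (h x)))"
    using X by (simp add: v_def)
  also have "\<dots> = (\<Sum>y\<in>Y. \<Sum>x | x \<in> X \<and> h x = y. real (v (h x)))"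
    by (rule sum.group[OF X Y h, symmetric])
  also have "\<dots> = (\<Sum>y\<in>Y. (real (v y))\<^sup>2)"
    by (intro sum.cong refl) (simp add: v_def power2_eq_square)
  finally have 2: "real (card {(x, x') \<in> X \<times> X. h x = h x'}) = (\<Sum>y\<in>Y. (real (v y))\<^sup>2)" .
  show ?thesis unfolding 1 2 by (rule Cauchy_Schwarz_ineq_sum)
qed

section \<open>Average size of gcds with the modulus\<close>

lemma card_multiples_le:
  fixes g N :: int
  assumes "g > 0" "N \<ge> 0"
  shows "g * int (card {n \<in> {-N..N} - {0}. g dvd n}) \<le> 2 * N"
proof -
  \<comment> \<open>With 0 removed, \<open>n = g * k\<close> has \<open>k\<close> nonzero and at
    most \<open>N div g\<close> in size, so no additive 1 spoils the bound when \<open>g\<close>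
    exceeds \<open>N\<close>.\<close>
  have sub: "{n \<in> {-N..N} - {0}. g dvd n} \<subseteq> (\<lambda>k. g * k) ` ({- (N div g)..N div g} - {0})"
  proof
    fix n assume "n \<in> {n \<in> {-N..N} - {0}. g dvd n}"
    then obtain k where k: "n = g * k" "-N \<le> g * k" "g * k \<le> N" "g * k \<noteq> 0" by (auto simp: dvd_def)
    have "k \<le> N div g" using zdiv_mono1[of "g * k" N g] k assms by simp
    moreover have "g * (-k) \<le> N" using k by simp
    then have "-k \<le> N div g" using zdiv_mono1[of "g * - k" N g] assms by (simp del: mult_minus_right)
    ultimately show "n \<in> (\<lambda>k. g * k) ` ({- (N div g)..N div g} - {0})" using k by auto
  qed
  have nn: "N div g \<ge> 0" using assms by (simp add: pos_imp_zdiv_nonneg_iff)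
  have "card {n \<in> {-N..N} - {0}. g dvd n} \<le> card ((\<lambda>k. g * k) ` ({- (N div g)..N div g} - {0}))"
    by (rule card_mono[OF _ sub]) simp
  also have "\<dots> \<le> card ({- (N div g)..N div g} - {0})" by (rule card_image_le) simp
  also have "\<dots> = nat (2 * (N div g))" using nn by simp
  finally have "int (card {n \<in> {-N..N} - {0}. g dvd n}) \<le> 2 * (N div g)" using nn by linarith
  then have "g * int (card {n \<in> {-N..N} - {0}. g dvd n}) \<le> g * (2 * (N div g))"
    using assms by (intro mult_left_mono) auto
  also have "\<dots> = 2 * (g * (N div g))" by simp
  also have "\<dots> \<le> 2 * N" using assms by (simp add: mult.commute pos_mod_sign minus_mod_eq_mult_div[symmetric])
  finally show ?thesis .
qed

text \<open>The gcd is itself one of the summands. The right-hand side can be exchanged with a sum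
  over \<open>x\<close>, after which each divisor only requires counting its multiples.\<close>

lemma gcd_le_sum_divisors:
  fixes x :: int
  assumes q: "q > 0"
  shows "gcd x (int q) \<le> (\<Sum>g | g dvd q. if int g dvd x then int g else 0)"
proof -
  let ?g = "nat (gcd x (int q))"
  have "?g dvd q" by (simp add: int_dvd_int_iff[symmetric] del: int_dvd_int_iff)
  moreover have "gcd x (int q) = (if int ?g dvd x then int ?g else 0)" by simp
  ultimately show ?thesis
    using q member_le_sum[of ?g "{g. g dvd q}" "\<lambda>g. if int g dvd x then int g else 0"] by auto
qed

lemma sum_gcd_le:
  fixes N :: int
  assumes q: "q > 0" and N: "N \<ge> 0"
  shows "(\<Sum>n\<in>{-N..N} - {0}. gcd n (int q)) \<le> int (divisor_count q) * (2 * N)"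
proof -
  have "(\<Sum>n\<in>{-N..N} - {0}. gcd n (int q)) \<le> (\<Sum>n\<in>{-N..N} - {0}. \<Sum>g | g dvd q. if int g dvd n then int g else 0)"
    by (intro sum_mono gcd_le_sum_divisors q)
  also have "\<dots> = (\<Sum>g | g dvd q. \<Sum>n\<in>{-N..N} - {0}. if int g dvd n then int g else 0)"
    by (rule sum.swap)
  also have "\<dots> = (\<Sum>g | g dvd q. int g * int (card {n \<in> {-N..N} - {0}. int g dvd n}))"
    by (intro sum.cong refl) (simp add: sum.inter_filter[symmetric])
  also have "\<dots> \<le> (\<Sum>g | g dvd q. 2 * N)"
    using q N by (intro sum_mono card_multiples_le) (auto intro!: Nat.gr0I)
  finally show ?thesis by (simp add: divisor_count_def)
qed

lemma sum_gcd2_le: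
  fixes N :: int
  assumes q: "q > 0" and N: "N \<ge> 0"
  shows "(\<Sum>(m, n)\<in>({-N..N} - {0}) \<times> ({-N..N} - {0}). gcd (gcd m n) (int q)) \<le> int (divisor_count q) * (2 * N)\<^sup>2"
proof -
  let ?A = "{-N..N} - {0}"
  have "(\<Sum>(m, n)\<in>?A \<times> ?A. gcd (gcd m n) (int q))
     \<le> (\<Sum>p\<in>?A \<times> ?A. \<Sum>g | g dvd q. if int g dvd gcd (fst p) (snd p) then int g else 0)"
    unfolding split_beta' by (intro sum_mono gcd_le_sum_divisors q)
  also have "\<dots> = (\<Sum>g | g dvd q. \<Sum>p\<in>?A \<times> ?A. if int g dvd gcd (fst p) (snd p) then int g else 0)"
    by (rule sum.swap)
  also have "\<dots> \<le> (\<Sum>g | g dvd q. (2 * N)\<^sup>2)"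
  proof (rule sum_mono)
    fix g assume "g \<in> {g. g dvd q}"
    then have g: "g > 0" using q by (auto intro!: Nat.gr0I)
    let ?C = "{n \<in> ?A. int g dvd n}"
    have "{p \<in> ?A \<times> ?A. int g dvd gcd (fst p) (snd p)} = ?C \<times> ?C" by auto
    then have "(\<Sum>p\<in>?A \<times> ?A. if int g dvd gcd (fst p) (snd p) then int g else 0) = int g * int (card ?C * card ?C)"
      by (simp only: sum.inter_filter[symmetric] finite_cartesian_product finite_Diff finite_atLeastAtMost_int)
         (simp add: card_cartesian_product)
    \<comment> \<open>The number of pairs decays like \<open>1 / g^2\<close> while the weight is
      only \<open>g\<close>; the spare factor \<open>g\<close> is given away.\<close>
    also have "\<dots> \<le> (int g * int (card ?C)) * (int g * int (card ?C))"
      using g mult_right_mono[of 1 "int g" "int g * (int (card ?C) * int (card ?C))"] by (simp add: mult_ac)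
    also have "\<dots> \<le> (2 * N) * (2 * N)"
      using card_multiples_le[of "int g" N] g N by (intro mult_mono[of _ "2 * N" _ "2 * N"]) auto
    finally show "(\<Sum>p\<in>?A \<times> ?A. if int g dvd gcd (fst p) (snd p) then int g else 0) \<le> (2 * N)\<^sup>2"
      by (simp add: power2_eq_square)
  qed
  finally show ?thesis by (simp add: divisor_count_def)
qed

section \<open>The divisor bound\<close>

lemma divisor_count_mult_le:
  assumes "m > 0" "n > 0"
  shows "divisor_count (m * n) \<le> divisor_count m * divisor_count n"
proof -
  have "{d. d dvd m * n} \<subseteq> (\<lambda>(a, b). a * b) ` ({d. d dvd m} \<times> {d. d dvd n})"
  proof
    fix d assume "d \<in> {d. d dvd m * n}"
    then obtain a b where "d = a * b" "a dvd m" "b dvd n" using division_decomp[of d m n] by auto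
    then show "d \<in> (\<lambda>(a, b). a * b) ` ({d. d dvd m} \<times> {d. d dvd n})" by auto
  qed
  then have "card {d. d dvd m * n} \<le> card ({d. d dvd m} \<times> {d. d dvd n})"
    using assms by (intro surj_card_le) auto
  then show ?thesis by (simp add: divisor_count_def card_cartesian_product)
qed

lemma divisor_count_prime_power:
  assumes "prime p" shows "divisor_count (p ^ k) = Suc k"
proof -
  have "{d. d dvd p ^ k} = (\<lambda>i. p ^ i) ` {..k}"
    using divides_primepow_nat[OF assms] by (auto simp: image_iff)
  moreover have "inj_on (\<lambda>i. p ^ i) {..k}"
    using prime_gt_1_nat[OF assms] by (auto intro!: inj_onI simp: power_inject_exp)
  ultimately show ?thesis by (simp add: divisor_count_def card_image)
qed

text \<open>For prime powers, \<open>k + 1 <= C0 * p powr (\<epsilon> * k)\<close> holds with one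
  constant for all primes, and with constant 1 once \<open>p >= B\<close>. Hence at most
  \<open>B\<close> prime factors contribute \<open>C0\<close>, whatever \<open>n\<close> is.\<close>

lemma divisor_count_bound:
  fixes \<epsilon> :: real
  assumes e: "\<epsilon> > 0"
  obtains C where "C \<ge> 1" "\<And>n. n > 0 \<Longrightarrow> real (divisor_count n) \<le> C * real n powr \<epsilon>"
proof -
  \<comment> \<open>From \<open>B\<close> on, \<open>p powr \<epsilon>\<close> is at least 2, and
    \<open>k + 1 <= 2 ^ k\<close> holds without a constant.\<close>
  define B where "B = nat \<lceil>2 powr (1 / \<epsilon>)\<rceil>"
  have "\<exists>C0\<ge>1. \<forall>k. real (Suc k) \<le> C0 * 2 powr (\<epsilon> * real k)"
  proof -
    \<comment> \<open>The inequality used is \<open>1 + x <= exp x\<close> at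
      \<open>x = \<epsilon> * k * ln 2\<close>: the factor \<open>1 / (\<epsilon> * ln 2)\<close>
      recovers \<open>k\<close>, and the remaining 1 is covered by \<open>C0 >= 1\<close>.\<close>
    define C0 where "C0 = max 1 (1 / (\<epsilon> * ln 2))"
    have l: "\<epsilon> * ln 2 > 0" using e by simp
    have "real (Suc k) \<le> C0 * 2 powr (\<epsilon> * real k)" for k
    proof -
      have "1 + \<epsilon> * real k * ln 2 \<le> exp (\<epsilon> * real k * ln 2)" by (rule exp_ge_add_one_self)
      also have "\<dots> = 2 powr (\<epsilon> * real k)" by (simp add: powr_def)
      finally have *: "1 + \<epsilon> * real k * ln 2 \<le> 2 powr (\<epsilon> * real k)" .
      have "real k = (1 / (\<epsilon> * ln 2)) * (\<epsilon> * real k * ln 2)" using e by (simp add: field_simps)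
      also have "\<dots> \<le> C0 * (\<epsilon> * real k * ln 2)"
        using e by (intro mult_right_mono) (auto simp: C0_def)
      finally have "real k \<le> C0 * (\<epsilon> * real k * ln 2)" .
      moreover have "1 \<le> C0" by (simp add: C0_def)
      ultimately have "real (Suc k) \<le> C0 * (1 + \<epsilon> * real k * ln 2)" by (simp add: algebra_simps)
      also have "\<dots> \<le> C0 * 2 powr (\<epsilon> * real k)" using * \<open>1 \<le> C0\<close> by (intro mult_left_mono) auto
      finally show ?thesis .
    qed
    then show ?thesis by (intro exI[of _ C0]) (auto simp: C0_def)
  qed
  then obtain C0 where C0: "C0 \<ge> 1" "\<And>k. real (Suc k) \<le> C0 * 2 powr (\<epsilon> * real k)" by blast
  define c where "c = (\<lambda>p. if p < B then C0 else 1)"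
  have c1: "c p \<ge> 1" for p using C0 by (simp add: c_def)
  have step: "real (Suc k) \<le> c p * (real p powr \<epsilon>) ^ k" if "prime p" for p k
  proof (cases "p < B")
    case True
    have "2 powr (\<epsilon> * real k) = (2 powr \<epsilon>) ^ k" by (simp add: powr_realpow[symmetric] powr_powr)
    also have "\<dots> \<le> (real p powr \<epsilon>) ^ k"
      using prime_ge_2_nat[OF that] e by (intro power_mono powr_mono2) auto
    finally show ?thesis using True C0(2)[of k] C0(1) unfolding c_def
      by (smt (verit) mult_left_mono)
  next
    case False
    then have "2 powr (1 / \<epsilon>) \<le> real p" unfolding B_def by linarith
    then have "(2 powr (1 / \<epsilon>)) powr \<epsilon> \<le> real p powr \<epsilon>" using e by (intro powr_mono2) auto
    then have "2 \<le> real p powr \<epsilon>" using e by (simp add: powr_powr)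
    then have "2 ^ k \<le> (real p powr \<epsilon>) ^ k" by (intro power_mono) auto
    moreover have "real (Suc k) \<le> 2 ^ k"
      using Bernoulli_inequality[of 1 k] by (simp add: add.commute)
    ultimately show ?thesis using False unfolding c_def by simp
  qed
  have main: "real (divisor_count n) \<le> (\<Prod>p\<in>prime_factors n. c p) * real n powr \<epsilon>" if "n > 0" for n
  proof -
    have "real (divisor_count (\<Prod>p\<in>P. p ^ f p)) \<le> (\<Prod>p\<in>P. c p) * real (\<Prod>p\<in>P. p ^ f p) powr \<epsilon>"
      if "finite P" "\<forall>p\<in>P. prime p" for P and f :: "nat \<Rightarrow> nat"
      using that
    proof (induction P rule: finite_induct)
      case empty
      then show ?case by (simp add: divisor_count_def)
    next
      case (insert p P)
      let ?m = "\<Prod>p\<in>P. p ^ f p"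
      have pos: "?m > 0" "p ^ f p > 0" using insert.prems by (simp_all add: prime_gt_0_nat prod_pos)
      have "real (divisor_count (\<Prod>p\<in>insert p P. p ^ f p)) = real (divisor_count (p ^ f p * ?m))"
        using insert.hyps by simp
      also have "\<dots> \<le> real (Suc (f p)) * real (divisor_count ?m)"
        using divisor_count_mult_le[OF pos(2,1)] divisor_count_prime_power[of p "f p"] insert.prems
        by (simp flip: of_nat_mult of_nat_Suc)
      also have "\<dots> \<le> (c p * (real p powr \<epsilon>) ^ f p) * ((\<Prod>p\<in>P. c p) * real ?m powr \<epsilon>)"
        using insert step[of p "f p"] c1[of p] by (intro mult_mono) auto
      also have "(real p powr \<epsilon>) ^ f p = real (p ^ f p) powr \<epsilon>"
        using insert.prems prime_gt_0_nat[of p] by (simp add: powr_realpow[symmetric] powr_powr mult.commute)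
      also have "(c p * real (p ^ f p) powr \<epsilon>) * ((\<Prod>p\<in>P. c p) * real ?m powr \<epsilon>)
         = (\<Prod>p\<in>insert p P. c p) * real (\<Prod>p\<in>insert p P. p ^ f p) powr \<epsilon>"
        using insert.hyps by (simp add: powr_mult prod_nonneg mult_ac)
      finally show ?case .
    qed
    from this[of "prime_factors n" "\<lambda>p. multiplicity p n"] show ?thesis
      using that prod_prime_factors[of n] by auto
  qed
  have prod_le: "(\<Prod>p\<in>prime_factors n. c p) \<le> C0 ^ B" for n
  proof -
    have "(\<Prod>p\<in>prime_factors n. c p) = (\<Prod>p\<in>prime_factors n \<inter> {..<B}. C0)"
      by (subst prod.inter_restrict) (auto simp: c_def intro!: prod.cong)
    also have "\<dots> = C0 ^ card (prime_factors n \<inter> {..<B})" by simp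
    also have "\<dots> \<le> C0 ^ B"
      using card_mono[of "{..<B}" "prime_factors n \<inter> {..<B}"] C0 by (intro power_increasing) auto
    finally show ?thesis .
  qed
  show ?thesis
  proof (rule that[of "C0 ^ B"])
    show "1 \<le> C0 ^ B" using C0 by simp
    fix n :: nat assume "n > 0"
    then show "real (divisor_count n) \<le> C0 ^ B * real n powr \<epsilon>"
      using main[of n] prod_le[of n] by (smt (verit) mult_right_mono powr_ge_zero)
  qed
qed

text \<open>For \<open>d\<close> dividing \<open>q\<close>, \<open>totient d\<close> divides
  \<open>totient q\<close>. This serves as the lower bound for the totient: it loses only a divisor
  count, a kind of factor that is lost elsewhere as well.\<close>

lemma le_totient_mult_divisor_count:
  assumes "q > 0" shows "q \<le> totient q * divisor_count q"
proof -
  have "q = (\<Sum>d | d dvd q. totient d)" by (simp add: totient_divisor_sum)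
  also have "\<dots> \<le> (\<Sum>d | d dvd q. totient q)"
    using assms by (intro sum_mono) (auto intro: dvd_imp_le totient_dvd)
  finally show ?thesis by (simp add: divisor_count_def mult.commute)
qed

section \<open>Kloosterman sums over a box of frequencies\<close>

text \<open>If \<open>x\<close> and \<open>y\<close> are two solutions \<open>v\<close>, then
  \<open>q\<close> divides \<open>m' * (x - y)\<close> and, after clearing inverses,
  \<open>n' * (x - y)\<close>. All solutions therefore agree modulo \<open>q\<close> divided by the
  gcd of \<open>m'\<close>, \<open>n'\<close> and \<open>q\<close>.\<close>

lemma card_inverse_pair_le:
  assumes u: "u \<in> units_mod q"
  shows "int (card {v \<in> units_mod q. int q dvd m * u - m' * v \<and> int q dvd n * inv_mod q u - n' * inv_mod q v})
       \<le> gcd (gcd m' n') (int q)" (is "int (card ?V) \<le> ?g")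
proof -
  have q: "q > 0" using u by (cases "q = 0") (auto simp: units_mod_def)
  define L where "L = int q div ?g"
  have gL: "?g * L = int q" by (simp add: L_def)
  have gpos: "?g > 0" using q by (simp add: gcd_pos_int)
  have Lpos: "L > 0" using gL gpos q by (metis of_nat_0_less_iff zero_less_mult_pos)
  have "int (card ?V) * L \<le> int q"
  proof (rule card_congruent_le)
    show "?V \<subseteq> {1..<1 + int q}" using units_mod_subset by blast
    show "L dvd int q" using gL by (metis dvd_triv_right)
    fix x y assume "x \<in> ?V" "y \<in> ?V"
    then have xy: "x \<in> units_mod q" "y \<in> units_mod q"
      and m: "int q dvd (m * u - m' * y) - (m * u - m' * x)"
      and n: "int q dvd (n * inv_mod q u - n' * inv_mod q x) - (n * inv_mod q u - n' * inv_mod q y)"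
      by (blast intro: dvd_diff)+
    \<comment> \<open>Modulo \<open>q\<close>, multiplication by \<open>x * y\<close> turns
      \<open>inv_mod q y - inv_mod q x\<close> into \<open>x - y\<close>.\<close>
    have "int q dvd x * y * ((n * inv_mod q u - n' * inv_mod q x) - (n * inv_mod q u - n' * inv_mod q y))
       + n' * y * (x * inv_mod q x - 1) - n' * x * (y * inv_mod q y - 1)"
      by (rule dvd_diff[OF dvd_add[OF dvd_mult[OF n] dvd_mult[OF inv_mod_dvd[OF xy(1)]]]
            dvd_mult[OF inv_mod_dvd[OF xy(2)]]])
    then have n2: "int q dvd n' * (x - y)" by (simp add: algebra_simps)
    have m2: "int q dvd m' * (x - y)" using m by (simp add: algebra_simps)
    have "int q dvd gcd (m' * (x - y)) (n' * (x - y))" using m2 n2 by simp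
    also have "gcd (m' * (x - y)) (n' * (x - y)) = gcd m' n' * \<bar>x - y\<bar>"
      by (metis gcd_mult_distrib_int mult.commute)
    finally have "int q dvd gcd (gcd m' n' * \<bar>x - y\<bar>) (int q * \<bar>x - y\<bar>)" by simp
    also have "gcd (gcd m' n' * \<bar>x - y\<bar>) (int q * \<bar>x - y\<bar>) = ?g * \<bar>x - y\<bar>"
      by (metis gcd_mult_distrib_int mult.commute abs_idempotent)
    finally have "?g * L dvd ?g * \<bar>x - y\<bar>" by (simp only: gL)
    then show "L dvd x - y" using q by simp
  qed (use Lpos in auto)
  then have "int (card ?V) * L \<le> ?g * L" using gL by simp
  then show ?thesis using Lpos by simp
qed

definition frequency_box :: "nat \<Rightarrow> (int \<times> int) set" where
  "frequency_box N = {-int N..int N} \<times> {-int N..int N} - {(0, 0)}"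

text \<open>The frequencies that scaling by units may identify with \<open>(m', n')\<close> modulo
  \<open>q\<close>. When \<open>m' * n' = 0\<close> the product carries little information, and the
  zero pattern confines the class to a single axis.\<close>

definition hyperbola_class :: "nat \<Rightarrow> int \<Rightarrow> int \<Rightarrow> (int \<times> int) set" where
  "hyperbola_class N m' n' = {(m, n) \<in> frequency_box N. m * n = m' * n' \<and> (m = 0 \<longleftrightarrow> m' = 0) \<and> (n = 0 \<longleftrightarrow> n' = 0)}"

lemma finite_frequency_box [simp]: "finite (frequency_box N)"
  by (simp add: frequency_box_def)

lemma finite_hyperbola_class [simp]: "finite (hyperbola_class N m n)"
  unfolding hyperbola_class_def by (rule finite_subset[of _ "frequency_box N"]) auto

lemma card_hyperbola_class_axis_le:
  assumes "m' = 0 \<or> n' = 0"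
  shows "card (hyperbola_class N m' n') \<le> 2 * N"
proof -
  have "\<exists>f. inj_on f (hyperbola_class N m' n') \<and> f ` hyperbola_class N m' n' \<subseteq> {-int N..int N} - {0}"
  proof (cases "m' = 0")
    case True
    then show ?thesis
      by (intro exI[of _ snd]) (auto simp: hyperbola_class_def frequency_box_def inj_on_def)
  next
    case False
    with assms show ?thesis
      by (intro exI[of _ fst]) (auto simp: hyperbola_class_def frequency_box_def inj_on_def)
  qed
  then obtain f where "inj_on f (hyperbola_class N m' n')" "f ` hyperbola_class N m' n' \<subseteq> {-int N..int N} - {0}" by blast
  then have "card (hyperbola_class N m' n') \<le> card ({-int N..int N} - {0})" by (intro card_inj_on_le) auto
  then show ?thesis by simp
qed

text \<open>Up to sign, \<open>m\<close> is a divisor of \<open>m' * n'\<close>, and it determines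
  \<open>n\<close>; the factor 2 counts the signs.\<close>

lemma card_hyperbola_class_le:
  assumes nz: "m' \<noteq> 0" "n' \<noteq> 0"
  shows "card (hyperbola_class N m' n') \<le> 2 * divisor_count (nat \<bar>m' * n'\<bar>)"
proof -
  let ?D = "{d. d dvd nat \<bar>m' * n'\<bar>}"
  have fin: "finite ?D" using nz by (intro finite_divisors_nat) simp
  have inj: "inj_on fst (hyperbola_class N m' n')"
    using nz by (auto simp: hyperbola_class_def inj_on_def) (metis mult_cancel_left)
  have "fst ` hyperbola_class N m' n' \<subseteq> int ` ?D \<union> (\<lambda>d. - int d) ` ?D"
  proof
    fix m assume "m \<in> fst ` hyperbola_class N m' n'"
    then obtain n where "m * n = m' * n'" by (auto simp: hyperbola_class_def)
    then have "m dvd m' * n'" by (metis dvd_triv_left)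
    then have "nat \<bar>m\<bar> dvd nat \<bar>m' * n'\<bar>" by (simp add: nat_abs_dvd_iff)
    moreover have "m = int (nat \<bar>m\<bar>) \<or> m = - int (nat \<bar>m\<bar>)" by auto
    ultimately show "m \<in> int ` ?D \<union> (\<lambda>d. - int d) ` ?D" by blast
  qed
  then have "card (hyperbola_class N m' n') \<le> card (int ` ?D \<union> (\<lambda>d. - int d) ` ?D)"
    using fin by (intro card_inj_on_le[OF inj]) auto
  also have "\<dots> \<le> card (int ` ?D) + card ((\<lambda>d. - int d) ` ?D)" by (rule card_Un_le)
  also have "\<dots> \<le> card ?D + card ?D" using fin by (intro add_mono card_image_le)
  finally show ?thesis by (simp add: divisor_count_def)
qed

text \<open>Off the axes a class has at most \<open>2 * D\<close> members. On the axes it may have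
  \<open>2 * N\<close>, but only \<open>4 * N\<close> frequencies lie there, so both parts are of
  order \<open>N ^ 2\<close>. The constant 8 is \<open>2 * 4\<close> off the axes and
  \<open>4 + 4\<close> for the two axes.\<close>

lemma sum_hyperbola_class_gcd_le:
  assumes q: "q > 0" and D: "\<And>k. 0 < k \<Longrightarrow> k \<le> N * N \<Longrightarrow> divisor_count k \<le> D"
  shows "(\<Sum>(m', n')\<in>frequency_box N. int (card (hyperbola_class N m' n')) * gcd (gcd m' n') (int q))
       \<le> 8 * int N ^ 2 * int (divisor_count q) * (int D + 1)"
proof -
  let ?A = "{-int N..int N} - {0}"
  let ?f = "\<lambda>(m', n'). int (card (hyperbola_class N m' n')) * gcd (gcd m' n') (int q)"
  let ?t = "int (divisor_count q)"
  have split: "frequency_box N = ?A \<times> ?A \<union> ({0} \<times> ?A \<union> ?A \<times> {0})" by (auto simp: frequency_box_def)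
  have total: "(\<Sum>p\<in>frequency_box N. ?f p)
      = (\<Sum>p\<in>?A \<times> ?A. ?f p) + ((\<Sum>p\<in>{0} \<times> ?A. ?f p) + (\<Sum>p\<in>?A \<times> {0}. ?f p))"
    unfolding split by (subst sum.union_disjoint; (subst sum.union_disjoint)?; auto)
  have f_le: "?f p \<le> 2 * int D * (case p of (m, n) \<Rightarrow> gcd (gcd m n) (int q))" if pA: "p \<in> ?A \<times> ?A" for p
  proof -
    obtain m n where p: "p = (m, n)" by (cases p)
    from pA have mn: "m \<in> {-int N..int N}" "n \<in> {-int N..int N}" "m \<noteq> 0" "n \<noteq> 0"
      unfolding p by auto
    have "\<bar>m * n\<bar> \<le> int N * int N" using mn by (auto simp: abs_mult intro!: mult_mono)
    then have "nat \<bar>m * n\<bar> \<le> N * N" by (simp add: nat_le_iff)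
    then have "divisor_count (nat \<bar>m * n\<bar>) \<le> D" using mn by (intro D) auto
    then have "int (card (hyperbola_class N m n)) \<le> 2 * int D"
      using card_hyperbola_class_le[OF mn(3,4), of N] by linarith
    then have "int (card (hyperbola_class N m n)) * gcd (gcd m n) (int q) \<le> 2 * int D * gcd (gcd m n) (int q)"
      by (intro mult_right_mono) auto
    then show ?thesis by (simp only: p prod.case)
  qed
  have "(\<Sum>p\<in>?A \<times> ?A. ?f p) \<le> (\<Sum>p\<in>?A \<times> ?A. 2 * int D * (case p of (m, n) \<Rightarrow> gcd (gcd m n) (int q)))"
    by (rule sum_mono[OF f_le])
  also have "\<dots> = 2 * int D * (\<Sum>p\<in>?A \<times> ?A. case p of (m, n) \<Rightarrow> gcd (gcd m n) (int q))"
    by (rule sum_distrib_left[symmetric])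
  also have "\<dots> \<le> 2 * int D * (?t * (2 * int N)\<^sup>2)"
    by (rule mult_left_mono[OF sum_gcd2_le[OF q]]) auto
  finally have s1: "(\<Sum>p\<in>?A \<times> ?A. ?f p) \<le> 2 * int D * (?t * (2 * int N)\<^sup>2)" .
  have axis: "int (card (hyperbola_class N m n)) * g \<le> 2 * int N * g" if "m = 0 \<or> n = 0" "g \<ge> 0" for m n g
  proof -
    have "int (card (hyperbola_class N m n)) \<le> 2 * int N"
      using card_hyperbola_class_axis_le[OF that(1), of N] by linarith
    then show ?thesis using that(2) by (rule mult_right_mono)
  qed
  have axis_sum: "(\<Sum>n\<in>?A. 2 * int N * gcd n (int q)) \<le> 2 * int N * (?t * (2 * int N))"
  proof -
    have "(\<Sum>n\<in>?A. 2 * int N * gcd n (int q)) = 2 * int N * (\<Sum>n\<in>?A. gcd n (int q))"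
      by (rule sum_distrib_left[symmetric])
    also have "\<dots> \<le> 2 * int N * (?t * (2 * int N))" by (rule mult_left_mono[OF sum_gcd_le[OF q]]) auto
    finally show ?thesis .
  qed
  have "(\<Sum>p\<in>{0} \<times> ?A. ?f p) = (\<Sum>n\<in>?A. int (card (hyperbola_class N 0 n)) * gcd (gcd 0 n) (int q))"
    by (subst sum.cartesian_product[symmetric]) simp
  also have "\<dots> \<le> (\<Sum>n\<in>?A. 2 * int N * gcd n (int q))"
    using axis[of 0] by (intro sum_mono) (simp add: gcd.assoc)
  finally have s2: "(\<Sum>p\<in>{0} \<times> ?A. ?f p) \<le> 2 * int N * (?t * (2 * int N))" using axis_sum by linarith
  have "(\<Sum>p\<in>?A \<times> {0}. ?f p) = (\<Sum>n\<in>?A. int (card (hyperbola_class N n 0)) * gcd (gcd n 0) (int q))"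
    by (subst sum.cartesian_product[symmetric]) simp
  also have "\<dots> \<le> (\<Sum>n\<in>?A. 2 * int N * gcd n (int q))"
    using axis[of _ 0] by (intro sum_mono) simp
  finally have s3: "(\<Sum>p\<in>?A \<times> {0}. ?f p) \<le> 2 * int N * (?t * (2 * int N))" using axis_sum by linarith
  have "(\<Sum>p\<in>frequency_box N. ?f p) \<le> 2 * int D * (?t * (2 * int N)\<^sup>2)
      + (2 * int N * (?t * (2 * int N)) + 2 * int N * (?t * (2 * int N)))"
    unfolding total by (intro add_mono s1 s2 s3)
  then show ?thesis by (simp add: algebra_simps power2_eq_square)
qed

text \<open>Summing over all units multiplies the box sum by \<open>totient q\<close>. After
  squaring, this gain is cancelled exactly: one totient counts \<open>u\<close> in the coincidences,
  the other is the factor in \<open>card_unit_quadruples_le\<close>. The constant is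
  \<open>16 = 8 * 2\<close>.\<close>

lemma kloosterman_box_sum_le:
  assumes q: "q > 1" and N: "2 * N * N < q"
    and D: "\<And>k. 0 < k \<Longrightarrow> k \<le> N * N \<Longrightarrow> divisor_count k \<le> D"
  shows "(\<Sum>(m, n)\<in>frequency_box N. (cmod (kloosterman q m n))\<^sup>2)\<^sup>2
       \<le> 16 * real N ^ 2 * real q ^ 3 * real (divisor_count q) ^ 4 * (real D + 1)"
proof -
  let ?U = "units_mod q" and ?B = "frequency_box N" and ?Y = "{0..<int q} \<times> {0..<int q}"
  define X where "X = ?U \<times> ?B"
  define S where "S = (\<Sum>(m, n)\<in>?B. (cmod (kloosterman q m n))\<^sup>2)"
  \<comment> \<open>Reduction modulo \<open>q\<close> places the scaled frequencies in
    \<open>?Y\<close>, the range of the complete fourth moment.\<close>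
  define h where "h = (\<lambda>(u, (m, n)). ((m * u) mod int q, (n * inv_mod q u) mod int q))"
  define k where "k = (\<lambda>(a, b). (cmod (kloosterman q a b))\<^sup>2)"
  have finX: "finite X" by (simp add: X_def)
  have hX: "h ` X \<subseteq> ?Y" using q by (auto simp: h_def)
  have kh: "k (h (u, (m, n))) = (cmod (kloosterman q m n))\<^sup>2" if "u \<in> ?U" for u m n
  proof -
    have "kloosterman q ((m * u) mod int q) ((n * inv_mod q u) mod int q) = kloosterman q (m * u) (n * inv_mod q u)"
      by (rule kloosterman_cong) (simp_all add: mod_eq_dvd_iff[symmetric])
    then show ?thesis using kloosterman_scale[OF q that] by (simp add: k_def h_def)
  qed
  have "(\<Sum>x\<in>X. k (h x)) = (\<Sum>u\<in>?U. \<Sum>p\<in>?B. k (h (u, p)))"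
    by (simp add: X_def sum.cartesian_product)
  also have "\<dots> = (\<Sum>u\<in>?U. S)"
    unfolding S_def by (intro sum.cong refl) (auto simp: kh)
  also have "\<dots> = real (totient q) * S" by (simp add: card_units_mod)
  finally have sumX: "(\<Sum>x\<in>X. k (h x)) = real (totient q) * S" .
  have "(\<Sum>y\<in>?Y. (k y)\<^sup>2) = (\<Sum>(a, b)\<in>?Y. cmod (kloosterman q a b) ^ 4)"
    by (intro sum.cong refl) (auto simp: k_def)
  also have "\<dots> = real q ^ 2 * real (card (unit_quadruples q))" using q by (intro kloosterman_fourth_moment) simp
  also have "\<dots> \<le> real q ^ 2 * real (totient q * (divisor_count q ^ 3 * (2 * q)))"
    using card_unit_quadruples_le[of q] q by (intro mult_left_mono of_nat_mono) auto
  finally have sumY: "(\<Sum>y\<in>?Y. (k y)\<^sup>2) \<le> real q ^ 2 * real (totient q * (divisor_count q ^ 3 * (2 * q)))" .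
  define P where "P = {(x, x') \<in> X \<times> X. h x = h x'}"
  define V where "V = (\<lambda>u m n m' n'. {v \<in> ?U. int q dvd m * u - m' * v \<and> int q dvd n * inv_mod q u - n' * inv_mod q v})"
  \<comment> \<open>The coordinates are ordered so that each can be counted given the earlier ones:
    \<open>u\<close> freely, \<open>(m', n')\<close> in the box, \<open>(m, n)\<close> in its class,
    and \<open>v\<close> last.\<close>
  define Q where "Q = Sigma ?U (\<lambda>u. Sigma ?B (\<lambda>p. Sigma (hyperbola_class N (fst p) (snd p))
      (\<lambda>r. V u (fst r) (snd r) (fst p) (snd p))))"
  \<comment> \<open>\<open>2 * N * N\<close> bounds the size of \<open>m * n - m' * n'\<close>; this
    is where the lower bound on \<open>q\<close> turns congruences into equalities.\<close>
  have small: "z = 0" if "int q dvd z" "\<bar>z\<bar> \<le> 2 * int N * int N" for z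
  proof (rule ccontr)
    assume "z \<noteq> 0"
    then have "int q \<le> \<bar>z\<bar>" using dvd_imp_le_int[OF _ that(1)] by simp
    also have "\<bar>z\<bar> < int q" 
    proof -
      have "int (2 * N * N) < int q" using N by (simp only: of_nat_less_iff)
      then show ?thesis using that(2) by simp
    qed
    finally show False by simp
  qed
  have smallN: "\<bar>z\<bar> \<le> 2 * int N * int N" if "\<bar>z\<bar> \<le> int N" for z
  proof (cases "N = 0")
    case False
    then have "int N * 1 \<le> int N * (2 * int N)" by (intro mult_left_mono) auto
    then show ?thesis using that by (simp add: mult_ac)
  qed (use that in auto)
  have fin: "finite (V u m n m' n')" for u m n m' n' by (simp add: V_def)
  have inj: "inj_on (\<lambda>((u, (m, n)), (v, (m', n'))). (u, ((m', n'), ((m, n), v)))) P"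
    by (auto simp: inj_on_def)
  have PQ: "(\<lambda>((u, (m, n)), (v, (m', n'))). (u, ((m', n'), ((m, n), v)))) ` P \<subseteq> Q"
  proof (clarsimp simp: P_def X_def)
    fix u m n v m' n'
    assume u: "u \<in> ?U" and v: "v \<in> ?U" and mn: "(m, n) \<in> ?B" "(m', n') \<in> ?B"
      and eq: "h (u, m, n) = h (v, m', n')"
    have d: "int q dvd m * u - m' * v" "int q dvd n * inv_mod q u - n' * inv_mod q v"
      using eq by (auto simp: h_def mod_eq_dvd_iff)
    have b: "\<bar>m\<bar> \<le> int N" "\<bar>n\<bar> \<le> int N" "\<bar>m'\<bar> \<le> int N" "\<bar>n'\<bar> \<le> int N"
      using mn by (auto simp: frequency_box_def)
    have cu: "coprime (int q) u" "coprime (int q) v" "coprime (int q) (inv_mod q u)" "coprime (int q) (inv_mod q v)"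
      using coprime_units_mod[OF u] coprime_units_mod[OF v] coprime_modular_inverse[of u "int q"] coprime_modular_inverse[of v "int q"]
      by (auto simp: coprime_commute[of "int q"])
    have m0: "m = 0 \<longleftrightarrow> m' = 0"
    proof
      assume "m = 0"
      then have "int q dvd m' * v" using d(1) by simp
      then have "int q dvd m'" using cu by (simp add: coprime_dvd_mult_left_iff)
      then show "m' = 0" using small smallN b by blast
    next
      assume "m' = 0"
      then have "int q dvd m * u" using d(1) by simp
      then have "int q dvd m" using cu by (simp add: coprime_dvd_mult_left_iff)
      then show "m = 0" using small smallN b by blast
    qed
    have n0: "n = 0 \<longleftrightarrow> n' = 0"
    proof
      assume "n = 0"
      then have "int q dvd n' * inv_mod q v" using d(2) by simp
      then have "int q dvd n'" using cu by (simp add: coprime_dvd_mult_left_iff)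
      then show "n' = 0" using small smallN b by blast
    next
      assume "n' = 0"
      then have "int q dvd n * inv_mod q u" using d(2) by simp
      then have "int q dvd n" using cu by (simp add: coprime_dvd_mult_left_iff)
      then show "n = 0" using small smallN b by blast
    qed
    \<comment> \<open>Multiplying the two congruences cancels the units, because
      \<open>u * inv_mod q u\<close> and \<open>v * inv_mod q v\<close> are 1 modulo
      \<open>q\<close>.\<close>
    have "int q dvd (m * u - m' * v) * (n * inv_mod q u) + m' * v * (n * inv_mod q u - n' * inv_mod q v)
        - m * n * (u * inv_mod q u - 1) + m' * n' * (v * inv_mod q v - 1)"
      by (rule dvd_add[OF dvd_diff[OF dvd_add[OF dvd_mult2[OF d(1)] dvd_mult[OF d(2)]]
              dvd_mult[OF inv_mod_dvd[OF u]]] dvd_mult[OF inv_mod_dvd[OF v]]])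
    then have "int q dvd m * n - m' * n'" by (simp add: algebra_simps)
    moreover have "\<bar>m * n - m' * n'\<bar> \<le> 2 * int N * int N"
    proof -
      have "\<bar>m * n\<bar> \<le> int N * int N" "\<bar>m' * n'\<bar> \<le> int N * int N"
        using b by (auto simp: abs_mult intro!: mult_mono)
      then show ?thesis by linarith
    qed
    ultimately have "m * n = m' * n'" using small by (metis eq_iff_diff_eq_0)
    with m0 n0 mn u v d show "(u, ((m', n'), ((m, n), v))) \<in> Q"
      by (simp add: Q_def V_def hyperbola_class_def)
  qed
  have "card P \<le> card Q"
    by (rule card_inj_on_le[OF inj PQ]) (auto simp: Q_def fin)
  also have "card Q = (\<Sum>u\<in>?U. \<Sum>(m', n')\<in>?B. \<Sum>(m, n)\<in>hyperbola_class N m' n'. card (V u m n m' n'))"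
    unfolding Q_def by (simp add: fin split_beta')
  finally have "int (card P) \<le> (\<Sum>u\<in>?U. \<Sum>(m', n')\<in>?B. \<Sum>(m, n)\<in>hyperbola_class N m' n'. int (card (V u m n m' n')))"
    by (simp add: split_beta' flip: of_nat_sum)
  also have "\<dots> \<le> (\<Sum>u\<in>?U. \<Sum>(m', n')\<in>?B. \<Sum>(m, n)\<in>hyperbola_class N m' n'. gcd (gcd m' n') (int q))"
    unfolding V_def split_beta' by (intro sum_mono card_inverse_pair_le)
  also have "\<dots> = int (totient q) * (\<Sum>(m', n')\<in>?B. int (card (hyperbola_class N m' n')) * gcd (gcd m' n') (int q))"
    by (simp add: split_beta' card_units_mod)
  also have "\<dots> \<le> int (totient q) * (8 * int N ^ 2 * int (divisor_count q) * (int D + 1))"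
    using q by (intro mult_left_mono sum_hyperbola_class_gcd_le D) auto
  finally have "real_of_int (int (card P)) \<le> real_of_int (int (totient q) * (8 * int N ^ 2 * int (divisor_count q) * (int D + 1)))"
    by (simp only: of_int_le_iff)
  then have cardP: "real (card P) \<le> real (totient q) * (8 * real N ^ 2 * real (divisor_count q) * (real D + 1))"
    by simp
  have "(real (totient q) * S)\<^sup>2 \<le> real (card P) * (\<Sum>y\<in>?Y. (k y)\<^sup>2)"
    unfolding sumX[symmetric] P_def by (rule sum_comp_square_le[OF finX _ hX]) auto
  also have "\<dots> \<le> (real (totient q) * (8 * real N ^ 2 * real (divisor_count q) * (real D + 1))) *
      (real q ^ 2 * real (totient q * (divisor_count q ^ 3 * (2 * q))))"
    by (intro mult_mono cardP sumY sum_nonneg) auto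
  also have "\<dots> = (real (totient q))\<^sup>2 * (16 * real N ^ 2 * real q ^ 3 * real (divisor_count q) ^ 4 * (real D + 1))"
    by (simp add: power2_eq_square power3_eq_cube power4_eq_xxxx mult_ac)
  finally have "(real (totient q))\<^sup>2 * S\<^sup>2 \<le> (real (totient q))\<^sup>2 * (16 * real N ^ 2 * real q ^ 3 * real (divisor_count q) ^ 4 * (real D + 1))"
    by (simp add: power_mult_distrib)
  then show ?thesis using q by (simp add: S_def mult_le_cancel_left)
qed

section \<open>Periodic functions on the unit square\<close>

definition unit_interval :: "real measure" where
  "unit_interval = density lborel (indicator {0..<1})"

text \<open>Built as a product to have Fubini and coordinatewise rotation at hand;
  \<open>unit_square_eq\<close> identifies it with the measure behind
  \<open>torus_vol\<close>.\<close>

definition unit_square :: "(real \<times> real) measure" where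
  "unit_square = unit_interval \<Otimes>\<^sub>M unit_interval"

lemma sets_unit_interval [simp, measurable_cong]: "sets unit_interval = sets borel"
  by (simp add: unit_interval_def)

lemma space_unit_interval [simp]: "space unit_interval = UNIV"
  by (simp add: unit_interval_def)

lemma emeasure_unit_interval: "A \<in> sets borel \<Longrightarrow> emeasure unit_interval A = emeasure lborel ({0..<1} \<inter> A)"
  unfolding unit_interval_def by (simp add: emeasure_density nn_integral_indicator' Int_commute flip: indicator_inter_arith)

interpretation unit_interval: prob_space unit_interval
  by (rule prob_spaceI) (simp add: emeasure_unit_interval)

interpretation unit_square: pair_prob_space unit_interval unit_interval ..

lemma sets_unit_square [simp, measurable_cong]: "sets unit_square = sets borel"
  unfolding unit_square_def borel_prod[symmetric] by (rule sets_pair_measure_cong) simp_all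

lemma space_unit_square [simp]: "space unit_square = UNIV"
  by (simp add: unit_square_def space_pair_measure)

lemma prob_space_unit_square: "prob_space unit_square"
  unfolding unit_square_def by (rule unit_square.prob_space_axioms)

lemma unit_square_eq: "unit_square = uniform_measure lborel ({0..<1} \<times> {0..<1})"
proof -
  have "unit_square = density (lborel \<Otimes>\<^sub>M lborel) (\<lambda>(x, y). indicator {0..<1} x * indicator {0..<1} y)"
    unfolding unit_square_def unit_interval_def
    using unit_interval.sigma_finite_measure_axioms
    by (intro pair_measure_density) (simp_all add: unit_interval_def lborel.sigma_finite_measure_axioms)
  also have "\<dots> = uniform_measure lborel ({0..<1} \<times> {0..<1})"
    unfolding uniform_measure_def lborel_prod
    by (intro arg_cong[of _ _ "density lborel"] ext)
       (auto simp: emeasure_unit_square indicator_def divide_ennreal_def)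
  finally show ?thesis .
qed

lemma torus_vol_eq: "torus_vol = distr unit_square borel to_torus"
  by (simp add: torus_vol_def unit_square_eq)

lemma frac_measurable [measurable]: "(frac :: real \<Rightarrow> real) \<in> borel_measurable borel"
  unfolding frac_def by measurable

lemma fst_borel_measurable [measurable]: "(fst :: real \<times> real \<Rightarrow> real) \<in> borel_measurable borel"
  and snd_borel_measurable [measurable]: "(snd :: real \<times> real \<Rightarrow> real) \<in> borel_measurable borel"
  by (intro borel_measurable_continuous_onI continuous_intros)+

text \<open>Rotation by \<open>b = frac a\<close> exchanges two intervals:
  \<open>{0..<1 - b}\<close> moves to \<open>{b..<1}\<close> and the rest to \<open>{0..<b}\<close>,
  each by a translation, which preserves Lebesgue measure.\<close>

lemma distr_unit_interval_shift: "distr unit_interval borel (\<lambda>x. frac (x + a)) = unit_interval"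
proof (rule measure_eqI)
  fix A assume "A \<in> sets (distr unit_interval borel (\<lambda>x. frac (x + a)))"
  then have A [measurable]: "A \<in> sets borel" by simp
  define b where "b = frac a"
  have b: "0 \<le> b" "b < 1" by (simp_all add: b_def frac_lt_1)
  have fr: "frac (x + a) = (if x < 1 - b then b + x else b - 1 + x)" if "0 \<le> x" "x < 1" for x
  proof -
    have ab: "a - b \<in> \<int>" by (simp add: b_def frac_def)
    then have "a - b + 1 \<in> \<int>" by simp
    moreover have "(x + a) - (b + x) = a - b" "(x + a) - (b - 1 + x) = a - b + 1" by simp_all
    ultimately show ?thesis using ab that b by (auto simp only: frac_unique_iff split: if_splits)
  qed
  have trans: "emeasure lborel ((+) c -` S) = emeasure lborel S" if "S \<in> sets borel" for c :: real and S
  proof -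
    have "emeasure lborel S = emeasure (distr lborel borel ((+) c)) S" by (simp add: lborel_distr_plus)
    also have "\<dots> = emeasure lborel ((+) c -` S)" using that by (subst emeasure_distr) auto
    finally show ?thesis by simp
  qed
  have vm: "(+) c -` S \<in> sets borel" if "S \<in> sets borel" for c :: real and S
    using measurable_sets[OF borel_measurable_continuous_onI that, of "(+) c"] by (simp add: continuous_intros)
  have "emeasure (distr unit_interval borel (\<lambda>x. frac (x + a))) A = emeasure lborel ({0..<1} \<inter> (\<lambda>x. frac (x + a)) -` A)"
  proof (subst emeasure_distr)
    have "(\<lambda>x. frac (x + a)) -` A \<in> sets borel"
      using measurable_sets_borel[of "\<lambda>x. frac (x + a)" borel A] by simp
    then show "emeasure unit_interval ((\<lambda>x. frac (x + a)) -` A \<inter> space unit_interval)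
        = emeasure lborel ({0..<1} \<inter> (\<lambda>x. frac (x + a)) -` A)"
      by (simp add: emeasure_unit_interval)
  qed simp_all
  also have "{0..<1} \<inter> (\<lambda>x. frac (x + a)) -` A = ((+) b -` ({b..<1} \<inter> A)) \<union> ((+) (b - 1) -` ({0..<b} \<inter> A))"
    using b by (auto simp: fr split: if_splits)
  also have "emeasure lborel \<dots> = emeasure lborel ((+) b -` ({b..<1} \<inter> A)) + emeasure lborel ((+) (b - 1) -` ({0..<b} \<inter> A))"
    by (intro plus_emeasure[symmetric]) (auto intro!: vm)
  also have "\<dots> = emeasure lborel ({b..<1} \<inter> A) + emeasure lborel ({0..<b} \<inter> A)"
    using trans[of "{b..<1} \<inter> A" b] trans[of "{0..<b} \<inter> A" "b - 1"] by simp
  also have "\<dots> = emeasure lborel (({b..<1} \<inter> A) \<union> ({0..<b} \<inter> A))"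
    by (intro plus_emeasure) auto
  also have "({b..<1} \<inter> A) \<union> ({0..<b} \<inter> A) = {0..<1} \<inter> A" using b by auto
  finally show "emeasure (distr unit_interval borel (\<lambda>x. frac (x + a))) A = emeasure unit_interval A"
    by (simp add: emeasure_unit_interval)
qed simp

lemma distr_unit_square_shift:
  "distr unit_square borel (\<lambda>z. (frac (fst z + a), frac (snd z + b))) = unit_square"
proof -
  have "unit_square = distr unit_interval borel (\<lambda>x. frac (x + a)) \<Otimes>\<^sub>M distr unit_interval borel (\<lambda>x. frac (x + b))"
    by (simp add: distr_unit_interval_shift unit_square_def)
  also have "\<dots> = distr (unit_interval \<Otimes>\<^sub>M unit_interval) (borel \<Otimes>\<^sub>M borel) (\<lambda>(x, y). (frac (x + a), frac (y + b)))"
    by (intro pair_measure_distr) (simp_all add: distr_unit_interval_shift unit_interval.sigma_finite_measure_axioms)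
  also have "\<dots> = distr unit_square borel (\<lambda>z. (frac (fst z + a), frac (snd z + b)))"
    by (simp add: unit_square_def borel_prod split_beta')
  finally show ?thesis by simp
qed

text \<open>Functions on the torus are handled as periodic functions on the plane, where translation
  is ordinary addition.\<close>

definition periodic2 :: "(real \<times> real \<Rightarrow> 'a) \<Rightarrow> bool" where
  "periodic2 f \<longleftrightarrow> (\<forall>x y i j. f (x + of_int i, y + of_int j) = f (x, y))"

lemma periodic2_frac:
  assumes "periodic2 f" shows "f (frac x, frac y) = f (x, y)"
  using assms[unfolded periodic2_def, rule_format, of "frac x" "\<lfloor>x\<rfloor>" "frac y" "\<lfloor>y\<rfloor>"]
  by (simp add: frac_def)

lemma integral_unit_square_shift:
  fixes f :: "real \<times> real \<Rightarrow> 'a :: {banach, second_countable_topology}"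
  assumes [measurable]: "f \<in> borel_measurable borel" and per: "periodic2 f"
  shows "(\<integral>z. f (z + w) \<partial>unit_square) = (\<integral>z. f z \<partial>unit_square)"
proof -
  have "(\<integral>z. f z \<partial>unit_square) = (\<integral>z. f z \<partial>distr unit_square borel (\<lambda>z. (frac (fst z + fst w), frac (snd z + snd w))))"
    by (simp only: distr_unit_square_shift)
  also have "\<dots> = (\<integral>z. f (frac (fst z + fst w), frac (snd z + snd w)) \<partial>unit_square)"
  proof (rule integral_distr)
    show "(\<lambda>z. (frac (fst z + fst w), frac (snd z + snd w))) \<in> borel_measurable unit_square"
      by (intro borel_measurable_Pair) measurable
  qed measurable
  also have "\<dots> = (\<integral>z. f (z + w) \<partial>unit_square)"
    by (simp add: periodic2_frac[OF per] plus_prod_def)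
  finally show ?thesis by simp
qed

lemma echar_measurable [measurable]: "echar \<in> borel_measurable borel"
  unfolding echar_def by (intro borel_measurable_continuous_onI continuous_intros)

definition wave :: "int \<times> int \<Rightarrow> real \<times> real \<Rightarrow> complex" where
  "wave p z = echar (of_int (fst p) * fst z + of_int (snd p) * snd z)"

lemma wave_measurable [measurable]: "wave p \<in> borel_measurable borel"
  unfolding wave_def by measurable

lemma norm_wave [simp]: "cmod (wave p z) = 1"
  by (simp add: wave_def)

lemma periodic2_wave: "periodic2 (wave p)"
  unfolding periodic2_def
proof (intro allI)
  fix x y :: real and i j :: int
  have "of_int (fst p) * (x + of_int i) + of_int (snd p) * (y + of_int j)
     = (of_int (fst p) * x + of_int (snd p) * y) + of_int (fst p * i + snd p * j)"
    by (simp add: algebra_simps)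
  then show "wave p (x + of_int i, y + of_int j) = wave p (x, y)"
    by (simp only: wave_def fst_conv snd_conv echar_add echar_of_int mult_1_right)
qed

lemma integrable_unit_square_bounded:
  fixes f :: "real \<times> real \<Rightarrow> 'a :: {banach, second_countable_topology}"
  assumes "f \<in> borel_measurable borel" "\<And>z. norm (f z) \<le> B"
  shows "integrable unit_square f"
  using assms prob_space_unit_square[THEN prob_space.finite_measure]
  by (intro finite_measure.integrable_const_bound[of _ _ B]) (auto simp: measurable_def[of borel] measurable_def[of unit_square])

lemma integral_wave: "(\<integral>z. wave p z \<partial>unit_square) = (if p = (0, 0) then 1 else 0)"
proof (cases "p = (0, 0)")
  case True
  then show ?thesis
    using prob_space.prob_space[OF prob_space_unit_square] by (simp add: wave_def)
next
  case False
  \<comment> \<open>translation by \<open>w\<close> changes the sign of the wave but not its integral\<close>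
  obtain w where w: "wave p w = -1"
  proof (cases "fst p = 0")
    case True
    then have "snd p \<noteq> 0" using False by (metis prod.collapse)
    then show ?thesis using True by (intro that[of "(0, 1 / (2 * of_int (snd p)))"]) (simp add: wave_def echar_def)
  next
    case False
    then show ?thesis by (intro that[of "(1 / (2 * of_int (fst p)), 0)"]) (simp add: wave_def echar_def)
  qed
  have "wave p (z + w) = - wave p z" for z
  proof -
    have "wave p (z + w) = wave p z * wave p w"
      by (simp add: wave_def echar_add[symmetric] algebra_simps)
    then show ?thesis by (simp add: w)
  qed
  then have "(\<integral>z. wave p z \<partial>unit_square) = (\<integral>z. - wave p z \<partial>unit_square)"
    using integral_unit_square_shift[OF wave_measurable periodic2_wave, of p w] by simp
  also have "\<dots> = - (\<integral>z. wave p z \<partial>unit_square)" by simp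
  finally show ?thesis using False by simp
qed

text \<open>Finite orthogonality suffices: the smoothing kernel is a trigonometric polynomial, so no
  question of convergence arises.\<close>

lemma parseval_unit_square:
  assumes B: "finite B"
  shows "(\<integral>z. (cmod (\<Sum>p\<in>B. c p * wave p z))\<^sup>2 \<partial>unit_square) = (\<Sum>p\<in>B. (cmod (c p))\<^sup>2)"
proof -
  have wv: "wave p z * cnj (wave r z) = wave (fst p - fst r, snd p - snd r) z" for p r z
    by (simp add: wave_def cnj_echar echar_add[symmetric] algebra_simps)
  have sq: "complex_of_real ((cmod (\<Sum>p\<in>B. c p * wave p z))\<^sup>2)
      = (\<Sum>p\<in>B. \<Sum>r\<in>B. (c p * cnj (c r)) * wave (fst p - fst r, snd p - snd r) z)" for z
    unfolding complex_norm_square cnj_sum sum_product complex_cnj_mult wv[symmetric]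
    by (intro sum.cong refl) (simp add: mult_ac)
  have int: "integrable unit_square (wave p)" for p
    by (rule integrable_unit_square_bounded[of _ 1]) auto
  have "complex_of_real (\<integral>z. (cmod (\<Sum>p\<in>B. c p * wave p z))\<^sup>2 \<partial>unit_square)
     = (\<integral>z. complex_of_real ((cmod (\<Sum>p\<in>B. c p * wave p z))\<^sup>2) \<partial>unit_square)"
    by (rule integral_complex_of_real[symmetric])
  also have "\<dots> = (\<Sum>p\<in>B. \<Sum>r\<in>B. (c p * cnj (c r)) * (if p = r then 1 else 0))"
    unfolding sq using int
    by (simp add: Bochner_Integration.integral_sum integral_wave prod_eq_iff)
  also have "\<dots> = (\<Sum>p\<in>B. c p * cnj (c p))" using B by (simp add: mult_delta_right)
  also have "\<dots> = complex_of_real (\<Sum>p\<in>B. (cmod (c p))\<^sup>2)"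
    by (simp only: of_real_sum complex_norm_square)
  finally show ?thesis by (simp only: of_real_eq_iff)
qed

section \<open>The Jackson kernel\<close>

definition tent :: "nat \<Rightarrow> nat \<Rightarrow> real" where
  "tent M j = real (min j (2 * M - j))" \<comment> \<open>truncated subtraction, but only \<open>j \<le> 2 * M\<close> is used\<close>

definition tent_norm :: "nat \<Rightarrow> real" where
  "tent_norm M = (\<Sum>j\<le>2 * M. (tent M j)\<^sup>2)"

definition tent_poly :: "nat \<Rightarrow> real \<Rightarrow> complex" where
  "tent_poly M x = (\<Sum>j\<le>2 * M. tent M j * echar (real j * x))"

text \<open>Up to a shift, the tent sequence is the self-convolution of \<open>M\<close> ones, so
  this is the normalised fourth power of a Dirichlet kernel. A Fejer kernel would come from constant
  coefficients, which jump at both ends; its second moment is only of order \<open>1 / M\<close>,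
  too weak for the Chebyshev bound on the tail.\<close>

definition jackson :: "nat \<Rightarrow> real \<Rightarrow> real" where
  "jackson M x = (cmod (tent_poly M x))\<^sup>2 / tent_norm M"

definition jackson_coeff :: "nat \<Rightarrow> int \<Rightarrow> real" where
  "jackson_coeff M m = (\<Sum>(j, k)\<in>{(j, k) \<in> {..2 * M} \<times> {..2 * M}. int j - int k = m}. tent M j * tent M k) / tent_norm M"

lemma tent_norm_ge: "tent_norm M \<ge> real M ^ 3 / 3"
proof -
  have "real M ^ 3 / 3 \<le> (\<Sum>j\<le>M. (real j)\<^sup>2)"
    by (induction M) (auto simp: power3_eq_cube power2_eq_square algebra_simps)
  also have "\<dots> = (\<Sum>j\<le>M. (tent M j)\<^sup>2)"
    by (intro sum.cong refl) (auto simp: tent_def)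
  also have "\<dots> \<le> tent_norm M"
    unfolding tent_norm_def by (intro sum_mono2) auto
  finally show ?thesis .
qed

lemma tent_norm_pos: "M > 0 \<Longrightarrow> tent_norm M > 0"
  using tent_norm_ge[of M] by (smt (verit) divide_pos_pos of_nat_0_less_iff zero_less_power)

lemma jackson_nonneg: "jackson M x \<ge> 0"
  by (simp add: jackson_def tent_norm_def sum_nonneg)

lemma jackson_measurable [measurable]: "jackson M \<in> borel_measurable borel"
  unfolding jackson_def tent_poly_def by measurable

lemma jackson_expansion:
  "complex_of_real (jackson M x) = (\<Sum>m\<in>{-int (2 * M)..int (2 * M)}. jackson_coeff M m * echar (of_int m * x))"
proof -
  let ?I = "{..2 * M} \<times> {..2 * M}" and ?N = "complex_of_real (tent_norm M)"
  let ?f = "\<lambda>(j, k). complex_of_real (tent M j * tent M k) * echar (of_int (int j - int k) * x) / ?N"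
  let ?g = "\<lambda>(j, k). int j - int k"
  have "complex_of_real (jackson M x) = (\<Sum>j\<le>2 * M. \<Sum>k\<le>2 * M. ?f (j, k))"
    unfolding jackson_def tent_poly_def of_real_divide complex_norm_square cnj_sum sum_product sum_divide_distrib
    by (intro sum.cong refl) (simp add: cnj_echar echar_add[symmetric] algebra_simps)
  also have "\<dots> = (\<Sum>p\<in>?I. ?f p)" by (simp only: sum.cartesian_product prod.case split_beta' prod.collapse)
  also have "\<dots> = (\<Sum>m\<in>{-int (2 * M)..int (2 * M)}. \<Sum>p | p \<in> ?I \<and> ?g p = m. ?f p)"
    by (rule sum.group[symmetric]) auto
  also have "\<dots> = (\<Sum>m\<in>{-int (2 * M)..int (2 * M)}. jackson_coeff M m * echar (of_int m * x))"
  proof (intro sum.cong refl)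
    fix m
    have "{p. p \<in> ?I \<and> ?g p = m} = {(j, k) \<in> ?I. int j - int k = m}" by auto
    then have "(\<Sum>p | p \<in> ?I \<and> ?g p = m. ?f p) = (\<Sum>p\<in>{(j, k) \<in> ?I. int j - int k = m}. ?f p)" by simp
    also have "\<dots> = (\<Sum>p\<in>{(j, k) \<in> ?I. int j - int k = m}. (case p of (j, k) \<Rightarrow> complex_of_real (tent M j * tent M k)) * (echar (of_int m * x) / ?N))"
      by (intro sum.cong refl) auto
    also have "\<dots> = jackson_coeff M m * echar (of_int m * x)"
      unfolding sum_distrib_right[symmetric] by (simp add: jackson_coeff_def split_beta')
    finally show "(\<Sum>p | p \<in> ?I \<and> ?g p = m. ?f p) = jackson_coeff M m * echar (of_int m * x)" .
  qed
  finally show ?thesis .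
qed

lemma jackson_coeff_0:
  assumes "M > 0" shows "jackson_coeff M 0 = 1"
proof -
  have "{(j, k) \<in> {..2 * M} \<times> {..2 * M}. int j - int k = 0} = (\<lambda>j. (j, j)) ` {..2 * M}" by auto
  then have "(\<Sum>(j, k)\<in>{(j, k) \<in> {..2 * M} \<times> {..2 * M}. int j - int k = 0}. tent M j * tent M k) = tent_norm M"
    by (simp add: sum.reindex inj_on_def tent_norm_def power2_eq_square)
  then show ?thesis using tent_norm_pos[OF assms] by (simp add: jackson_coeff_def)
qed

text \<open>Cauchy-Schwarz for an autocorrelation, via \<open>x * y <= (x^2 + y^2) / 2\<close>: for
  a fixed difference, either of \<open>j\<close> and \<open>k\<close> determines the pair.\<close>

lemma abs_jackson_coeff_le: "\<bar>jackson_coeff M m\<bar> \<le> 1"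
proof -
  let ?S = "{(j, k) \<in> {..2 * M} \<times> {..2 * M}. int j - int k = m}"
  have fin: "finite ?S" by (rule finite_subset[of _ "{..2 * M} \<times> {..2 * M}"]) auto
  have le: "(\<Sum>p\<in>?S. (tent M (f p))\<^sup>2) \<le> tent_norm M" if "inj_on f ?S" "f ` ?S \<subseteq> {..2 * M}" for f
  proof -
    have "(\<Sum>p\<in>?S. (tent M (f p))\<^sup>2) = (\<Sum>j\<in>f ` ?S. (tent M j)\<^sup>2)" by (rule sum.reindex[OF that(1), unfolded o_def, symmetric])
    also have "\<dots> \<le> tent_norm M" unfolding tent_norm_def using that(2) by (intro sum_mono2) auto
    finally show ?thesis .
  qed
  have nn: "tent_norm M \<ge> 0" by (simp add: tent_norm_def sum_nonneg)
  have "\<bar>\<Sum>(j, k)\<in>?S. tent M j * tent M k\<bar> = (\<Sum>(j, k)\<in>?S. tent M j * tent M k)"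
    by (intro abs_of_nonneg sum_nonneg) (auto simp: tent_def)
  also have "\<dots> \<le> (\<Sum>p\<in>?S. ((tent M (fst p))\<^sup>2 + (tent M (snd p))\<^sup>2) / 2)"
  proof (intro sum_mono, unfold split_beta')
    fix p
    have "0 \<le> (tent M (fst p) - tent M (snd p))\<^sup>2" by simp
    then show "tent M (fst p) * tent M (snd p) \<le> ((tent M (fst p))\<^sup>2 + (tent M (snd p))\<^sup>2) / 2"
      by (simp add: power2_diff)
  qed
  also have "\<dots> = ((\<Sum>p\<in>?S. (tent M (fst p))\<^sup>2) + (\<Sum>p\<in>?S. (tent M (snd p))\<^sup>2)) / 2"
    by (simp only: sum_divide_distrib[symmetric] sum.distrib)
  also have "\<dots> \<le> tent_norm M"
  proof -
    have "(\<Sum>p\<in>?S. (tent M (fst p))\<^sup>2) \<le> tent_norm M" by (rule le) (auto simp: inj_on_def)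
    moreover have "(\<Sum>p\<in>?S. (tent M (snd p))\<^sup>2) \<le> tent_norm M" by (rule le) (auto simp: inj_on_def)
    moreover have "(a + b) / 2 \<le> c" if "a \<le> c" "b \<le> c" for a b c :: real using that by simp
    ultimately show ?thesis by blast
  qed
  finally show ?thesis
    using nn by (auto simp: jackson_coeff_def divide_simps)
qed

text \<open>A crude count of the frequencies, which only serves integrability and never enters the
  final estimate.\<close>

lemma jackson_le: "jackson M x \<le> 4 * real M + 1"
proof -
  have "cmod (complex_of_real (jackson M x)) \<le> (\<Sum>m\<in>{-int (2 * M)..int (2 * M)}. 1)"
    unfolding jackson_expansion
    using abs_jackson_coeff_le by (intro sum_norm_le) (simp add: norm_mult)
  then show ?thesis by simp
qed

lemma jackson_abs_le: "\<bar>jackson M x\<bar> \<le> 4 * real M + 1"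
  using jackson_le[of M x] jackson_nonneg[of M x] by simp

lemma integral_unit_square_product:
  fixes f :: "real \<Rightarrow> real" and g :: "real \<Rightarrow> real"
  assumes [measurable]: "f \<in> borel_measurable borel" "g \<in> borel_measurable borel"
    and bd: "\<And>x. \<bar>f x\<bar> \<le> B" "\<And>x. \<bar>g x\<bar> \<le> C"
  shows "(\<integral>z. f (fst z) * g (snd z) \<partial>unit_square) = (\<integral>x. f x \<partial>unit_interval) * (\<integral>x. g x \<partial>unit_interval)"
proof -
  have int: "integrable unit_square (\<lambda>z. f (fst z) * g (snd z))"
  proof (rule integrable_unit_square_bounded[of _ "B * C"])
    fix z
    have "B \<ge> 0" using bd(1)[of 0] by linarith
    then show "norm (f (fst z) * g (snd z)) \<le> B * C"
      using bd by (auto simp: abs_mult intro!: mult_mono)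
  qed measurable
  have "(\<integral>z. f (fst z) * g (snd z) \<partial>unit_square) = (\<integral>x. \<integral>y. f x * g y \<partial>unit_interval \<partial>unit_interval)"
    using unit_square.integral_fst'[OF int[unfolded unit_square_def]] by (simp add: unit_square_def)
  then show ?thesis by simp
qed

lemma integral_jackson:
  assumes "M > 0"
  shows "(\<integral>x. jackson M x \<partial>unit_interval) = 1"
proof -
  \<comment> \<open>The one-dimensional identity is the two-dimensional Parseval formula with second
    frequency 0.\<close>
  have "(\<integral>z. (cmod (\<Sum>p\<in>(\<lambda>j. (int j, 0)) ` {..2 * M}. complex_of_real (tent M (nat (fst p))) * wave p z))\<^sup>2 \<partial>unit_square) = tent_norm M"
    by (subst parseval_unit_square) (auto simp: sum.reindex inj_on_def tent_norm_def)
  moreover have "(\<Sum>p\<in>(\<lambda>j. (int j, 0)) ` {..2 * M}. complex_of_real (tent M (nat (fst p))) * wave p z) = tent_poly M (fst z)" for z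
    by (simp add: sum.reindex inj_on_def tent_poly_def wave_def)
  ultimately have "(\<integral>z. jackson M (fst z) \<partial>unit_square) = 1"
    using tent_norm_pos[OF assms] by (simp add: jackson_def)
  moreover have "(\<integral>z. jackson M (fst z) \<partial>unit_square) = (\<integral>x. jackson M x \<partial>unit_interval)"
    using integral_unit_square_product[of "jackson M" "\<lambda>_. 1" "4 * real M + 1" 1] jackson_le jackson_nonneg
      unit_interval.prob_space by (simp add: abs_of_nonneg)
  ultimately show ?thesis by simp
qed

text \<open>
  Multiplying \<^const>\<open>tent_poly\<close> by \<open>echar x - 1\<close> replaces its coefficients by their
  differences, which are at most 1 in absolute value.
\<close>

lemma integral_jackson_sin_le:
  assumes M: "M > 0"
  shows "(\<integral>x. jackson M x * (sin (pi * x))\<^sup>2 \<partial>unit_interval) \<le> 3 / (2 * (real M)\<^sup>2)"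
proof -
  define c where "c = (\<lambda>j. if j = 0 then 0 else tent M (j - 1) - tent M j)"
  have c_le: "(c j)\<^sup>2 \<le> 1" for j
  proof -
    have "\<bar>c j\<bar> \<le> 1" by (cases j) (auto simp: c_def tent_def)
    then show ?thesis by (simp add: abs_square_le_1)
  qed
  have tel: "(echar x - 1) * tent_poly M x = (\<Sum>j\<le>2 * M. complex_of_real (c j) * echar (real j * x))" for x
  proof -
    \<comment> \<open>Summation by parts. The boundary term disappears at \<open>n = 2 * M\<close>,
      where the tent vanishes.\<close>
    have "(\<Sum>j\<le>n. complex_of_real (c j) * echar (real j * x))
       = (echar x - 1) * (\<Sum>j\<le>n. complex_of_real (tent M j) * echar (real j * x)) - complex_of_real (tent M n) * echar (real (Suc n) * x)" for n
    proof (induction n)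
      case 0
      show ?case by (simp add: c_def tent_def)
    next
      case (Suc n)
      have e: "echar (real (Suc k) * x) = echar x * echar (real k * x)" for k
        by (simp add: echar_add[symmetric] algebra_simps)
      show ?case
        unfolding sum.atMost_Suc Suc.IH e by (simp add: c_def algebra_simps)
    qed
    from this[of "2 * M"] show ?thesis by (simp add: tent_poly_def tent_def)
  qed
  have sin: "4 * (sin (pi * x))\<^sup>2 = (cmod (echar x - 1))\<^sup>2" for x
  proof -
    have "(cmod (echar x - 1))\<^sup>2 = (cos (2 * (pi * x)) - 1)\<^sup>2 + (sin (2 * (pi * x)))\<^sup>2"
      by (simp add: echar_def cmod_power2 mult.assoc)
    also have "\<dots> = 2 - 2 * cos (2 * (pi * x))"
      by (simp add: sin_squared_eq power2_diff)
    finally show ?thesis by (simp add: cos_double_sin)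
  qed
  have "jackson M x * (sin (pi * x))\<^sup>2 = (cmod (\<Sum>j\<le>2 * M. complex_of_real (c j) * echar (real j * x)))\<^sup>2 / (4 * tent_norm M)" for x
    unfolding tel[symmetric] norm_mult power_mult_distrib sin[symmetric] by (simp add: jackson_def)
  moreover have "(\<Sum>p\<in>(\<lambda>j. (int j, 0)) ` {..2 * M}. complex_of_real (c (nat (fst p))) * wave p z) = (\<Sum>j\<le>2 * M. complex_of_real (c j) * echar (real j * fst z))" for z
    by (simp add: sum.reindex inj_on_def wave_def)
  moreover have "(\<integral>z. (cmod (\<Sum>p\<in>(\<lambda>j. (int j, 0)) ` {..2 * M}. complex_of_real (c (nat (fst p))) * wave p z))\<^sup>2 \<partial>unit_square) = (\<Sum>j\<le>2 * M. (c j)\<^sup>2)"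
    by (subst parseval_unit_square) (auto simp: sum.reindex inj_on_def)
  ultimately have "(\<integral>z. jackson M (fst z) * (sin (pi * fst z))\<^sup>2 \<partial>unit_square) = (\<Sum>j\<le>2 * M. (c j)\<^sup>2) / (4 * tent_norm M)"
    by simp
  moreover have "(\<integral>z. jackson M (fst z) * (sin (pi * fst z))\<^sup>2 \<partial>unit_square) = (\<integral>x. jackson M x * (sin (pi * x))\<^sup>2 \<partial>unit_interval)"
  proof -
    have "\<bar>jackson M x * (sin (pi * x))\<^sup>2\<bar> \<le> 4 * real M + 1" for x
      using mult_mono[OF jackson_le[of M x], of "(sin (pi * x))\<^sup>2" 1] jackson_nonneg[of M x]
      by (simp add: abs_mult abs_square_le_1)
    then show ?thesis
      using integral_unit_square_product[of "\<lambda>x. jackson M x * (sin (pi * x))\<^sup>2" "\<lambda>_. 1" "4 * real M + 1" 1]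
        unit_interval.prob_space by simp
  qed
  moreover have "(\<Sum>j\<le>2 * M. (c j)\<^sup>2) \<le> (\<Sum>j\<in>{1..2 * M}. 1)"
  proof -
    have "(\<Sum>j\<le>2 * M. (c j)\<^sup>2) = (\<Sum>j\<in>{1..2 * M}. (c j)\<^sup>2)"
      by (rule sum.mono_neutral_right) (auto simp: c_def)
    also have "\<dots> \<le> (\<Sum>j\<in>{1..2 * M}. 1)" by (intro sum_mono c_le)
    finally show ?thesis .
  qed
  ultimately have "(\<integral>x. jackson M x * (sin (pi * x))\<^sup>2 \<partial>unit_interval) \<le> (2 * real M) / (4 * tent_norm M)"
    using tent_norm_pos[OF M] by (simp add: field_simps)
  \<comment> \<open>\<open>tent_norm M\<close> is cubic in \<open>M\<close> while only
    \<open>2 * M\<close> differences contribute; hence the decay like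
    \<open>1 / M^2\<close>.\<close>
  also have "\<dots> \<le> (2 * real M) / (4 * (real M ^ 3 / 3))"
    using tent_norm_ge[of M] M by (intro divide_left_mono) (auto intro!: mult_pos_pos tent_norm_pos)
  also have "\<dots> = 3 / (2 * (real M)\<^sup>2)"
    using M by (simp add: power3_eq_cube power2_eq_square field_simps)
  finally show ?thesis .
qed

section \<open>Discs on the torus\<close>

definition torus_norm :: "real \<times> real \<Rightarrow> real" where
  "torus_norm z = sqrt ((infdist (fst z) \<int>)\<^sup>2 + (infdist (snd z) \<int>)\<^sup>2)"

lemma dist_to_torus: "dist (to_torus y) (to_torus z) = torus_norm (y - z)"
  by (simp add: to_torus_def dist_prod_def dist_to_circle torus_norm_def)

lemma torus_norm_eq_dist: "torus_norm z = dist (to_torus z) (to_torus 0)"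
  by (simp add: dist_to_torus)

lemma torus_norm_add_le: "torus_norm (y + z) \<le> torus_norm y + torus_norm z"
proof -
  have "torus_norm (y + z) = dist (to_torus (y + z)) (to_torus 0)" by (rule torus_norm_eq_dist)
  also have "\<dots> \<le> dist (to_torus (y + z)) (to_torus z) + dist (to_torus z) (to_torus 0)"
    by (rule dist_triangle)
  finally show ?thesis by (simp add: dist_to_torus)
qed

lemma torus_norm_minus: "torus_norm (- z) = torus_norm z"
proof -
  have "torus_norm (- z) = dist (to_torus 0) (to_torus z)" by (simp add: dist_to_torus)
  then show ?thesis by (simp add: dist_commute torus_norm_eq_dist)
qed

lemma torus_norm_periodic: "torus_norm (x + of_int i, y + of_int j) = torus_norm (x, y)"
  by (simp add: torus_norm_def infdist_Ints_cong[of "x + of_int i" x] infdist_Ints_cong[of "y + of_int j" y])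

lemma torus_norm_measurable [measurable]: "torus_norm \<in> borel_measurable borel"
  unfolding torus_norm_def by (intro borel_measurable_continuous_onI continuous_intros)

lemma infdist_Ints_eq_abs:
  fixes x :: real
  assumes "\<bar>x\<bar> \<le> 1 / 2" shows "infdist x \<int> = \<bar>x\<bar>"
proof (rule antisym)
  show "infdist x \<int> \<le> \<bar>x\<bar>" using infdist_Ints_le[of 0 x] by simp
  obtain n where n: "n \<in> \<int>" "infdist x \<int> = \<bar>x - n\<bar>" by (rule infdist_Ints_attained)
  show "\<bar>x\<bar> \<le> infdist x \<int>"
  proof (cases "n = 0")
    case False
    then have "\<bar>n\<bar> \<ge> 1" using n(1) by (auto elim!: Ints_cases)
    then show ?thesis using assms n(2) by linarith
  qed (use n in simp)
qed

text \<open>Jordan's inequality with a factor 2 to spare. It trades the distance for a sine, whose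
  square has a mean against the kernel that Parseval computes.\<close>

lemma infdist_le_abs_sin_pi: "infdist x \<int> \<le> \<bar>sin (pi * x)\<bar>"
proof -
  obtain n where n: "n \<in> \<int>" "infdist x \<int> = \<bar>x - n\<bar>" by (rule infdist_Ints_attained)
  then obtain k where k: "n = of_int k" by (auto elim: Ints_cases)
  define t where "t = pi * \<bar>x - n\<bar>"
  have "\<bar>x - n\<bar> \<le> 1 / 2"
    using infdist_Ints_le[of "of_int (round x)" x] of_int_round_abs_le[of x] n(2) by (simp add: abs_minus_commute)
  then have t: "0 \<le> t" "t \<le> pi / 2" by (simp_all add: t_def)
  have s: "\<bar>sin (pi * x)\<bar> = \<bar>sin t\<bar>"
  proof -
    have "sin (pi * (x - n)) = sin (pi * x) * cos (pi * of_int k) - cos (pi * x) * sin (pi * of_int k)"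
      by (simp add: k sin_diff right_diff_distrib)
    then have "\<bar>sin (pi * (x - n))\<bar> = \<bar>sin (pi * x)\<bar> * \<bar>cos (pi * of_int k)\<bar>"
      by (simp add: sin_integer_2pi sin_times_pi_eq_0[of "of_int k", unfolded mult.commute[of _ pi]] abs_mult)
    also have "\<bar>cos (pi * of_int k)\<bar> = 1"
      using sin_cos_squared_add[of "pi * of_int k"] sin_times_pi_eq_0[of "of_int k"]
      by (simp add: mult.commute abs_square_eq_1 flip: power2_eq_1_iff)
    finally have "\<bar>sin (pi * (x - n))\<bar> = \<bar>sin (pi * x)\<bar>" by simp
    moreover have "t = pi * (x - n) \<or> t = - (pi * (x - n))" by (auto simp: t_def abs_if algebra_simps)
    ultimately show ?thesis by auto
  qed
  have "\<bar>sin t - t\<bar> \<le> t ^ 3 / 6"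
    using Maclaurin_sin_bound[of t 3] t
    by (simp add: sin_coeff_def numeral_eq_Suc fact_numeral lessThan_Suc)
  then have "sin t \<ge> t - t ^ 3 / 6" by linarith
  then have "sin t \<ge> t * (1 - t\<^sup>2 / 6)" by (simp add: power3_eq_cube power2_eq_square algebra_simps)
  \<comment> \<open>\<open>t <= 8/5\<close> gives \<open>1 - t^2 / 6 >= 43/75\<close>, which exceeds
    \<open>1/3\<close> and hence \<open>1 / pi\<close>.\<close>
  moreover have "1 - t\<^sup>2 / 6 \<ge> 1 / pi"
  proof -
    have "pi \<le> 16 / 5" using pi_approx(2) by (rule order_trans) simp
    then have "t \<le> 8 / 5" using t by linarith
    then have "t\<^sup>2 \<le> (8 / 5)\<^sup>2" using t by (intro power_mono) auto
    then have "t\<^sup>2 \<le> 64 / 25" by (simp add: power2_eq_square)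
    moreover have "1 / pi \<le> 1 / 3" using pi_gt3 by (simp add: divide_simps)
    ultimately show ?thesis by linarith
  qed
  ultimately have "sin t \<ge> t * (1 / pi)" using mult_left_mono[of "1 / pi" "1 - t\<^sup>2 / 6" t] t by linarith
  then have "sin t \<ge> \<bar>x - n\<bar>" by (simp add: t_def)
  then show ?thesis using s n by linarith
qed

definition disc_ind :: "real \<Rightarrow> real \<times> real \<Rightarrow> real" where
  "disc_ind R z = (if torus_norm z < R then 1 else 0)"

lemma disc_ind_measurable [measurable]: "disc_ind R \<in> borel_measurable borel"
  unfolding disc_ind_def by measurable

lemma disc_ind_bounds: "0 \<le> disc_ind R z" "disc_ind R z \<le> 1"
  by (simp_all add: disc_ind_def)

lemma periodic2_disc_ind: "periodic2 (disc_ind R)"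
  by (simp add: periodic2_def disc_ind_def torus_norm_periodic)

lemma disc_ind_minus: "disc_ind R (- z) = disc_ind R z"
  by (simp add: disc_ind_def torus_norm_minus)

definition disc_vol :: "real \<Rightarrow> real" where
  "disc_vol R = (\<integral>z. disc_ind R z \<partial>unit_square)"

lemma measure_torus_vol_eq:
  assumes "B \<in> sets borel"
  shows "measure torus_vol B = measure unit_square {z. to_torus z \<in> B}"
proof -
  have "to_torus \<in> measurable unit_square borel" by measurable
  then show ?thesis using assms by (simp add: torus_vol_eq measure_distr vimage_def)
qed

lemma integral_disc_ind_shift: "(\<integral>z. disc_ind R (z - w) \<partial>unit_square) = disc_vol R"
  using integral_unit_square_shift[OF disc_ind_measurable periodic2_disc_ind, of R "- w"] by (simp add: disc_vol_def)

lemma integral_disc_ind_eq_measure: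
  "(\<integral>z. disc_ind R (z - w) \<partial>unit_square) = measure unit_square {z. torus_norm (z - w) < R}"
proof -
  have "(\<lambda>z. disc_ind R (z - w)) = indicator {z. torus_norm (z - w) < R}"
    by (auto simp: disc_ind_def indicator_def)
  then show ?thesis by simp
qed

lemma measure_torus_vol_ball: "measure torus_vol (ball (to_torus w) R) = disc_vol R"
proof -
  have "{z. to_torus z \<in> ball (to_torus w) R} = {z. torus_norm (z - w) < R}"
    by (simp add: dist_to_torus[symmetric] dist_commute)
  then have "measure torus_vol (ball (to_torus w) R) = measure unit_square {z. torus_norm (z - w) < R}"
    by (simp add: measure_torus_vol_eq)
  then show ?thesis using integral_disc_ind_eq_measure integral_disc_ind_shift by metis
qed

text \<open>Translation invariance puts the centre in the middle of the square, where torus distance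
  and Euclidean distance agree on the whole fundamental domain.\<close>

lemma disc_vol_eq_lborel:
  "disc_vol R = measure lborel (({0..<1::real} \<times> {0..<1::real}) \<inter> ball (1 / 2, 1 / 2) R)"
proof -
  let ?c = "(1 / 2, 1 / 2) :: real \<times> real" and ?Q = "{0..<1::real} \<times> {0..<1::real}"
  have "{z. torus_norm (z - ?c) < R} \<in> sets borel" by measurable
  moreover have "disc_vol R = measure unit_square {z. torus_norm (z - ?c) < R}"
    by (metis integral_disc_ind_shift integral_disc_ind_eq_measure)
  ultimately have "disc_vol R = measure lborel (?Q \<inter> {z. torus_norm (z - ?c) < R})"
    unfolding unit_square_eq
    using emeasure_unit_square by (simp add: measure_uniform_measure borel_Times measure_def divide_ennreal_def)
  also have "?Q \<inter> {z. torus_norm (z - ?c) < R} = ?Q \<inter> ball ?c R"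
  proof -
    have "torus_norm (z - ?c) = dist ?c z" if "z \<in> ?Q" for z
    proof -
      obtain x y where z: "z = (x, y)" by (cases z)
      with that have "\<bar>x - 1 / 2\<bar> \<le> 1 / 2" "\<bar>y - 1 / 2\<bar> \<le> 1 / 2" by (auto simp: abs_if)
      then show ?thesis
        by (simp add: z torus_norm_def dist_prod_def dist_real_def infdist_Ints_eq_abs abs_minus_commute)
    qed
    then show ?thesis by auto
  qed
  finally show ?thesis .
qed

lemma content_ball_prod:
  assumes "R \<ge> 0" shows "measure lborel (ball (c :: real \<times> real) R) = pi * R\<^sup>2"
  using content_ball[OF assms, of c] by (simp add: unit_ball_vol_2 numeral_2_eq_2[symmetric])

text \<open>An inequality without upper limit on the radius, for the enlarged disc of radius
  \<open>R + a\<close>, which may exceed \<open>1 / 2\<close>.\<close>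

lemma disc_vol_le:
  assumes "R \<ge> 0" shows "disc_vol R \<le> pi * R\<^sup>2"
proof -
  have "disc_vol R \<le> measure lborel (ball (1 / 2, 1 / 2 :: real) R :: (real \<times> real) set)"
    unfolding disc_vol_eq_lborel
    using emeasure_bounded_finite[OF bounded_ball] by (intro measure_mono_fmeasurable) (auto simp: borel_Times fmeasurable_def)
  then show ?thesis by (simp add: content_ball_prod[OF assms])
qed

lemma disc_vol_eq:
  assumes "0 \<le> R" "R \<le> 1 / 2" shows "disc_vol R = pi * R\<^sup>2"
proof -
  have "ball (1 / 2, 1 / 2) R \<subseteq> {0..<1::real} \<times> {0..<1::real}"
  proof (rule subsetI)
    fix z :: "real \<times> real" assume "z \<in> ball (1 / 2, 1 / 2) R"
    then have "dist (1 / 2) (fst z) < R" "dist (1 / 2) (snd z) < R"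
      using dist_fst_le[of "(1 / 2, 1 / 2)" z] dist_snd_le[of "(1 / 2, 1 / 2)" z] by (auto simp: mem_ball intro: le_less_trans)
    then show "z \<in> {0..<1} \<times> {0..<1}" using assms(2) by (cases z) (auto simp: dist_real_def abs_if split: if_splits)
  qed
  then have "({0..<1::real} \<times> {0..<1::real}) \<inter> ball (1 / 2, 1 / 2) R = (ball (1 / 2, 1 / 2) R :: (real \<times> real) set)" by blast
  then show ?thesis unfolding disc_vol_eq_lborel by (simp only: content_ball_prod[OF assms(1)])
qed

lemma periodic2_shift: "periodic2 f \<Longrightarrow> periodic2 (\<lambda>z. f (z - w))"
  unfolding periodic2_def
proof (intro allI)
  fix x y :: real and i j :: int
  assume "\<forall>x y i j. f (x + of_int i, y + of_int j) = f (x, y)"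
  from this[rule_format, of "x - fst w" i "y - snd w" j]
  show "f ((x + of_int i, y + of_int j) - w) = f ((x, y) - w)"
    by (cases w) (simp add: algebra_simps)
qed

lemma periodic2_mult: "periodic2 f \<Longrightarrow> periodic2 g \<Longrightarrow> periodic2 (\<lambda>z. f z * g z)"
  by (simp add: periodic2_def)

text \<open>Symmetry of the discs turns the inner integral into \<^term>\<open>disc_vol R\<close> after Fubini.\<close>

lemma integral_integral_disc_ind:
  assumes [measurable]: "h \<in> borel_measurable borel" and h: "\<And>z. \<bar>h z\<bar> \<le> B"
  shows "(\<integral>y. (\<integral>z. disc_ind R (z + w - y) * h z \<partial>unit_square) \<partial>unit_square) = disc_vol R * (\<integral>z. h z \<partial>unit_square)"
    and "integrable unit_square (\<lambda>y. \<integral>z. disc_ind R (z + w - y) * h z \<partial>unit_square)"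
proof -
  interpret U: prob_space unit_square by (rule prob_space_unit_square)
  interpret UU: pair_prob_space unit_square unit_square ..
  have int: "integrable (unit_square \<Otimes>\<^sub>M unit_square) (\<lambda>(y, z). disc_ind R (z + w - y) * h z)"
  proof (rule UU.integrable_const_bound[of _ B])
    show "AE p in unit_square \<Otimes>\<^sub>M unit_square. norm (case p of (y, z) \<Rightarrow> disc_ind R (z + w - y) * h z) \<le> B"
      using h order_trans[OF abs_ge_zero h] by (intro always_eventually) (auto simp: disc_ind_def)
    show "(\<lambda>(y, z). disc_ind R (z + w - y) * h z) \<in> borel_measurable (unit_square \<Otimes>\<^sub>M unit_square)"
      by measurable
  qed
  show "integrable unit_square (\<lambda>y. \<integral>z. disc_ind R (z + w - y) * h z \<partial>unit_square)"
    using UU.integrable_fst[OF int] by simp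
  have "(\<integral>y. (\<integral>z. disc_ind R (z + w - y) * h z \<partial>unit_square) \<partial>unit_square)
     = (\<integral>z. (\<integral>y. disc_ind R (z + w - y) * h z \<partial>unit_square) \<partial>unit_square)"
    using UU.Fubini_integral[of "\<lambda>y z. disc_ind R (z + w - y) * h z"] int by simp
  also have "\<dots> = (\<integral>z. disc_vol R * h z \<partial>unit_square)"
  proof (intro Bochner_Integration.integral_cong refl)
    fix z
    have "(\<integral>y. disc_ind R (z + w - y) \<partial>unit_square) = (\<integral>y. disc_ind R (y - (z + w)) \<partial>unit_square)"
      using disc_ind_minus[of R "z + w - _"] by simp
    then show "(\<integral>y. disc_ind R (z + w - y) * h z \<partial>unit_square) = disc_vol R * h z"
      by (simp add: integral_disc_ind_shift)
  qed
  finally show "(\<integral>y. (\<integral>z. disc_ind R (z + w - y) * h z \<partial>unit_square) \<partial>unit_square) = disc_vol R * (\<integral>z. h z \<partial>unit_square)"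
    by simp
qed

section \<open>Smoothing the empirical measure\<close>

text \<open>
  \<open>A R y\<close> is the empirical measure of the disc around \<open>y\<close>, \<open>W\<close> the density of the empirical
  measure smoothed by \<open>G\<close>, \<open>E\<close> the error from \<open>W\<close> not being constant, and \<open>T\<close> the
  error from the mass of \<open>G\<close> outside the disc of radius \<open>a\<close>.
\<close>

locale smoothing =
  fixes D :: "'d set" and p :: "'d \<Rightarrow> real \<times> real" and G :: "real \<times> real \<Rightarrow> real" and B :: real
  assumes finite_D: "finite D" and D_nonempty: "D \<noteq> {}"
    and G_measurable [measurable]: "G \<in> borel_measurable borel"
    and G_nonneg: "\<And>z. G z \<ge> 0" and G_le: "\<And>z. G z \<le> B"
    and G_periodic: "periodic2 G"
    and G_integral: "(\<integral>z. G z \<partial>unit_square) = 1"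
begin

definition avg :: "('d \<Rightarrow> real) \<Rightarrow> real" where
  "avg f = (\<Sum>d\<in>D. f d) / real (card D)"

definition A :: "real \<Rightarrow> real \<times> real \<Rightarrow> real" where
  "A R y = avg (\<lambda>d. disc_ind R (p d - y))"

definition W :: "real \<times> real \<Rightarrow> real" where
  "W z = avg (\<lambda>d. G (z - p d))"

definition E :: "real \<Rightarrow> real \<times> real \<Rightarrow> real" where
  "E R y = (\<integral>z. disc_ind R (z - y) * \<bar>W z - 1\<bar> \<partial>unit_square)"

definition tail :: "real \<Rightarrow> real" where
  "tail a = (\<integral>z. G z * (1 - disc_ind a z) \<partial>unit_square)"

definition T :: "real \<Rightarrow> real \<Rightarrow> real \<times> real \<Rightarrow> real" where
  "T R a y = avg (\<lambda>d. \<integral>z. disc_ind R (z + p d - y) * (G z * (1 - disc_ind a z)) \<partial>unit_square)"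

lemma card_D_pos: "real (card D) > 0"
  using finite_D D_nonempty by (simp add: card_gt_0_iff)

lemma avg_mono: "(\<And>d. d \<in> D \<Longrightarrow> f d \<le> g d) \<Longrightarrow> avg f \<le> avg g"
  unfolding avg_def by (intro divide_right_mono sum_mono) auto

lemma avg_const [simp]: "avg (\<lambda>d. c) = c"
  using card_D_pos by (simp add: avg_def)

lemma avg_mult_left: "avg (\<lambda>d. c * f d) = c * avg f"
  by (simp add: avg_def sum_distrib_left)

lemma avg_add: "avg (\<lambda>d. f d + g d) = avg f + avg g"
  by (simp add: avg_def sum.distrib add_divide_distrib)

lemma avg_nonneg: "(\<And>d. f d \<ge> 0) \<Longrightarrow> avg f \<ge> 0"
  by (simp add: avg_def sum_nonneg)

lemma integral_avg:
  assumes "\<And>d. integrable unit_square (f d)"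
  shows "(\<integral>z. avg (\<lambda>d. f d z) \<partial>unit_square) = avg (\<lambda>d. \<integral>z. f d z \<partial>unit_square)"
    and "integrable unit_square (\<lambda>z. avg (\<lambda>d. f d z))"
  using assms unfolding avg_def by (simp_all add: Bochner_Integration.integral_sum)

lemma W_measurable [measurable]: "W \<in> borel_measurable borel"
  unfolding W_def avg_def by measurable

lemma W_nonneg: "W z \<ge> 0"
  unfolding W_def by (rule avg_nonneg) (rule G_nonneg)

lemma B_nonneg: "B \<ge> 0" using G_nonneg[of 0] G_le[of 0] by linarith

lemma W_le: "W z \<le> B"
  using avg_mono[of "\<lambda>d. G (z - p d)" "\<lambda>_. B"] G_le unfolding W_def by simp

lemma abs_W_minus_1_le: "\<bar>W z - 1\<bar> \<le> B + 1"
  using W_le[of z] W_nonneg[of z] by linarith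

lemma integrable_disc_ind_mult:
  assumes [measurable]: "h \<in> borel_measurable borel" and h: "\<And>z. \<bar>h z\<bar> \<le> C"
  shows "integrable unit_square (\<lambda>z. disc_ind R (z + w) * h z)"
proof (rule integrable_unit_square_bounded[of _ C])
  show "norm (disc_ind R (z + w) * h z) \<le> C" for z
    using h[of z] order_trans[OF abs_ge_zero h] by (auto simp: disc_ind_def)
qed measurable

lemma integral_disc_ind_W:
  "(\<integral>z. disc_ind R (z - y) * W z \<partial>unit_square) = avg (\<lambda>d. \<integral>z. disc_ind R (z + p d - y) * G z \<partial>unit_square)"
proof -
  have "(\<integral>z. disc_ind R (z - y) * W z \<partial>unit_square) = (\<integral>z. avg (\<lambda>d. disc_ind R (z - y) * G (z - p d)) \<partial>unit_square)"
    by (simp add: W_def avg_mult_left)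
  also have "\<dots> = avg (\<lambda>d. \<integral>z. disc_ind R (z - y) * G (z - p d) \<partial>unit_square)"
  proof (rule integral_avg)
    fix d
    show "integrable unit_square (\<lambda>z. disc_ind R (z - y) * G (z - p d))"
      using integrable_disc_ind_mult[of "\<lambda>z. G (z - p d)" B R "- y"] G_nonneg G_le by simp
  qed
  also have "(\<lambda>d. \<integral>z. disc_ind R (z - y) * G (z - p d) \<partial>unit_square) = (\<lambda>d. \<integral>z. disc_ind R (z + p d - y) * G z \<partial>unit_square)"
  proof
    fix d
    have "(\<integral>z. (\<lambda>z. disc_ind R (z - y) * G (z - p d)) (z + p d) \<partial>unit_square) = (\<integral>z. disc_ind R (z - y) * G (z - p d) \<partial>unit_square)"
      by (rule integral_unit_square_shift) (measurable, intro periodic2_mult periodic2_shift periodic2_disc_ind G_periodic)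
    then show "(\<integral>z. disc_ind R (z - y) * G (z - p d) \<partial>unit_square) = (\<integral>z. disc_ind R (z + p d - y) * G z \<partial>unit_square)"
      by simp
  qed
  finally show ?thesis .
qed

lemma integral_disc_ind_W_close: "\<bar>(\<integral>z. disc_ind R (z - y) * W z \<partial>unit_square) - disc_vol R\<bar> \<le> E R y"
proof -
  have 1: "integrable unit_square (\<lambda>z. disc_ind R (z - y) * W z)"
    using integrable_disc_ind_mult[of W B R "- y"] W_nonneg W_le by simp
  have 2: "integrable unit_square (\<lambda>z. disc_ind R (z - y))"
    by (rule integrable_unit_square_bounded[of _ 1]) (auto simp: disc_ind_def)
  have "(\<integral>z. disc_ind R (z - y) * W z \<partial>unit_square) - disc_vol R = (\<integral>z. disc_ind R (z - y) * (W z - 1) \<partial>unit_square)"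
    unfolding integral_disc_ind_shift[of R y, symmetric] using 1 2
    by (simp add: right_diff_distrib)
  also have "\<bar>\<dots>\<bar> \<le> (\<integral>z. \<bar>disc_ind R (z - y) * (W z - 1)\<bar> \<partial>unit_square)"
    by (rule integral_abs_bound)
  also have "\<dots> = E R y"
    by (simp add: E_def abs_mult abs_of_nonneg[OF disc_ind_bounds(1)])
  finally show ?thesis .
qed

lemma integrable_G_mult:
  assumes "f \<in> borel_measurable borel" "\<And>z. 0 \<le> f z" "\<And>z. f z \<le> 1"
  shows "integrable unit_square (\<lambda>z. f z * G z)"
proof (rule integrable_unit_square_bounded[of _ B])
  show "norm (f z * G z) \<le> B" for z
    using mult_mono[OF assms(3)[of z] G_le[of z]] assms(2)[of z] G_nonneg[of z] by (simp add: abs_mult)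
qed (use assms in measurable)

text \<open>If \<open>z + p d\<close> is within \<open>R\<close> of \<open>y\<close> and
  \<open>z\<close> within \<open>a\<close> of 0, then \<open>p d\<close> is within
  \<open>R + a\<close> of \<open>y\<close>. The remaining part is kept as a function of
  \<open>y\<close> instead of being bounded by \<open>tail a\<close>: its mean over \<open>y\<close>
  is \<open>disc_vol R * tail a\<close>, whereas \<open>tail a\<close> itself may far exceed the
  area of the disc.\<close>

lemma integral_disc_ind_W_upper:
  "(\<integral>z. disc_ind R (z - y) * W z \<partial>unit_square) \<le> A (R + a) y + T R a y"
proof -
  have "(\<integral>z. disc_ind R (z + p d - y) * G z \<partial>unit_square)
     \<le> disc_ind (R + a) (p d - y) + (\<integral>z. disc_ind R (z + p d - y) * (G z * (1 - disc_ind a z)) \<partial>unit_square)" for d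
  proof -
    have i1: "integrable unit_square (\<lambda>z. disc_ind R (z + p d - y) * G z)"
      by (rule integrable_G_mult) (auto simp: disc_ind_bounds)
    have i2: "integrable unit_square (\<lambda>z. (disc_ind R (z + p d - y) * (1 - disc_ind a z)) * G z)"
      by (rule integrable_G_mult) (auto simp: disc_ind_def)
    have i2': "integrable unit_square (\<lambda>z. disc_ind R (z + p d - y) * (G z * (1 - disc_ind a z)))"
      using i2 by (simp add: mult_ac)
    have i3: "integrable unit_square (\<lambda>z. disc_ind (R + a) (p d - y) * G z)"
      by (rule integrable_G_mult) (auto simp: disc_ind_bounds)
    have "(\<integral>z. disc_ind R (z + p d - y) * G z \<partial>unit_square)
       \<le> (\<integral>z. disc_ind (R + a) (p d - y) * G z + disc_ind R (z + p d - y) * (G z * (1 - disc_ind a z)) \<partial>unit_square)"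
    proof (rule integral_mono[OF i1 Bochner_Integration.integrable_add[OF i3 i2']])
      fix z
      have "torus_norm (p d - y) \<le> torus_norm (z + p d - y) + torus_norm z"
        using torus_norm_add_le[of "z + p d - y" "- z"] by (simp add: torus_norm_minus)
      then show "disc_ind R (z + p d - y) * G z \<le> disc_ind (R + a) (p d - y) * G z + disc_ind R (z + p d - y) * (G z * (1 - disc_ind a z))"
        using G_nonneg[of z] by (auto simp: disc_ind_def)
    qed
    also have "\<dots> = disc_ind (R + a) (p d - y) + (\<integral>z. disc_ind R (z + p d - y) * (G z * (1 - disc_ind a z)) \<partial>unit_square)"
      using i3 i2' by (simp add: G_integral)
    finally show ?thesis .
  qed
  then show ?thesis unfolding integral_disc_ind_W A_def T_def avg_add[symmetric] by (intro avg_mono) 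
qed

text \<open>In this direction only the mass of \<open>G\<close> inside the disc of radius
  \<open>a\<close> is used, so the loss is a factor and no term like \<open>T\<close>
  appears.\<close>

lemma integral_disc_ind_W_lower:
  "(1 - tail a) * A (R - a) y \<le> (\<integral>z. disc_ind R (z - y) * W z \<partial>unit_square)"
proof -
  have "(1 - tail a) * disc_ind (R - a) (p d - y) \<le> (\<integral>z. disc_ind R (z + p d - y) * G z \<partial>unit_square)" for d
  proof -
    have i1: "integrable unit_square (\<lambda>z. disc_ind R (z + p d - y) * G z)"
      by (rule integrable_G_mult) (auto simp: disc_ind_bounds)
    have i2: "integrable unit_square (\<lambda>z. (1 - disc_ind a z) * G z)" "integrable unit_square (\<lambda>z. 1 * G z)"
      by (rule integrable_G_mult; auto simp: disc_ind_def)+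
    have "(1 - tail a) = (\<integral>z. G z - G z * (1 - disc_ind a z) \<partial>unit_square)"
      using i2 by (simp add: tail_def G_integral mult.commute)
    then have "(1 - tail a) * disc_ind (R - a) (p d - y) = (\<integral>z. (disc_ind (R - a) (p d - y) * disc_ind a z) * G z \<partial>unit_square)"
      by (simp add: right_diff_distrib mult_ac flip: Bochner_Integration.integral_mult_right_zero)
    also have "\<dots> \<le> (\<integral>z. disc_ind R (z + p d - y) * G z \<partial>unit_square)"
    proof (rule integral_mono[OF _ i1])
      show "integrable unit_square (\<lambda>z. (disc_ind (R - a) (p d - y) * disc_ind a z) * G z)"
        by (rule integrable_G_mult) (auto simp: disc_ind_def)
      fix z
      have "torus_norm (z + p d - y) \<le> torus_norm (p d - y) + torus_norm z"
        using torus_norm_add_le[of "p d - y" z] by (simp add: algebra_simps)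
      then show "disc_ind (R - a) (p d - y) * disc_ind a z * G z \<le> disc_ind R (z + p d - y) * G z"
        using G_nonneg[of z] by (auto simp: disc_ind_def)
    qed
    finally show ?thesis .
  qed
  then show ?thesis unfolding integral_disc_ind_W A_def avg_mult_left[symmetric] by (intro avg_mono)
qed

lemma integral_E: "(\<integral>y. E R y \<partial>unit_square) = disc_vol R * (\<integral>z. \<bar>W z - 1\<bar> \<partial>unit_square)"
  and integrable_E: "integrable unit_square (E R)"
  using integral_integral_disc_ind[of "\<lambda>z. \<bar>W z - 1\<bar>" "B + 1" R 0] abs_W_minus_1_le
  unfolding E_def[abs_def] by simp_all

lemma integral_T: "(\<integral>y. T R a y \<partial>unit_square) = disc_vol R * tail a"
  and integrable_T: "integrable unit_square (T R a)"
proof -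
  have *: "\<bar>G z * (1 - disc_ind a z)\<bar> \<le> B" for z
    using G_nonneg[of z] G_le[of z] B_nonneg by (auto simp: disc_ind_def)
  have int: "integrable unit_square (\<lambda>y. \<integral>z. disc_ind R (z + p d - y) * (G z * (1 - disc_ind a z)) \<partial>unit_square)" for d
    using * by (intro integral_integral_disc_ind(2)) auto
  show "(\<integral>y. T R a y \<partial>unit_square) = disc_vol R * tail a"
    unfolding T_def integral_avg(1)[OF int]
    using * by (subst integral_integral_disc_ind(1)[of _ B]) (auto simp: tail_def)
  show "integrable unit_square (T R a)"
    unfolding T_def[abs_def] by (rule integral_avg(2)[OF int])
qed

lemma E_nonneg: "E R y \<ge> 0"
  unfolding E_def by (intro Bochner_Integration.integral_nonneg) (simp add: disc_ind_bounds)

lemma T_nonneg: "T R a y \<ge> 0"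
  unfolding T_def by (intro avg_nonneg Bochner_Integration.integral_nonneg) (simp add: disc_ind_bounds G_nonneg)

lemma tail_nonneg: "tail a \<ge> 0"
  unfolding tail_def by (intro Bochner_Integration.integral_nonneg) (simp add: disc_ind_bounds G_nonneg)

lemma measure_E_ge_le:
  assumes "c > 0"
  shows "measure unit_square {y. c \<le> E R y} \<le> disc_vol R * (\<integral>z. \<bar>W z - 1\<bar> \<partial>unit_square) / c"
  using integral_Markov_inequality_measure[OF integrable_E[of R], of UNIV c] assms
  by (simp add: E_nonneg integral_E)

lemma measure_T_ge_le:
  assumes "c > 0"
  shows "measure unit_square {y. c \<le> T R a y} \<le> disc_vol R * tail a / c"
  using integral_Markov_inequality_measure[OF integrable_T[of R a], of UNIV c] assms
  by (simp add: T_nonneg integral_T)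

text \<open>Radius \<open>R - a\<close> bounds \<open>A R y\<close> from below and radius
  \<open>R + a\<close> from above. Outside three exceptional sets the relative loss is at most
  \<open>4 * \<eta>\<close> below, and above it is absorbed by
  \<open>(1 + \<eta>)^2 + \<eta> <= (1 - \<eta>) * (1 + \<epsilon>)\<close>;
  \<open>\<eta> <= \<epsilon> / 8\<close> and \<open>\<eta> <= 1 / 8\<close> suffice for
  both.\<close>

lemma measure_deviation_le:
  assumes R: "0 < R" "R \<le> 1 / 2" and \<epsilon>: "\<epsilon> > 0"
    and \<eta>: "0 < \<eta>" "\<eta> \<le> 1 / 8" "\<eta> \<le> \<epsilon> / 8" and tail: "tail (\<eta> * R) \<le> \<eta>"
  shows "measure unit_square {y. \<bar>A R y - disc_vol R\<bar> > \<epsilon> * disc_vol R}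
       \<le> (5 * (\<integral>z. \<bar>W z - 1\<bar> \<partial>unit_square) + tail (\<eta> * R)) / \<eta>"
proof -
  interpret U: prob_space unit_square by (rule prob_space_unit_square)
  define a where "a = \<eta> * R"
  define V where "V = disc_vol R"
  define w where "w = (\<integral>z. \<bar>W z - 1\<bar> \<partial>unit_square)"
  have w: "w \<ge> 0" unfolding w_def by (rule Bochner_Integration.integral_nonneg) simp
  have V: "V = pi * R\<^sup>2" unfolding V_def using R by (intro disc_vol_eq) auto
  have Vpos: "V > 0" using R by (simp add: V)
  have Vm: "disc_vol (R - a) = (1 - \<eta>)\<^sup>2 * V"
  proof -
    have "\<eta> * R \<le> 1 * R" using R \<eta> by (intro mult_right_mono) auto
    moreover have "0 \<le> \<eta> * R" using R \<eta> by simp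
    ultimately have "0 \<le> R - a" "R - a \<le> 1 / 2" using R unfolding a_def by linarith+
    then have "disc_vol (R - a) = pi * (R - a)\<^sup>2" by (rule disc_vol_eq)
    also have "\<dots> = pi * ((1 - \<eta>) * R)\<^sup>2" by (simp add: a_def algebra_simps)
    finally show ?thesis by (simp add: V power_mult_distrib mult_ac)
  qed
  have Vp: "disc_vol (R + a) \<le> (1 + \<eta>)\<^sup>2 * V"
  proof -
    have "disc_vol (R + a) \<le> pi * (R + a)\<^sup>2" using R \<eta> by (intro disc_vol_le) (simp add: a_def)
    also have "\<dots> = pi * ((1 + \<eta>) * R)\<^sup>2" by (simp add: a_def algebra_simps)
    finally show ?thesis by (simp add: V power_mult_distrib mult_ac)
  qed
  define S1 where "S1 = {y. \<eta> * V \<le> E (R - a) y}"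
  define S2 where "S2 = {y. \<eta> * V \<le> E (R + a) y}"
  define S3 where "S3 = {y. \<eta> * V \<le> T (R - a) a y}"
  have meas: "S1 \<in> U.events" "S2 \<in> U.events" "S3 \<in> U.events"
    using borel_measurable_integrable[OF integrable_E[of "R - a"]] borel_measurable_integrable[OF integrable_E[of "R + a"]]
      borel_measurable_integrable[OF integrable_T[of "R - a" a]]
    unfolding S1_def S2_def S3_def by (auto simp: borel_measurable_iff_ge)
  have sub: "{y. \<bar>A R y - disc_vol R\<bar> > \<epsilon> * disc_vol R} \<subseteq> (S1 \<union> S2) \<union> S3"
  proof (rule subsetI, rule ccontr)
    fix y assume y: "y \<in> {y. \<bar>A R y - disc_vol R\<bar> > \<epsilon> * disc_vol R}" "y \<notin> S1 \<union> S2 \<union> S3"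
    then have s: "E (R - a) y < \<eta> * V" "E (R + a) y < \<eta> * V" "T (R - a) a y < \<eta> * V"
      by (auto simp: S1_def S2_def S3_def)
    have "disc_vol (R - a) - E (R - a) y \<le> A R y + T (R - a) a y"
      using integral_disc_ind_W_close[of "R - a" y] integral_disc_ind_W_upper[of "R - a" y a] by simp
    then have "A R y \<ge> (1 - \<eta>)\<^sup>2 * V - 2 * (\<eta> * V)" using s Vm by linarith
    also have "(1 - \<eta>)\<^sup>2 * V - 2 * (\<eta> * V) = V - 4 * \<eta> * V + \<eta>\<^sup>2 * V" by (simp add: power2_eq_square algebra_simps)
    finally have "A R y \<ge> V - 4 * \<eta> * V" using Vpos by (smt (verit) mult_nonneg_nonneg zero_le_power2)
    moreover have "4 * \<eta> * V \<le> \<epsilon> * V" using \<eta> \<epsilon> Vpos by (intro mult_right_mono) auto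
    ultimately have low: "A R y \<ge> V - \<epsilon> * V" by linarith
    have "(1 - tail a) * A R y \<le> disc_vol (R + a) + E (R + a) y"
      using integral_disc_ind_W_close[of "R + a" y] integral_disc_ind_W_lower[of a "R + a" y] by simp
    also have "\<dots> \<le> ((1 + \<eta>)\<^sup>2 + \<eta>) * V" using Vp s by (simp add: algebra_simps)
    also have "\<dots> \<le> ((1 - \<eta>) * (1 + \<epsilon>)) * V"
    proof (rule mult_right_mono)
      have "\<eta> * \<eta> \<le> (1 / 8) * \<eta>" using \<eta> by (intro mult_right_mono) auto
      moreover have "\<eta> * \<epsilon> \<le> (1 / 8) * \<epsilon>" using \<eta> \<epsilon> by (intro mult_right_mono) auto
      moreover have "\<eta> \<le> \<epsilon> / 8" by (rule \<eta>(3))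
      moreover have "(1 + \<eta>)\<^sup>2 + \<eta> = 1 + 3 * \<eta> + \<eta> * \<eta>" "(1 - \<eta>) * (1 + \<epsilon>) = 1 + \<epsilon> - \<eta> - \<eta> * \<epsilon>"
        by (simp_all add: power2_eq_square algebra_simps)
      ultimately show "(1 + \<eta>)\<^sup>2 + \<eta> \<le> (1 - \<eta>) * (1 + \<epsilon>)" using \<eta> \<epsilon> by linarith
    qed (use Vpos in simp)
    finally have 1: "(1 - tail a) * A R y \<le> (1 - \<eta>) * ((1 + \<epsilon>) * V)" by (simp add: mult.assoc)
    have "A R y \<ge> 0" unfolding A_def by (intro avg_nonneg disc_ind_bounds)
    then have "(1 - \<eta>) * A R y \<le> (1 - tail a) * A R y" using tail unfolding a_def by (intro mult_right_mono) auto
    then have "(1 - \<eta>) * A R y \<le> (1 - \<eta>) * ((1 + \<epsilon>) * V)" using 1 by linarith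
    then have "A R y \<le> (1 + \<epsilon>) * V" using \<eta> by (simp add: mult_le_cancel_left)
    with low y(1) show False by (auto simp: V_def algebra_simps abs_if split: if_splits)
  qed
  have "measure unit_square {y. \<bar>A R y - disc_vol R\<bar> > \<epsilon> * disc_vol R} \<le> measure unit_square ((S1 \<union> S2) \<union> S3)"
    using meas by (intro U.finite_measure_mono[OF sub]) auto
  also have "\<dots> \<le> measure unit_square (S1 \<union> S2) + measure unit_square S3"
    using meas by (intro measure_Un_le) auto
  also have "\<dots> \<le> measure unit_square S1 + measure unit_square S2 + measure unit_square S3"
    using meas by (intro add_right_mono measure_Un_le) auto
  \<comment> \<open>Markov's inequality for each set. The enlarged disc has area at most
    \<open>4 * V\<close>, whence \<open>5 = 1 + 4\<close>, and \<open>V\<close> cancels.\<close>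
  also have "\<dots> \<le> V * w / (\<eta> * V) + (4 * V) * w / (\<eta> * V) + V * tail a / (\<eta> * V)"
  proof (intro add_mono)
    have m: "disc_vol (R - a) \<le> V"
    proof -
      have "(1 - \<eta>)\<^sup>2 * V \<le> 1 * V" using \<eta> Vpos by (intro mult_right_mono) (auto simp: power_le_one)
      then show ?thesis by (simp add: Vm)
    qed
    have p: "disc_vol (R + a) \<le> 4 * V"
    proof -
      have "(1 + \<eta>)\<^sup>2 \<le> 2\<^sup>2" using \<eta> by (intro power_mono) auto
      then have "(1 + \<eta>)\<^sup>2 * V \<le> 4 * V" using Vpos by (intro mult_right_mono) auto
      then show ?thesis using Vp by linarith
    qed
    have c: "\<eta> * V > 0" using \<eta> Vpos by simp
    show "measure unit_square S1 \<le> V * w / (\<eta> * V)"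
      unfolding S1_def 
      by (rule order_trans[OF measure_E_ge_le[OF c, folded w_def] divide_right_mono[OF mult_right_mono[OF m w] less_imp_le[OF c]]])
    show "measure unit_square S2 \<le> 4 * V * w / (\<eta> * V)"
      unfolding S2_def 
      by (rule order_trans[OF measure_E_ge_le[OF c, folded w_def] divide_right_mono[OF mult_right_mono[OF p w] less_imp_le[OF c]]])
    show "measure unit_square S3 \<le> V * tail a / (\<eta> * V)"
      unfolding S3_def
      by (rule order_trans[OF measure_T_ge_le[OF c] divide_right_mono[OF mult_right_mono[OF m tail_nonneg] less_imp_le[OF c]]])
  qed
  also have "\<dots> = (5 * w + tail a) / \<eta>" using Vpos \<eta> by (simp add: field_simps)
  finally show ?thesis by (simp add: w_def a_def)
qed

text \<open>Cauchy-Schwarz on a probability space, read off from the nonnegativity of the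
  variance.\<close>

lemma integral_abs_W_square_le:
  "(\<integral>z. \<bar>W z - 1\<bar> \<partial>unit_square)\<^sup>2 \<le> (\<integral>z. (W z - 1)\<^sup>2 \<partial>unit_square)"
proof -
  interpret U: prob_space unit_square by (rule prob_space_unit_square)
  have "integrable unit_square (\<lambda>z. \<bar>W z - 1\<bar>)"
    using abs_W_minus_1_le by (intro integrable_unit_square_bounded[of _ "B + 1"]) auto
  moreover have "integrable unit_square (\<lambda>z. \<bar>W z - 1\<bar>\<^sup>2)"
  proof (rule integrable_unit_square_bounded[of _ "(B + 1)\<^sup>2"])
    fix z
    have "\<bar>W z - 1\<bar>\<^sup>2 \<le> (B + 1)\<^sup>2" by (rule power_mono[OF abs_W_minus_1_le]) simp
    then show "norm (\<bar>W z - 1\<bar>\<^sup>2) \<le> (B + 1)\<^sup>2" by simp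
  qed measurable
  ultimately show ?thesis
    using U.variance_positive[of "\<lambda>z. \<bar>W z - 1\<bar>"] by (simp add: U.variance_eq)
qed

end

section \<open>Equidistribution in small discs\<close>

definition sample :: "nat \<Rightarrow> nat \<Rightarrow> real \<times> real" where
  "sample q d = (real d / real q, real_of_int (inv_mod q (int d)) / real q)"

definition jackson2 :: "nat \<Rightarrow> real \<times> real \<Rightarrow> real" where
  "jackson2 M z = jackson M (fst z) * jackson M (snd z)"

lemma jackson_periodic: "jackson M (x + of_int i) = jackson M x"
proof -
  have "echar (real j * (x + of_int i)) = echar (real j * x)" for j
    using echar_of_int[of "int j * i"] by (simp add: distrib_left echar_add)
  then show ?thesis by (simp add: jackson_def tent_poly_def)
qed

lemma smoothing_jackson:
  assumes "q > 0" "M > 0"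
  shows "smoothing (totatives q) (jackson2 M) ((4 * real M + 1)\<^sup>2)"
proof
  show "jackson2 M \<in> borel_measurable borel" unfolding jackson2_def by measurable
  show "jackson2 M z \<le> (4 * real M + 1)\<^sup>2" for z
    unfolding jackson2_def power2_eq_square by (intro mult_mono jackson_le jackson_nonneg) auto
  show "(\<integral>z. jackson2 M z \<partial>unit_square) = 1"
  proof -
    have "(\<integral>z. jackson2 M z \<partial>unit_square) = (\<integral>x. jackson M x \<partial>unit_interval) * (\<integral>x. jackson M x \<partial>unit_interval)"
      unfolding jackson2_def by (rule integral_unit_square_product[OF jackson_measurable jackson_measurable jackson_abs_le jackson_abs_le])
    then show ?thesis by (simp only: integral_jackson[OF assms(2)] mult_1_left)
  qed
  show "jackson2 M z \<ge> 0" for z unfolding jackson2_def by (intro mult_nonneg_nonneg jackson_nonneg)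
  show "periodic2 (jackson2 M)" unfolding periodic2_def jackson2_def fst_conv snd_conv jackson_periodic by blast
  show "finite (totatives q)" "totatives q \<noteq> {}" using assms by auto
qed

text \<open>Chebyshev: outside the disc, \<open>a^2\<close> is at most the sum of the squared
  coordinate distances, hence at most the sum of two squared sines. Each of them leaves a
  one-dimensional second moment times a total mass 1.\<close>

lemma jackson2_tail_le:
  assumes M: "M > 0" and a: "a > 0"
  shows "(\<integral>z. jackson2 M z * (1 - disc_ind a z) \<partial>unit_square) \<le> 3 / ((real M)\<^sup>2 * a\<^sup>2)"
proof -
  let ?J = "jackson M" and ?s = "\<lambda>x. (sin (pi * x))\<^sup>2" and ?C = "4 * real M + 1"
  have s1: "\<bar>?J x * ?s x\<bar> \<le> ?C" for x
    using mult_mono[OF jackson_le[of M x], of "?s x" 1] jackson_nonneg[of M x]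
    by (simp add: abs_mult abs_square_le_1)
  have meas: "(\<lambda>x. ?J x * ?s x) \<in> borel_measurable borel" by measurable
  have prod_int: "integrable unit_square (\<lambda>z. f (fst z) * g (snd z))"
    if "f \<in> borel_measurable borel" "g \<in> borel_measurable borel" "\<And>x. \<bar>f x\<bar> \<le> ?C" "\<And>x. \<bar>g x\<bar> \<le> ?C" for f g :: "real \<Rightarrow> real"
  proof (rule integrable_unit_square_bounded[of _ "?C * ?C"])
    show "(\<lambda>z. f (fst z) * g (snd z)) \<in> borel_measurable borel" using that(1,2) by measurable
    show "norm (f (fst z) * g (snd z)) \<le> ?C * ?C" for z
      unfolding real_norm_def abs_mult by (intro mult_mono that(3,4)) auto
  qed
  note J = jackson_measurable[of M] jackson_abs_le[of M]
  have i1: "integrable unit_square (\<lambda>z. (?J (fst z) * ?s (fst z)) * ?J (snd z))"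
    using prod_int[OF meas J(1) s1 J(2)] .
  have i2: "integrable unit_square (\<lambda>z. ?J (fst z) * (?J (snd z) * ?s (snd z)))"
    using prod_int[OF J(1) meas J(2) s1] .
  have "(\<integral>z. jackson2 M z * (1 - disc_ind a z) \<partial>unit_square)
     \<le> (\<integral>z. ((?J (fst z) * ?s (fst z)) * ?J (snd z) + ?J (fst z) * (?J (snd z) * ?s (snd z))) / a\<^sup>2 \<partial>unit_square)"
  proof (rule integral_mono)
    show "integrable unit_square (\<lambda>z. jackson2 M z * (1 - disc_ind a z))"
    proof (rule integrable_unit_square_bounded[of _ "?C * ?C"])
      show "(\<lambda>z. jackson2 M z * (1 - disc_ind a z)) \<in> borel_measurable borel"
        unfolding jackson2_def by measurable
      show "norm (jackson2 M z * (1 - disc_ind a z)) \<le> ?C * ?C" for z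
      proof -
        have "\<bar>jackson2 M z\<bar> \<le> ?C * ?C"
          unfolding jackson2_def abs_mult by (intro mult_mono jackson_abs_le) auto
        then show ?thesis by (auto simp: disc_ind_def)
      qed
    qed
    show "integrable unit_square (\<lambda>z. ((?J (fst z) * ?s (fst z)) * ?J (snd z) + ?J (fst z) * (?J (snd z) * ?s (snd z))) / a\<^sup>2)"
      using i1 i2 by (intro integrable_divide Bochner_Integration.integrable_add)
    fix z
    have "1 - disc_ind a z \<le> (?s (fst z) + ?s (snd z)) / a\<^sup>2"
    proof (cases "torus_norm z < a")
      case True
      then show ?thesis by (simp add: disc_ind_def)
    next
      case False
      have "a\<^sup>2 \<le> (torus_norm z)\<^sup>2" using False a by (intro power_mono) auto
      also have "\<dots> = (infdist (fst z) \<int>)\<^sup>2 + (infdist (snd z) \<int>)\<^sup>2" by (simp add: torus_norm_def)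
      also have "\<dots> \<le> ?s (fst z) + ?s (snd z)"
        using power_mono[OF infdist_le_abs_sin_pi[of "fst z"] infdist_nonneg, of 2]
          power_mono[OF infdist_le_abs_sin_pi[of "snd z"] infdist_nonneg, of 2] by simp
      finally show ?thesis using False a by (simp add: disc_ind_def divide_simps)
    qed
    then have "jackson2 M z * (1 - disc_ind a z) \<le> jackson2 M z * ((?s (fst z) + ?s (snd z)) / a\<^sup>2)"
      unfolding jackson2_def by (intro mult_left_mono mult_nonneg_nonneg jackson_nonneg)
    then show "jackson2 M z * (1 - disc_ind a z) \<le> ((?J (fst z) * ?s (fst z)) * ?J (snd z) + ?J (fst z) * (?J (snd z) * ?s (snd z))) / a\<^sup>2"
      by (simp add: jackson2_def algebra_simps add_divide_distrib)
  qed
  also have "\<dots> = ((\<integral>z. (?J (fst z) * ?s (fst z)) * ?J (snd z) \<partial>unit_square) + (\<integral>z. ?J (fst z) * (?J (snd z) * ?s (snd z)) \<partial>unit_square)) / a\<^sup>2"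
    using i1 i2 by (simp only: integral_divide_zero Bochner_Integration.integral_add)
  also have "\<dots> = 2 * (\<integral>x. ?J x * ?s x \<partial>unit_interval) / a\<^sup>2"
    using integral_unit_square_product[OF meas J(1) s1 J(2)] integral_unit_square_product[OF J(1) meas J(2) s1]
    by (simp add: integral_jackson[OF M])
  also have "\<dots> \<le> 2 * (3 / (2 * (real M)\<^sup>2)) / a\<^sup>2"
    by (intro divide_right_mono mult_left_mono integral_jackson_sin_le M) auto
  also have "\<dots> = 3 / ((real M)\<^sup>2 * a\<^sup>2)" by simp
  finally show ?thesis .
qed

lemma jackson2_expansion:
  "complex_of_real (jackson2 M (z - w)) = (\<Sum>(m, n)\<in>{-int (2 * M)..int (2 * M)} \<times> {-int (2 * M)..int (2 * M)}.
     complex_of_real (jackson_coeff M m * jackson_coeff M n) * echar (of_int (- m) * fst w + of_int (- n) * snd w) * wave (m, n) z)"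
proof -
  let ?I = "{-int (2 * M)..int (2 * M)}"
  have "complex_of_real (jackson2 M (z - w)) = (\<Sum>m\<in>?I. \<Sum>n\<in>?I.
     (jackson_coeff M m * echar (of_int m * (fst z - fst w))) * (jackson_coeff M n * echar (of_int n * (snd z - snd w))))"
    by (simp only: jackson2_def of_real_mult jackson_expansion sum_product fst_diff snd_diff)
  also have "\<dots> = (\<Sum>m\<in>?I. \<Sum>n\<in>?I. complex_of_real (jackson_coeff M m * jackson_coeff M n) *
     echar (of_int (- m) * fst w + of_int (- n) * snd w) * wave (m, n) z)"
  proof (intro sum.cong refl)
    fix m n
    have "echar (of_int m * (fst z - fst w)) * echar (of_int n * (snd z - snd w))
       = echar (of_int (- m) * fst w + of_int (- n) * snd w) * wave (m, n) z"
      by (simp add: wave_def echar_add[symmetric] algebra_simps)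
    then show "(jackson_coeff M m * echar (of_int m * (fst z - fst w))) * (jackson_coeff M n * echar (of_int n * (snd z - snd w)))
       = complex_of_real (jackson_coeff M m * jackson_coeff M n) * echar (of_int (- m) * fst w + of_int (- n) * snd w) * wave (m, n) z"
      by (simp add: mult_ac)
  qed
  finally show ?thesis by (simp only: sum.cartesian_product)
qed

lemma kloosterman_0: "kloosterman q 0 0 = of_nat (totient q)"
  by (simp add: kloosterman_def card_units_mod)

lemma kloosterman_uminus: "kloosterman q (- m) (- n) = cnj (kloosterman q m n)"
  unfolding kloosterman_def cnj_sum cnj_echar
  by (intro sum.cong refl arg_cong[of _ _ echar]) (simp add: minus_divide_left)

section \<open>The smoothed measure for a fixed modulus\<close>

context
  fixes q M :: nat
  assumes q: "q > 1" and M: "M > 0"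
begin

interpretation smoothing "totatives q" "sample q" "jackson2 M" "(4 * real M + 1)\<^sup>2"
  using q M by (intro smoothing_jackson) auto

text \<open>The zero frequency contributes exactly 1, as \<open>kloosterman q 0 0\<close> is the
  totient and \<open>jackson_coeff M 0 = 1\<close>. The signs arise because the kernel is evaluated
  at \<open>z\<close> minus a sample point.\<close>

lemma W_minus_1_eq:
  "complex_of_real (W z - 1) = (\<Sum>p\<in>frequency_box (2 * M).
     complex_of_real (jackson_coeff M (fst p) * jackson_coeff M (snd p) / real (totient q)) * kloosterman q (- fst p) (- snd p) * wave p z)"
proof -
  let ?I = "{-int (2 * M)..int (2 * M)}"
  let ?b = "\<lambda>p. jackson_coeff M (fst p) * jackson_coeff M (snd p)"
  let ?t = "\<lambda>p. complex_of_real (?b p / real (totient q)) * kloosterman q (- fst p) (- snd p) * wave p z"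
  have \<phi>: "real (totient q) > 0" using q by simp
  have K: "(\<Sum>d\<in>totatives q. echar (of_int (- m) * fst (sample q d) + of_int (- n) * snd (sample q d))) = kloosterman q (- m) (- n)" for m n
    unfolding kloosterman_def units_mod_def
    by (simp add: sum.reindex sample_def add_divide_distrib diff_divide_distrib)
  have "complex_of_real (W z) = (\<Sum>d\<in>totatives q. complex_of_real (jackson2 M (z - sample q d))) / of_nat (totient q)"
    by (simp add: W_def avg_def totient_def)
  also have "\<dots> = (\<Sum>p\<in>?I \<times> ?I. \<Sum>d\<in>totatives q. complex_of_real (?b p) *
      echar (of_int (- fst p) * fst (sample q d) + of_int (- snd p) * snd (sample q d)) * wave p z) / of_nat (totient q)"
    unfolding jackson2_expansion split_beta' prod.collapse by (subst sum.swap) simp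
  also have "\<dots> = (\<Sum>p\<in>?I \<times> ?I. complex_of_real (?b p) * kloosterman q (- fst p) (- snd p) * wave p z) / of_nat (totient q)"
    by (simp only: sum_distrib_left[symmetric] sum_distrib_right[symmetric] K)
  also have "\<dots> = (\<Sum>p\<in>?I \<times> ?I. ?t p)"
    unfolding sum_divide_distrib by (intro sum.cong refl) simp
  also have "\<dots> = ?t (0, 0) + (\<Sum>p\<in>?I \<times> ?I - {(0, 0)}. ?t p)"
    by (rule sum.remove) auto
  also have "?t (0, 0) = 1"
    using \<phi> M by (simp add: kloosterman_0 jackson_coeff_0 wave_def)
  finally show ?thesis by (simp add: frequency_box_def)
qed

lemma integral_W_minus_1_square_le:
  "(\<integral>z. (W z - 1)\<^sup>2 \<partial>unit_square) \<le> (\<Sum>(m, n)\<in>frequency_box (2 * M). (cmod (kloosterman q m n))\<^sup>2) / (real (totient q))\<^sup>2"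
proof -
  let ?c = "\<lambda>p. complex_of_real (jackson_coeff M (fst p) * jackson_coeff M (snd p) / real (totient q)) * kloosterman q (- fst p) (- snd p)"
  have "(W z - 1)\<^sup>2 = (cmod (\<Sum>p\<in>frequency_box (2 * M). ?c p * wave p z))\<^sup>2" for z
    unfolding W_minus_1_eq[symmetric] norm_of_real by simp
  then have "(\<integral>z. (W z - 1)\<^sup>2 \<partial>unit_square) = (\<Sum>p\<in>frequency_box (2 * M). (cmod (?c p))\<^sup>2)"
    using parseval_unit_square[of "frequency_box (2 * M)" ?c] by simp
  also have "\<dots> \<le> (\<Sum>p\<in>frequency_box (2 * M). (cmod (kloosterman q (fst p) (snd p)))\<^sup>2 / (real (totient q))\<^sup>2)"
  proof (rule sum_mono)
    fix p
    have "cmod (?c p) = \<bar>jackson_coeff M (fst p)\<bar> * \<bar>jackson_coeff M (snd p)\<bar> * (cmod (kloosterman q (fst p) (snd p)) / real (totient q))"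
      by (simp add: kloosterman_uminus norm_mult norm_divide)
    also have "\<dots> \<le> (1 * 1) * (cmod (kloosterman q (fst p) (snd p)) / real (totient q))"
      by (intro mult_right_mono mult_mono abs_jackson_coeff_le) auto
    finally have "(cmod (?c p))\<^sup>2 \<le> (cmod (kloosterman q (fst p) (snd p)) / real (totient q))\<^sup>2"
      by (intro power_mono) auto
    then show "(cmod (?c p))\<^sup>2 \<le> (cmod (kloosterman q (fst p) (snd p)))\<^sup>2 / (real (totient q))\<^sup>2"
      by (simp add: power_divide)
  qed
  finally show ?thesis by (simp add: sum_divide_distrib split_beta')
qed

text \<open>The fourth power arises from two squarings: Cauchy-Schwarz for the L^1 norm, and the box
  bound, which controls the square of the sum. With \<open>N = 2 * M\<close> the constant 16 becomes
  64, and four more divisor counts replace \<open>totient q\<close> by \<open>q\<close>.\<close>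

lemma integral_abs_W_power4_le:
  assumes small: "2 * (2 * M) * (2 * M) < q"
    and D: "\<And>k. 0 < k \<Longrightarrow> k \<le> (2 * M) * (2 * M) \<Longrightarrow> divisor_count k \<le> D"
  shows "(\<integral>z. \<bar>W z - 1\<bar> \<partial>unit_square) ^ 4
      \<le> 64 * (real M)\<^sup>2 * real (divisor_count q) ^ 8 * (real D + 1) / real q"
proof -
  define S where "S = (\<Sum>(m, n)\<in>frequency_box (2 * M). (cmod (kloosterman q m n))\<^sup>2)"
  let ?t = "real (divisor_count q)" and ?\<phi> = "real (totient q)"
  have \<phi>: "?\<phi> > 0" using q by simp
  have t: "?t \<ge> 0" by simp
  have "(\<integral>z. \<bar>W z - 1\<bar> \<partial>unit_square)\<^sup>2 \<le> S / ?\<phi>\<^sup>2"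
    using integral_abs_W_square_le integral_W_minus_1_square_le unfolding S_def by (rule order_trans)
  then have "((\<integral>z. \<bar>W z - 1\<bar> \<partial>unit_square)\<^sup>2)\<^sup>2 \<le> (S / ?\<phi>\<^sup>2)\<^sup>2" by (intro power_mono) auto
  then have "(\<integral>z. \<bar>W z - 1\<bar> \<partial>unit_square) ^ 4 \<le> S\<^sup>2 / ?\<phi> ^ 4" by (simp add: power_divide)
  also have "\<dots> \<le> (64 * (real M)\<^sup>2 * real q ^ 3 * ?t ^ 4 * (real D + 1)) / ?\<phi> ^ 4"
    using kloosterman_box_sum_le[OF q small D] unfolding S_def[symmetric]
    by (intro divide_right_mono) (auto simp: power_mult_distrib)
  also have "\<dots> \<le> 64 * (real M)\<^sup>2 * ?t ^ 8 * (real D + 1) / real q"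
  proof -
    have rearrange: "(64 * A * B * C * D) / E \<le> 64 * A * (C * C) * D / G"
      if "(64 * A * C * D) * (B / E) \<le> (64 * A * C * D) * (C / G)" for A B C D E G :: real
    proof -
      have "(64 * A * B * C * D) / E = (64 * A * C * D) * (B / E)"
        by (simp only: times_divide_eq_right) (simp only: mult_ac)
      also have "\<dots> \<le> (64 * A * C * D) * (C / G)" by (rule that)
      also have "\<dots> = 64 * A * (C * C) * D / G"
        by (simp only: times_divide_eq_right) (simp only: mult_ac)
      finally show ?thesis .
    qed
    have "real q \<le> ?\<phi> * ?t" using le_totient_mult_divisor_count[of q] q by (simp flip: of_nat_mult)
    then have "real q ^ 4 \<le> (?\<phi> * ?t) ^ 4" by (intro power_mono) auto
    moreover have "real q ^ 4 = real q * real q ^ 3" by (simp add: eval_nat_numeral)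
    ultimately have "real q * real q ^ 3 \<le> ?\<phi> ^ 4 * ?t ^ 4" by (simp only: power_mult_distrib)
    then have "real q ^ 3 / ?\<phi> ^ 4 \<le> ?t ^ 4 / real q"
      using \<phi> q by (subst frac_le_eq) (auto simp: divide_le_0_iff mult.commute)
    then have "(64 * (real M)\<^sup>2 * ?t ^ 4 * (real D + 1)) * (real q ^ 3 / ?\<phi> ^ 4)
        \<le> (64 * (real M)\<^sup>2 * ?t ^ 4 * (real D + 1)) * (?t ^ 4 / real q)"
      by (intro mult_left_mono) auto
    moreover have "?t ^ 8 = ?t ^ 4 * ?t ^ 4" by (simp flip: power_add)
    ultimately show ?thesis by (simp only: rearrange)
  qed
  finally show ?thesis .
qed

lemma measure_mu_ball: "measure (mu q) (ball (to_torus y) R) = A R y"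
proof -
  have "{d \<in> totatives q. inverse_point q d \<in> ball (to_torus y) R} = {d \<in> totatives q. torus_norm (sample q d - y) < R}"
    by (auto simp: inverse_point_def sample_def[symmetric] dist_to_torus[symmetric] dist_commute)
  then have "measure (mu q) (ball (to_torus y) R) = real (card {d \<in> totatives q. torus_norm (sample q d - y) < R}) / real (totient q)"
    by (simp add: measure_mu)
  also have "real (card {d \<in> totatives q. torus_norm (sample q d - y) < R}) = (\<Sum>d\<in>totatives q. disc_ind R (sample q d - y))"
    by (simp add: disc_ind_def sum.inter_filter[symmetric])
  finally show ?thesis by (simp add: A_def avg_def totient_def)
qed

lemma measure_deviation_torus_le:
  assumes R: "0 < R" "R \<le> 1 / 2" and \<epsilon>: "\<epsilon> > 0"
    and \<eta>: "0 < \<eta>" "\<eta> \<le> 1 / 8" "\<eta> \<le> \<epsilon> / 8"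
    and tail: "3 / ((real M)\<^sup>2 * (\<eta> * R)\<^sup>2) \<le> \<eta>"
    and small: "2 * (2 * M) * (2 * M) < q"
    and D: "\<And>k. 0 < k \<Longrightarrow> k \<le> (2 * M) * (2 * M) \<Longrightarrow> divisor_count k \<le> D"
    and X: "64 * (real M)\<^sup>2 * real (divisor_count q) ^ 8 * (real D + 1) / real q \<le> X"
  shows "measure torus_vol {y. \<bar>measure (mu q) (ball y R) - measure torus_vol (ball y R)\<bar> > \<epsilon> * measure torus_vol (ball y R)}
    \<le> (5 * X powr (1 / 4) + 3 / ((real M)\<^sup>2 * (\<eta> * R)\<^sup>2)) / \<eta>" (is "measure torus_vol ?S \<le> _")
proof -
  have tl: "tail (\<eta> * R) \<le> 3 / ((real M)\<^sup>2 * (\<eta> * R)\<^sup>2)"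
    unfolding tail_def using R \<eta> by (intro jackson2_tail_le M) auto
  define w where "w = (\<integral>z. \<bar>W z - 1\<bar> \<partial>unit_square)"
  have w: "w \<ge> 0" unfolding w_def by (rule Bochner_Integration.integral_nonneg) simp
  have wX: "w ^ 4 \<le> X" using integral_abs_W_power4_le[OF small D] X unfolding w_def by linarith
  have "w = (w ^ 4) powr (1 / 4)"
  proof (cases "w = 0")
    case False
    then have "w powr 4 = w ^ 4" using w by (intro powr_numeral) simp
    moreover have "(w powr 4) powr (1 / 4) = w"
      unfolding powr_powr using w by (simp add: powr_one)
    ultimately show ?thesis by simp
  qed simp
  also have "\<dots> \<le> X powr (1 / 4)" using wX w by (intro powr_mono2) auto
  finally have wle: "w \<le> X powr (1 / 4)" .
  have "measure torus_vol ?S \<le> measure unit_square {y. \<bar>A R y - disc_vol R\<bar> > \<epsilon> * disc_vol R}"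
  \<comment> \<open>A set that is not Borel has \<open>measure\<close> 0 by convention, so the
    inequality is settled without a measurability proof.\<close>
  proof (cases "?S \<in> sets borel")
    case True
    then have "measure torus_vol ?S = measure unit_square {y. to_torus y \<in> ?S}"
      by (rule measure_torus_vol_eq)
    also have "{y. to_torus y \<in> ?S} = {y. \<bar>A R y - disc_vol R\<bar> > \<epsilon> * disc_vol R}"
      by (simp add: measure_mu_ball measure_torus_vol_ball)
    finally show ?thesis by simp
  qed (simp add: measure_notin_sets)
  also have "\<dots> \<le> (5 * w + tail (\<eta> * R)) / \<eta>"
    unfolding w_def by (rule measure_deviation_le[OF R \<epsilon> \<eta> order_trans[OF tl tail]])
  also have "\<dots> \<le> (5 * X powr (1 / 4) + 3 / ((real M)\<^sup>2 * (\<eta> * R)\<^sup>2)) / \<eta>"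
    using wle tl \<eta> by (intro divide_right_mono add_mono) auto
  finally show ?thesis .
qed

end

section \<open>Choice of the parameters and passage to the limit\<close>

lemma deviation_eventually_le:
  fixes R :: "nat \<Rightarrow> real"
  assumes R: "\<forall>q>0. R q < 1 / 2" and \<delta>: "0 < \<delta>" "\<delta> < 1" and c: "c > 0"
    and Rc: "\<forall>\<^sub>F q in sequentially. R q \<ge> c * real q powr (- (1 / 2) + \<delta>)"
    and \<eta>: "0 < \<eta>" "\<eta> \<le> 1 / 8" "\<eta> \<le> \<epsilon> / 8"
  obtains K where "K \<ge> 0" "\<forall>\<^sub>F q in sequentially. measure torus_vol
       {y. \<bar>measure (mu q) (ball y (R q)) - measure torus_vol (ball y (R q))\<bar> > \<epsilon> * measure torus_vol (ball y (R q))}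
      \<le> (5 * (K * real q powr (- \<delta> / 2)) powr (1 / 4) + 192 / (\<eta>\<^sup>2 * c\<^sup>2) * real q powr (- \<delta>)) / \<eta>"
proof -
  \<comment> \<open>Eight factors \<open>divisor_count q\<close> and one \<open>D\<close> cost
    \<open>q powr (9 * e) = q powr (\<delta> / 2)\<close>, half of the saving
    \<open>q powr (- \<delta>)\<close> from \<open>M^2 / q\<close>.\<close>
  define e where "e = \<delta> / 18"
  have e: "e > 0" using \<delta> by (simp add: e_def)
  obtain C where C: "C \<ge> 1" "\<And>n. n > 0 \<Longrightarrow> real (divisor_count n) \<le> C * real n powr e"
    using divisor_count_bound[OF e] by blast
  define Q where "Q = (\<lambda>q::nat. real q powr ((1 - \<delta>) / 2))"
  have ev1: "\<forall>\<^sub>F q in sequentially. Q q \<ge> 8" unfolding Q_def using \<delta> by real_asymp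
  have ev2: "\<forall>\<^sub>F q in sequentially. 192 / (\<eta>\<^sup>2 * c\<^sup>2) * real q powr (- \<delta>) \<le> \<eta>"
  proof -
    have "(\<lambda>q::nat. 192 / (\<eta>\<^sup>2 * c\<^sup>2) * real q powr (- \<delta>)) \<longlonglongrightarrow> 192 / (\<eta>\<^sup>2 * c\<^sup>2) * 0"
      using \<delta> by (intro tendsto_mult tendsto_const) real_asymp
    then have "\<forall>\<^sub>F q in sequentially. 192 / (\<eta>\<^sup>2 * c\<^sup>2) * real q powr (- \<delta>) < \<eta>"
      using \<eta> by (intro order_tendstoD(2)) auto
    then show ?thesis by eventually_elim simp
  qed
  show ?thesis
  proof (rule that[of "8 * C ^ 9"])
    show "8 * C ^ 9 \<ge> 0" using C(1) by simp
    show "\<forall>\<^sub>F q in sequentially. measure torus_vol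
       {y. \<bar>measure (mu q) (ball y (R q)) - measure torus_vol (ball y (R q))\<bar> > \<epsilon> * measure torus_vol (ball y (R q))}
      \<le> (5 * (8 * C ^ 9 * real q powr (- \<delta> / 2)) powr (1 / 4) + 192 / (\<eta>\<^sup>2 * c\<^sup>2) * real q powr (- \<delta>)) / \<eta>"
      using ev1 ev2 Rc eventually_gt_at_top[of 1]
    proof eventually_elim
      fix q :: nat
      assume Q8: "Q q \<ge> 8" and tl: "192 / (\<eta>\<^sup>2 * c\<^sup>2) * real q powr (- \<delta>) \<le> \<eta>"
        and Rq: "R q \<ge> c * real q powr (- (1 / 2) + \<delta>)" and q: "1 < q"
      \<comment> \<open>The frequencies reach \<open>2 * M <= Q q / 2\<close>, so
        \<open>2 * (2 * M)^2\<close> is at most half of \<open>q powr (1 - \<delta>)\<close>.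
        \<open>Q q >= 8\<close> keeps the rounded value above \<open>Q q / 8\<close>.\<close>
      define M where "M = nat \<lfloor>Q q / 4\<rfloor>"
      have M_le: "real M \<le> Q q / 4" using Q8 unfolding M_def by linarith
      have M_ge: "real M \<ge> Q q / 8" using Q8 unfolding M_def by linarith
      have M0: "M > 0" using M_ge Q8 by (cases M) auto
      have q0: "real q > 0" using q by simp
      have Q2: "(Q q)\<^sup>2 = real q powr (1 - \<delta>)" using q0 by (simp add: Q_def power2_eq_square flip: powr_add)
      have Mq: "(real M)\<^sup>2 \<le> real q powr (1 - \<delta>) / 16"
        using power_mono[OF M_le, of 2] by (simp add: power_divide Q2)
      have le_q: "real q powr (1 - \<delta>) \<le> real q"
        using q \<delta> powr_mono[of "1 - \<delta>" 1 "real q"] by simp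
      have small: "2 * (2 * M) * (2 * M) < q"
      proof -
        have "real (2 * (2 * M) * (2 * M)) = 8 * (real M)\<^sup>2" by (simp add: power2_eq_square)
        also have "\<dots> < real q" using Mq le_q q0 by linarith
        finally show ?thesis by (simp only: of_nat_less_iff)
      qed
      define D where "D = nat \<lfloor>C * real q powr e\<rfloor>"
      have Cq: "C * real q powr e \<ge> 1"
        using mult_mono[of 1 C 1 "real q powr e"] C(1) q e by (simp add: ge_one_powr_ge_zero)
      have D: "divisor_count k \<le> D" if "0 < k" "k \<le> (2 * M) * (2 * M)" for k
      proof -
        have "k \<le> q" using that(2) small by linarith
        have "real (divisor_count k) \<le> C * real k powr e" by (rule C(2)[OF that(1)])
        also have "\<dots> \<le> C * real q powr e" using C(1) e \<open>k \<le> q\<close> by (intro mult_left_mono powr_mono2) auto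
        finally show ?thesis unfolding D_def by (simp add: le_nat_floor)
      qed
      have D1: "real D + 1 \<le> 2 * (C * real q powr e)" using Cq unfolding D_def by linarith
      have X: "64 * (real M)\<^sup>2 * real (divisor_count q) ^ 8 * (real D + 1) / real q \<le> 8 * C ^ 9 * real q powr (- \<delta> / 2)"
      proof -
        have "64 * (real M)\<^sup>2 * real (divisor_count q) ^ 8 * (real D + 1) / real q
           \<le> 64 * (real q powr (1 - \<delta>) / 16) * (C * real q powr e) ^ 8 * (2 * (C * real q powr e)) / real q"
          using Mq D1 C(1) C(2)[of q] q by (intro divide_right_mono mult_mono power_mono mult_nonneg_nonneg) auto
        also have "\<dots> = 8 * C ^ 9 * ((real q powr (1 - \<delta>) * (real q powr e) ^ 9) * real q powr (-1))"
        proof -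
          have *: "64 * (Y / 16) * (C * Z) ^ 8 * (2 * (C * Z)) = 8 * Y * (C * Z) ^ 9" for Y Z by (simp add: eval_nat_numeral)
          have "real q powr (-1) = 1 / real q" using q0 by (simp add: powr_minus divide_simps)
          then show ?thesis unfolding * by (simp add: power_mult_distrib)
        qed
        also have "(real q powr (1 - \<delta>) * (real q powr e) ^ 9) * real q powr (-1) = real q powr (- \<delta> / 2)"
        proof -
          have e9: "(real q powr e) ^ 9 = real q powr (9 * e)"
            using q0 by (simp add: powr_power)
          show ?thesis unfolding e9 powr_add[symmetric] by (simp add: e_def)
        qed
        finally show ?thesis by simp
      qed
      have R0: "R q > 0" using Rq c q0 by (smt (verit) mult_pos_pos powr_gt_zero)
      have tail: "3 / ((real M)\<^sup>2 * (\<eta> * R q)\<^sup>2) \<le> 192 / (\<eta>\<^sup>2 * c\<^sup>2) * real q powr (- \<delta>)"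
      proof -
        \<comment> \<open>\<open>M * R q\<close> is at least
          \<open>c / 8 * q powr (\<delta> / 2)\<close>: the disc is wider than the kernel by a power
          of \<open>q\<close>. Squaring the 8 gives \<open>192 = 3 * 64\<close>.\<close>
        have "Q q / 8 * (c * real q powr (- (1 / 2) + \<delta>)) \<le> real M * R q"
          using M_ge Rq c Q8 by (intro mult_mono) auto
        moreover have "Q q * real q powr (- (1 / 2) + \<delta>) = real q powr (\<delta> / 2)"
          unfolding Q_def by (simp add: field_simps flip: powr_add)
        ultimately have "c / 8 * real q powr (\<delta> / 2) \<le> real M * R q" by (simp add: mult_ac)
        then have "(c / 8 * real q powr (\<delta> / 2))\<^sup>2 \<le> (real M * R q)\<^sup>2" using c by (intro power_mono) auto
        moreover have "(real q powr (\<delta> / 2))\<^sup>2 = real q powr \<delta>" by (simp add: power2_eq_square flip: powr_add)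
        ultimately have *: "c\<^sup>2 / 64 * real q powr \<delta> \<le> (real M * R q)\<^sup>2" by (simp add: power_mult_distrib power_divide)
        have "3 / ((real M)\<^sup>2 * (\<eta> * R q)\<^sup>2) = 3 / (\<eta>\<^sup>2 * (real M * R q)\<^sup>2)" by (simp add: power_mult_distrib mult_ac)
        also have "\<dots> \<le> 3 / (\<eta>\<^sup>2 * (c\<^sup>2 / 64 * real q powr \<delta>))"
          using * \<eta> c q0 R0 M0 by (intro divide_left_mono mult_left_mono mult_pos_pos) auto
        also have "\<dots> = 192 / (\<eta>\<^sup>2 * c\<^sup>2) * real q powr (- \<delta>)"
          by (simp add: powr_minus field_simps)
        finally show ?thesis .
      qed
      have "measure torus_vol
       {y. \<bar>measure (mu q) (ball y (R q)) - measure torus_vol (ball y (R q))\<bar> > \<epsilon> * measure torus_vol (ball y (R q))}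
        \<le> (5 * (8 * C ^ 9 * real q powr (- \<delta> / 2)) powr (1 / 4) + 3 / ((real M)\<^sup>2 * (\<eta> * R q)\<^sup>2)) / \<eta>"
        using R q \<eta> tail tl
        by (intro measure_deviation_torus_le[OF q M0 R0 _ _ \<eta> _ small D X]) (auto intro: less_imp_le)
      also have "\<dots> \<le> (5 * (8 * C ^ 9 * real q powr (- \<delta> / 2)) powr (1 / 4) + 192 / (\<eta>\<^sup>2 * c\<^sup>2) * real q powr (- \<delta>)) / \<eta>"
        using tail \<eta> by (intro divide_right_mono add_left_mono) auto
      finally show "measure torus_vol
       {y. \<bar>measure (mu q) (ball y (R q)) - measure torus_vol (ball y (R q))\<bar> > \<epsilon> * measure torus_vol (ball y (R q))}
        \<le> (5 * (8 * C ^ 9 * real q powr (- \<delta> / 2)) powr (1 / 4) + 192 / (\<eta>\<^sup>2 * c\<^sup>2) * real q powr (- \<delta>)) / \<eta>" .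
    qed
  qed
qed

theorem theorem1p2:
  fixes R :: "nat \<Rightarrow> real"
  assumes "\<forall>q>0. R q < 1 / 2"
    and "\<exists>\<delta>>0. \<exists>c>0. \<forall>\<^sub>F q in sequentially. R q \<ge> c * real q powr (- (1 / 2) + \<delta>)"
  shows "\<forall>\<epsilon>>0.
    (\<lambda>q. measure torus_vol
       {y. \<bar>measure (mu q) (ball y (R q)) - measure torus_vol (ball y (R q))\<bar>
             > \<epsilon> * measure torus_vol (ball y (R q))}) \<longlonglongrightarrow> 0"
proof (intro allI impI)
  fix \<epsilon> :: real assume \<epsilon>: "\<epsilon> > 0"
  obtain \<delta>' c where \<delta>': "\<delta>' > 0" and c: "c > 0"
    and ev': "\<forall>\<^sub>F q in sequentially. R q \<ge> c * real q powr (- (1 / 2) + \<delta>')"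
    using assms(2) by blast
  \<comment> \<open>A smaller exponent weakens the lower bound on \<open>R\<close> for
    \<open>q >= 1\<close> and secures \<open>\<delta> < 1\<close>, so that the frequency cutoff
    tends to infinity.\<close>
  define \<delta> where "\<delta> = min \<delta>' (1 / 2)"
  have \<delta>: "0 < \<delta>" "\<delta> < 1" using \<delta>' by (auto simp: \<delta>_def)
  have ev: "\<forall>\<^sub>F q in sequentially. R q \<ge> c * real q powr (- (1 / 2) + \<delta>)"
    using ev' eventually_gt_at_top[of 0]
  proof eventually_elim
    fix q :: nat assume *: "R q \<ge> c * real q powr (- (1 / 2) + \<delta>')" "0 < q"
    have "c * real q powr (- (1 / 2) + \<delta>) \<le> c * real q powr (- (1 / 2) + \<delta>')"
      using *(2) c by (intro mult_left_mono powr_mono) (auto simp: \<delta>_def)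
    with *(1) show "R q \<ge> c * real q powr (- (1 / 2) + \<delta>)" by linarith
  qed
  \<comment> \<open>\<open>\<eta>\<close> need not depend on \<open>q\<close>: shrinking or
    enlarging the disc by a fixed proportion changes its area by a relative amount within
    \<open>\<epsilon>\<close>.\<close>
  define \<eta> where "\<eta> = min 1 \<epsilon> / 8"
  have \<eta>: "0 < \<eta>" "\<eta> \<le> 1 / 8" "\<eta> \<le> \<epsilon> / 8" using \<epsilon> by (auto simp: \<eta>_def)
  obtain K where K0: "K \<ge> 0" and K: "\<forall>\<^sub>F q in sequentially. measure torus_vol
       {y. \<bar>measure (mu q) (ball y (R q)) - measure torus_vol (ball y (R q))\<bar> > \<epsilon> * measure torus_vol (ball y (R q))}
      \<le> (5 * (K * real q powr (- \<delta> / 2)) powr (1 / 4) + 192 / (\<eta>\<^sup>2 * c\<^sup>2) * real q powr (- \<delta>)) / \<eta>"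
    using deviation_eventually_le[OF assms(1) \<delta> c ev \<eta>] by blast
  have l1: "(\<lambda>q::nat. real q powr (- \<delta> / 2)) \<longlonglongrightarrow> 0" using \<delta> by real_asymp
  have l2: "(\<lambda>q::nat. real q powr (- \<delta>)) \<longlonglongrightarrow> 0" using \<delta> by real_asymp
  have "(\<lambda>q::nat. (K * real q powr (- \<delta> / 2)) powr (1 / 4)) \<longlonglongrightarrow> 0"
  proof -
    have "(\<lambda>q::nat. K powr (1 / 4) * real q powr (- \<delta> / 2 * (1 / 4))) \<longlonglongrightarrow> 0"
    proof (rule tendsto_mult_right_zero)
      show "(\<lambda>q::nat. real q powr (- \<delta> / 2 * (1 / 4))) \<longlonglongrightarrow> 0" using \<delta> by real_asymp
    qed
    then show ?thesis using K0 by (simp add: powr_mult powr_powr)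
  qed
  then have lim: "(\<lambda>q::nat. (5 * (K * real q powr (- \<delta> / 2)) powr (1 / 4) + 192 / (\<eta>\<^sup>2 * c\<^sup>2) * real q powr (- \<delta>)) / \<eta>) \<longlonglongrightarrow> 0"
    using l2 by (intro tendsto_divide_zero tendsto_add_zero tendsto_mult_right_zero)
  show "(\<lambda>q. measure torus_vol
       {y. \<bar>measure (mu q) (ball y (R q)) - measure torus_vol (ball y (R q))\<bar>
             > \<epsilon> * measure torus_vol (ball y (R q))}) \<longlonglongrightarrow> 0"
    by (rule tendsto_sandwich[OF always_eventually K tendsto_const lim]) simp
qed

end
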